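(* Let $X,X_1,X_2,\dots$ be i.i.d. real random variables with common Lebesgue density $f$, and assume $f$ is bounded. Let $\phi$ be a bounded, compactly supported scaling function, and let $\{j_n\}_{n\ge1}$ be a sequence of integers with $j_n\to\infty$ and $2^{-j_n}\asymp n^{-\delta}$ for some $\delta\in(0,1/3)$. Assume that there exists $L\ge0$ such that $f$ is Hölder continuous with exponent $\alpha$, $0<\alpha\le1$, on $[-L,L]$, $f$ is monotonically increasing on $(-\infty,-L]$, and $f$ is monotonically decreasing on $[L,\infty)$. Let $f_{n,K}$ be the linear wavelet density estimator of $f$ based on $X_1,\dots,X_n$, put $$J_n:=\|f_{n,K}-f\|_2^2-\mathbb E\|f_{n,K}-f\|_2^2,\qquad \sigma^2:=2\int_{\mathbb R}f^2(x)\,dx,\quad\sigma>0,$$ and let $Z\sim\mathcal N(0,1)$. Then there exists a constant $C$ (depending on $f$, $\phi$ and $\{j_n\}$) such that, for all $n$, $$\sup_{t\in\mathbb R}\left|\Pr\{n2^{-j_n/2}J_n\le t\}-\Pr\{\sigma Z\le t\}\right|\le C\left(n^{-3\delta/16}\vee n^{-\alpha\delta}\sqrt{\log n}\right).$$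
   Context: Notation: $a_n\asymp b_n$ means $0<\liminf a_n/b_n<\limsup a_n/b_n<\infty$; $a\vee b=\max(a,b)$; $\|\cdot\|_2$ is the $L_2(\mathbb R)$ norm. A scaling function $\phi\in L_2(\mathbb R)$ is the (father) scaling function of an orthonormal wavelet multiresolution analysis, with corresponding wavelet function $\psi$: writing $\phi_{0k}(x)=\phi(x-k)$ and $\psi_{jk}(x)=2^{j/2}\psi(2^jx-k)$, the family $\{\phi_{0k},\psi_{jk}: j\ge0,k\in\mathbb Z\}$ is an orthonormal wavelet basis of $L_2(\mathbb R)$. The linear wavelet density estimator is $$f_{n,K}(x)=\sum_k\hat\alpha_{0k}\phi_{0k}(x)+\sum_{j=0}^{j_n-1}\sum_k\hat\beta_{jk}\psi_{jk}(x),\quad \hat\alpha_{0k}=\frac1n\sum_{i=1}^n\phi_{0k}(X_i),\quad \hat\beta_{jk}=\frac1n\sum_{i=1}^n\psi_{jk}(X_i),$$ which, for bounded compactly supported $\phi$, is equivalently written $$f_{n,K}(x)=\frac{2^{j_n}}{n}\sum_{i=1}^nK(2^{j_n}x,2^{j_n}X_i),\qquad K(x,y)=\sum_{k\in\mathbb Z}\phi(x-k)\phi(y-k).$$ *)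

theory Defs
  imports "HOL-Probability.Probability"
begin

text \<open>
  Elements of \<open>L\<^sub>2\<close> are represented by real functions, not by equivalence classes; the
  subspace and basis notions are invariant under modification on Lebesgue null sets, while the
  estimator evaluates the wavelets pointwise at the sample points.
\<close>

definition L2_fun :: "(real \<Rightarrow> real) set" where
  "L2_fun = {g. g \<in> borel_measurable lborel \<and> integrable lborel (\<lambda>x. (g x)\<^sup>2)}"

definition l2norm :: "(real \<Rightarrow> real) \<Rightarrow> real" where
  "l2norm g = sqrt (LINT x|lborel. (g x)\<^sup>2)"

definition l2inner :: "(real \<Rightarrow> real) \<Rightarrow> (real \<Rightarrow> real) \<Rightarrow> real" where
  "l2inner g h = (LINT x|lborel. g x * h x)"

definition closed_L2_subspace :: "(real \<Rightarrow> real) set \<Rightarrow> bool" where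
  "closed_L2_subspace S \<longleftrightarrow>
     S \<subseteq> L2_fun \<and> (\<lambda>x. 0) \<in> S \<and>
     (\<forall>g\<in>S. \<forall>h\<in>S. (\<lambda>x. g x + h x) \<in> S) \<and>
     (\<forall>c. \<forall>g\<in>S. (\<lambda>x. c * g x) \<in> S) \<and>
     (\<forall>g\<in>L2_fun. (\<forall>\<epsilon>>0. \<exists>h\<in>S. l2norm (\<lambda>x. g x - h x) < \<epsilon>) \<longrightarrow> g \<in> S)"

definition L2_orthonormal_basis :: "('i \<Rightarrow> real \<Rightarrow> real) \<Rightarrow> (real \<Rightarrow> real) set \<Rightarrow> bool" where
  "L2_orthonormal_basis e S \<longleftrightarrow>
     (\<forall>i. e i \<in> S) \<and>
     (\<forall>i i'. l2inner (e i) (e i') = (if i = i' then 1 else 0)) \<and>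
     (\<forall>g\<in>S. \<forall>\<epsilon>>0. \<exists>F c. finite F \<and> l2norm (\<lambda>x. g x - (\<Sum>i\<in>F. c i * e i x)) < \<epsilon>)"

definition father :: "(real \<Rightarrow> real) \<Rightarrow> int \<Rightarrow> real \<Rightarrow> real" where
  "father \<phi> k x = \<phi> (x - of_int k)"

definition mother :: "(real \<Rightarrow> real) \<Rightarrow> nat \<Rightarrow> int \<Rightarrow> real \<Rightarrow> real" where
  "mother \<psi> j k x = 2 powr (real j / 2) * \<psi> (2 ^ j * x - of_int k)"

definition orthonormal_mra :: "(int \<Rightarrow> (real \<Rightarrow> real) set) \<Rightarrow> (real \<Rightarrow> real) \<Rightarrow> bool" where
  "orthonormal_mra V \<phi> \<longleftrightarrow>
     (\<forall>m. closed_L2_subspace (V m)) \<and>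
     (\<forall>m. V m \<subseteq> V (m + 1)) \<and>
     (\<forall>m g. g \<in> V m \<longleftrightarrow> (\<lambda>x. g (2 * x)) \<in> V (m + 1)) \<and>
     (\<forall>g. (\<forall>m. g \<in> V m) \<longrightarrow> (AE x in lborel. g x = 0)) \<and>
     (\<forall>g\<in>L2_fun. \<forall>\<epsilon>>0. \<exists>m. \<exists>h\<in>V m. l2norm (\<lambda>x. g x - h x) < \<epsilon>) \<and>
     L2_orthonormal_basis (father \<phi>) (V 0)"

definition scaling_function :: "(real \<Rightarrow> real) \<Rightarrow> bool" where
  "scaling_function \<phi> \<longleftrightarrow> (\<exists>V. orthonormal_mra V \<phi>)"

definition wavelet_system ::
    "(real \<Rightarrow> real) \<Rightarrow> (real \<Rightarrow> real) \<Rightarrow> int + nat \<times> int \<Rightarrow> real \<Rightarrow> real" where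
  "wavelet_system \<phi> \<psi> i = (case i of Inl k \<Rightarrow> father \<phi> k | Inr (j, k) \<Rightarrow> mother \<psi> j k)"

definition wavelet_function :: "(real \<Rightarrow> real) \<Rightarrow> (real \<Rightarrow> real) \<Rightarrow> bool" where
  "wavelet_function \<phi> \<psi> \<longleftrightarrow>
     (\<exists>V. orthonormal_mra V \<phi> \<and> \<psi> \<in> V 1) \<and>
     L2_orthonormal_basis (wavelet_system \<phi> \<psi>) L2_fun"

definition alpha_hat ::
    "(real \<Rightarrow> real) \<Rightarrow> (nat \<Rightarrow> 'a \<Rightarrow> real) \<Rightarrow> nat \<Rightarrow> 'a \<Rightarrow> int \<Rightarrow> real" where
  "alpha_hat \<phi> X n \<omega> k = (1 / real n) * (\<Sum>i=1..n. father \<phi> k (X i \<omega>))"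

definition beta_hat ::
    "(real \<Rightarrow> real) \<Rightarrow> (nat \<Rightarrow> 'a \<Rightarrow> real) \<Rightarrow> nat \<Rightarrow> 'a \<Rightarrow> nat \<Rightarrow> int \<Rightarrow> real" where
  "beta_hat \<psi> X n \<omega> j k = (1 / real n) * (\<Sum>i=1..n. mother \<psi> j k (X i \<omega>))"

text \<open>
  For every \<open>\<psi> \<in> L\<^sub>2\<close> the sum of \<open>(\<psi> (x - k))\<^sup>2\<close> over \<open>k\<close> is finite for almost every \<open>x\<close>. Hence, the
  \<open>X i\<close> having a density, the series over \<open>k\<close> below converge absolutely for almost every \<open>x\<close>, almost
  surely. For negative \<open>J\<close> the sum over \<open>j\<close> is empty.
\<close>

definition wavelet_estimator ::
    "(real \<Rightarrow> real) \<Rightarrow> (real \<Rightarrow> real) \<Rightarrow> int \<Rightarrow> (nat \<Rightarrow> 'a \<Rightarrow> real) \<Rightarrow> nat \<Rightarrow> 'a \<Rightarrow> real \<Rightarrow> real" where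
  "wavelet_estimator \<phi> \<psi> J X n \<omega> x =
     (\<Sum>\<^sub>\<infinity>k\<in>UNIV. alpha_hat \<phi> X n \<omega> k * father \<phi> k x) +
     (\<Sum>j<nat J. \<Sum>\<^sub>\<infinity>k\<in>UNIV. beta_hat \<psi> X n \<omega> j k * mother \<psi> j k x)"

definition ise ::
    "(real \<Rightarrow> real) \<Rightarrow> (real \<Rightarrow> real) \<Rightarrow> (real \<Rightarrow> real) \<Rightarrow> int \<Rightarrow> (nat \<Rightarrow> 'a \<Rightarrow> real) \<Rightarrow> nat \<Rightarrow> 'a \<Rightarrow> real"
  where
  "ise f \<phi> \<psi> J X n \<omega> = (l2norm (\<lambda>x. wavelet_estimator \<phi> \<psi> J X n \<omega> x - f x))\<^sup>2"

definition centered_ise ::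
    "'a measure \<Rightarrow> (real \<Rightarrow> real) \<Rightarrow> (real \<Rightarrow> real) \<Rightarrow> (real \<Rightarrow> real) \<Rightarrow> int \<Rightarrow>
      (nat \<Rightarrow> 'a \<Rightarrow> real) \<Rightarrow> nat \<Rightarrow> 'a \<Rightarrow> real" where
  "centered_ise M f \<phi> \<psi> J X n \<omega> =
     ise f \<phi> \<psi> J X n \<omega> - (LINT \<omega>'|M. ise f \<phi> \<psi> J X n \<omega>')"

definition iid_with_density ::
    "'a measure \<Rightarrow> (nat \<Rightarrow> 'a \<Rightarrow> real) \<Rightarrow> (real \<Rightarrow> real) \<Rightarrow> bool" where
  "iid_with_density M X f \<longleftrightarrow>
     prob_space.indep_vars M (\<lambda>_. borel) X {1..} \<and>
     (\<forall>i\<ge>1. distributed M lborel (X i) (\<lambda>x. ennreal (f x)))"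

text \<open>
  The inequality between lower and upper limit is strict. If \<open>a n\<close> is \<open>2 powr - j n\<close> with integers
  \<open>j n\<close> and \<open>b n\<close> is \<open>n powr - \<delta>\<close> with \<open>\<delta> > 0\<close>, this is automatic, since \<open>a n / b n\<close> cannot converge
  to a positive limit.
\<close>

definition same_order :: "(nat \<Rightarrow> real) \<Rightarrow> (nat \<Rightarrow> real) \<Rightarrow> bool" where
  "same_order a b \<longleftrightarrow>
     0 < liminf (\<lambda>n. ereal (a n / b n)) \<and>
     liminf (\<lambda>n. ereal (a n / b n)) < limsup (\<lambda>n. ereal (a n / b n)) \<and>
     limsup (\<lambda>n. ereal (a n / b n)) < \<infinity>"

definition holder_on :: "real set \<Rightarrow> real \<Rightarrow> (real \<Rightarrow> real) \<Rightarrow> bool" where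
  "holder_on S \<alpha> g \<longleftrightarrow> (\<exists>H. \<forall>x\<in>S. \<forall>y\<in>S. \<bar>g x - g y\<bar> \<le> H * \<bar>x - y\<bar> powr \<alpha>)"

end

theory Submission
  imports Defs "HOL-Real_Asymp.Real_Asymp"
begin

text \<open>
  Let \<open>N = 2 ^ J\<close> and let \<open>P\<close> be the projection kernel of the resolution space of level \<open>J\<close>. The
  wavelet system up to level \<open>J\<close> and the dilated scaling functions are two orthonormal bases of that
  space, so the estimator is almost surely the average of the functions \<open>P (\<cdot>, X i)\<close>, up to a null
  set (\<open>estimator_eq_kernel\<close>). Since \<open>P\<close> reproduces itself, with \<open>g(x) = \<integral> P(x,y) f(y) dy\<close> the
  integrated squared error equals
  \<open>(1/n\<^sup>2) \<Sum> P(X i, X k) - (2/n) \<Sum> g(X i) + \<integral> f\<^sup>2\<close>. Subtracting its mean turns it into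
  \<open>(1/n\<^sup>2)\<close> times the off-diagonal sum of \<open>H(x,y) = P(x,y) - g(x) - g(y) + \<theta>\<close>, which integrates to
  zero in each variable, plus a centred diagonal sum of smaller order (\<open>ise_stat_decomp\<close>). The bias
  contributes a constant only, because the error of projection is orthogonal to the fluctuations.

  The quadratic form is treated by Stein's method. Let \<open>h\<close> be a symmetric kernel that integrates to
  zero in each variable, \<open>D i = \<Sum>k\<noteq>i. h(X i, X k)\<close>, \<open>W = (1/2) \<Sum> D i\<close> and \<open>T = (1/2) \<Sum> (D i)\<^sup>2\<close>. The
  variable \<open>W - D i\<close> does not involve \<open>X i\<close>, whereas \<open>D i\<close> has conditional mean zero given the other
  coordinates. Hence \<open>E W F(W) = (1/2) \<Sum> E D i (F(W) - F(W - D i))\<close>, which is \<open>E T F'(W)\<close> up to a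
  third-order term. If \<open>F\<close> solves Stein's equation for a test function \<open>G\<close> with values in \<open>[0,1]\<close>,
  the distance of \<open>E G(W)\<close> from its Gaussian value is thus \<open>E F'(W) (1 - T)\<close> up to that term. The
  derivative \<open>F'\<close> is bounded by \<open>2\<close> no matter how steep \<open>G\<close> is, so that approximating an indicator
  by a function of slope \<open>1/\<epsilon>\<close> costs nothing in the leading term \<open>E \<bar>1 - T\<bar>\<close>; only the remainder
  sees \<open>\<epsilon>\<close> (\<open>smooth_distance_le\<close>).

  For \<open>h = 2 H / (\<sigma> n \<surd>N)\<close> the variance of \<open>T\<close> is of order \<open>1/N + N/n\<close> and the remainder of order
  \<open>\<surd>(N/n) / \<epsilon>\<close>. The mean of \<open>T\<close> tends to \<open>1\<close>: it is \<open>2/(\<sigma>\<^sup>2 N) \<integral>\<integral> P\<^sup>2 f f\<close> up to terms of order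
  \<open>1/N + 1/n\<close>, the integral of \<open>P(x,\<cdot>)\<^sup>2\<close> is \<open>P(x,x)\<close>, and \<open>P(x,x)\<close> has average \<open>N\<close> over each period
  of length \<open>1/N\<close>. Replacing \<open>f(y)\<close> by \<open>f(x)\<close> and averaging over a period both cost the \<open>L\<^sub>1\<close> modulus
  of continuity of \<open>f\<close> at scale \<open>1/N\<close>. It is of order \<open>N\<close> to the power \<open>-\<alpha>\<close>, since \<open>f\<close> is Hoelder on
  a compact interval and monotone outside (\<open>L1_modulus_of_continuity\<close>). With \<open>\<epsilon> = (N/n)\<close> to the
  power \<open>1/4\<close> the distance of distribution functions is at most a constant times the sum of \<open>N\<close> to
  the power \<open>-\<alpha>\<close>, \<open>N\<close> to the power \<open>-1/2\<close> and \<open>(N/n)\<close> to the power \<open>1/4\<close>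
  (\<open>stat_normal_approximation\<close>). For \<open>N\<close> of order \<open>n\<close> to the power \<open>\<delta>\<close> with \<open>\<delta> < 1/3\<close> this is of the
  claimed order.
\<close>

section \<open>Stein's equation for the normal law\<close>

text \<open>
  Dividing the signed distribution function \<open>G(x) = \<integral> (h - m) d\<gamma>\<close> over \<open>(-\<infinity>, x]\<close> by the density gives
  the solution. \<open>G\<close> vanishes at both infinities, and comparing its derivative with that of the
  density divided by \<open>x\<close> gives the Mills-type bound \<open>\<bar>x G(x)\<bar> \<le> density\<close>, from which all estimates
  follow. The bounds \<open>6\<close> and \<open>2\<close> hold uniformly in \<open>h\<close>; this uniformity is what later allows steep
  test functions.
\<close>

lemma stein_equation_solution:
  fixes h :: "real \<Rightarrow> real"
  assumes cont: "continuous_on UNIV h" and h01: "\<And>x. 0 \<le> h x" "\<And>x. h x \<le> 1"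
  defines "m \<equiv> (LINT x|lborel. std_normal_density x * h x)"
  obtains F F' where "\<And>x. (F has_real_derivative F' x) (at x)"
    "\<And>x. F' x = x * F x + h x - m" "\<And>x. \<bar>F x\<bar> \<le> 6" "\<And>x. \<bar>F' x\<bar> \<le> 2"
proof -
  let ?d = "std_normal_density"
  have [measurable]: "h \<in> borel_measurable borel"
    using cont by (rule borel_measurable_continuous_onI)
  have intd: "integrable lborel ?d" by simp
  have d0: "0 < ?d x" for x by (simp add: normal_density_pos)
  have inth: "integrable lborel (\<lambda>x. ?d x * h x)"
    by (rule Bochner_Integration.integrable_bound[OF intd])
       (auto simp: abs_mult h01 mult_left_le)
  have m01: "0 \<le> m" "m \<le> 1"
  proof -
    show "0 \<le> m" unfolding m_def by (intro Bochner_Integration.integral_nonneg) (auto simp: h01)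
    have "m \<le> (LINT x|lborel. ?d x)" unfolding m_def
      by (intro integral_mono inth intd) (auto simp: h01 mult_left_le)
    then show "m \<le> 1" by (simp add: integral_normal_density)
  qed
  define g where "g s = ?d s * (h s - m)" for s
  have intg: "integrable lborel g"
    unfolding g_def right_diff_distrib using inth intd by auto
  have gcont: "continuous_on A g" for A
    unfolding g_def std_normal_density_def
    by (intro continuous_intros continuous_on_subset[OF cont]) auto
  have g_tot: "(LINT s|lborel. g s) = 0"
    unfolding g_def right_diff_distrib using inth intd by (simp add: m_def integral_normal_density)
  have hm: "\<bar>h s - m\<bar> \<le> 1" for s using h01[of s] m01 by linarith
  have g_le: "\<bar>g s\<bar> \<le> ?d s" for s
    unfolding g_def abs_mult using hm[of s] d0[of s] by (simp add: mult_left_le)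
  define G where "G x = (LINT s|lborel. indicator {..x} s *\<^sub>R g s)" for x
  have G_top: "(G \<longlongrightarrow> 0) at_top"
    unfolding G_def g_tot[symmetric]
    by (rule tendsto_integral_at_top) (auto intro: intg)
  have G_le1: "\<bar>G x\<bar> \<le> 1" for x
  proof -
    have "\<bar>G x\<bar> \<le> (LINT s|lborel. ?d s)"
      unfolding G_def
      by (rule order_trans[OF integral_abs_bound], intro integral_mono' intd)
         (use g_le in \<open>auto simp: indicator_def\<close>)
    then show ?thesis by (simp add: integral_normal_density)
  qed
  have G_diff: "G u = G a + (LBINT y=a..u. g y)" if "a \<le> u" for a u :: real
  proof -
    have "G u = (LINT s|lborel. indicator {..a} s *\<^sub>R g s + indicator {a<..u} s *\<^sub>R g s)"
      unfolding G_def using that by (intro Bochner_Integration.integral_cong) (auto simp: indicator_def)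
    also have "\<dots> = G a + (LINT s|lborel. indicator {a<..u} s *\<^sub>R g s)"
      unfolding G_def
      by (intro Bochner_Integration.integral_add integrable_mult_indicator intg) auto
    finally show ?thesis
      using that by (simp add: interval_integral_Ioc set_lebesgue_integral_def)
  qed
  have G_deriv: "(G has_real_derivative g x) (at x)" for x
  proof -
    have "((\<lambda>u. LBINT y=x-1..u. g y) has_vector_derivative g x) (at x within {x-1..x+1})"
      by (rule interval_integral_FTC2[OF _ _ gcont]) auto
    then have "((\<lambda>u. G (x-1) + (LBINT y=x-1..u. g y)) has_vector_derivative 0 + g x) (at x within {x-1..x+1})"
      by (intro has_vector_derivative_add has_vector_derivative_const)
    then have "(G has_vector_derivative 0 + g x) (at x within {x-1..x+1})"
      by (rule has_vector_derivative_transform[rotated 2]) (auto intro: G_diff)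
    then have "(G has_vector_derivative g x) (at x)"
      by (simp add: at_within_Icc_at)
    then show ?thesis by (simp add: has_real_derivative_iff_has_vector_derivative)
  qed
  have d_deriv: "(?d has_real_derivative (- x * ?d x)) (at x)" for x
    unfolding std_normal_density_def[abs_def]
    by (auto intro!: derivative_eq_intros simp: field_simps power2_eq_square)
  have G_bot: "(G \<longlongrightarrow> 0) at_bot"
  proof -
    have intk: "integrable lborel (\<lambda>s. g (- s))"
      using lborel_integrable_real_affine[OF intg, of "-1" 0] by simp
    have k_tot: "(LINT s|lborel. g (- s)) = 0"
      using lborel_integral_real_affine[of "-1" g 0] g_tot by simp
    have "G (- x) = - (LINT s|lborel. indicator {..x} s *\<^sub>R g (- s))" for x
    proof -
      have "G (- x) = (LINT s|lborel. indicator {..-x} (-s) *\<^sub>R g (- s))"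
        unfolding G_def using lborel_integral_real_affine[of "-1" "\<lambda>s. indicator {..-x} s *\<^sub>R g s" 0] by simp
      also have "\<dots> = (LINT s|lborel. g (- s) - indicator {..x} s *\<^sub>R g (- s))"
      proof (rule integral_cong_AE)
        show "AE s in lborel. indicator {..- x} (- s) *\<^sub>R g (- s) = g (- s) - indicator {..x} s *\<^sub>R g (- s)"
          using AE_lborel_singleton[of x] by eventually_elim (auto simp: indicator_def)
      qed (use intk in auto)
      also have "\<dots> = (LINT s|lborel. g (- s)) - (LINT s|lborel. indicator {..x} s *\<^sub>R g (- s))"
        by (intro Bochner_Integration.integral_diff integrable_mult_indicator intk) auto
      finally show ?thesis using k_tot by simp
    qed
    moreover have "((\<lambda>x. - (LINT s|lborel. indicator {..x} s *\<^sub>R g (- s))) \<longlongrightarrow> - (LINT s|lborel. g (- s))) at_top"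
      by (intro tendsto_minus tendsto_integral_at_top intk) simp
    ultimately show ?thesis
      unfolding filterlim_at_bot_mirror k_tot by simp
  qed
  \<comment> \<open>The function \<open>density / y - c G\<close> decreases and vanishes at both infinities.\<close>
  have pos_aux: "x * (c * G x) \<le> ?d x" if c: "\<bar>c\<bar> = 1" for x c
  proof -
    have cg: "\<bar>c * g s\<bar> \<le> ?d s" for s using g_le[of s] c by (simp add: abs_mult)
    have der: "((\<lambda>y. ?d y / y - c * G y) has_real_derivative (- ?d y - ?d y / y\<^sup>2 - c * g y)) (at y)"
      if "y \<noteq> 0" for y
      using that by (auto intro!: derivative_eq_intros d_deriv G_deriv simp: field_simps power2_eq_square)
    have neg: "- ?d y - ?d y / y\<^sup>2 - c * g y \<le> 0" for y
      using cg[of y] d0[of y] zero_le_divide_iff[of "?d y" "y\<^sup>2"] by (smt (verit) zero_le_power2)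
    consider "x = 0" | "x > 0" | "x < 0" by linarith
    then show ?thesis
    proof cases
      case 1 then show ?thesis using d0[of 0] by simp
    next
      case 2
      have lim: "((\<lambda>y. ?d y / y - c * G y) \<longlongrightarrow> 0 - c * 0) at_top"
        by (intro tendsto_intros G_top) (unfold std_normal_density_def[abs_def], real_asymp)
      have "?d y / y - c * G y \<le> ?d x / x - c * G x" if "y \<ge> x" for y
      proof (rule DERIV_nonpos_imp_nonincreasing[OF that])
        fix z assume "x \<le> z" "z \<le> y"
        then show "\<exists>D. ((\<lambda>y. ?d y / y - c * G y) has_real_derivative D) (at z) \<and> D \<le> 0"
          using der[of z] neg[of z] 2 by force
      qed
      then have "0 - c * 0 \<le> ?d x / x - c * G x"
        by (intro tendsto_upperbound[OF lim]) (auto simp: eventually_at_top_linorder)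
      then show ?thesis using 2 by (simp add: field_simps)
    next
      case 3
      have lim: "((\<lambda>y. ?d y / y - c * G y) \<longlongrightarrow> 0 - c * 0) at_bot"
        by (intro tendsto_intros G_bot) (unfold std_normal_density_def[abs_def], real_asymp)
      have "?d y / y - c * G y \<ge> ?d x / x - c * G x" if "y \<le> x" for y
      proof (rule DERIV_nonpos_imp_nonincreasing[OF that])
        fix z assume "y \<le> z" "z \<le> x"
        then show "\<exists>D. ((\<lambda>y. ?d y / y - c * G y) has_real_derivative D) (at z) \<and> D \<le> 0"
          using der[of z] neg[of z] 3 by force
      qed
      then have "0 - c * 0 \<ge> ?d x / x - c * G x"
        by (intro tendsto_lowerbound[OF lim]) (auto simp: eventually_at_bot_linorder)
      then show ?thesis using 3 by (simp add: field_simps)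
    qed
  qed
  have pos: "\<bar>x\<bar> * \<bar>G x\<bar> \<le> ?d x" for x
    using pos_aux[of 1 x] pos_aux[of "-1" x] by (simp add: abs_mult[symmetric] abs_le_iff)
  define F where "F x = G x / ?d x" for x
  have F_deriv: "(F has_real_derivative (x * F x + h x - m)) (at x)" for x
  proof -
    have "(F has_real_derivative ((g x * ?d x - G x * (- x * ?d x)) / (?d x * ?d x))) (at x)"
      unfolding F_def[abs_def] using d0[of x]
      by (intro DERIV_divide G_deriv d_deriv) auto
    moreover have "(g x * ?d x - G x * (- x * ?d x)) / (?d x * ?d x) = x * F x + h x - m"
      unfolding F_def g_def using d0[of x] by (simp add: field_simps)
    ultimately show ?thesis by simp
  qed
  have xF: "\<bar>x * F x\<bar> \<le> 1" for x
    using pos[of x] d0[of x] by (simp add: F_def abs_mult)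
  have F6: "\<bar>F x\<bar> \<le> 6" for x
  proof (cases "\<bar>x\<bar> \<le> 1")
    case True
    have "exp (x\<^sup>2 / 2) \<le> exp (1/2)" using True by (simp add: abs_square_le_1)
    also have "\<dots> \<le> (2::real)" using exp_half_le2 by simp
    finally have e: "exp (x\<^sup>2 / 2) \<le> 2" .
    have "1 / ?d x = sqrt (2*pi) * exp (x\<^sup>2 / 2)"
      unfolding std_normal_density_def by (simp add: exp_minus field_simps)
    also have "\<dots> \<le> 3 * 2"
    proof (intro mult_mono e)
      show "sqrt (2*pi) \<le> 3" by (rule real_le_lsqrt) (use pi_less_4 in \<open>auto simp: power2_eq_square\<close>)
    qed auto
    finally have "1 / ?d x \<le> 6" by simp
    moreover have "\<bar>F x\<bar> \<le> 1 / ?d x"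
      unfolding F_def abs_divide using G_le1[of x] d0[of x] by (simp add: divide_right_mono)
    ultimately show ?thesis by linarith
  next
    case False
    then have "\<bar>F x\<bar> \<le> \<bar>x\<bar> * \<bar>F x\<bar>" by (intro mult_right_mono[of 1 "\<bar>x\<bar>" "\<bar>F x\<bar>", simplified]) auto
    then show ?thesis using xF[of x] by (simp add: abs_mult)
  qed
  have "\<bar>x * F x + h x - m\<bar> \<le> 2" for x using xF[of x] hm[of x] by linarith
  then show thesis
    by (intro that[where F = F and F' = "\<lambda>x. x * F x + h x - m"] F_deriv F6 refl)
qed

text \<open>
  The derivative of the solution is Lipschitz only up to the factor \<open>\<bar>w\<bar>\<close>, because of the term
  \<open>x F x\<close> in the equation. This is why a fourth moment of the statistic is needed later.
\<close>

lemma stein_remainder: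
  fixes F F' h :: "real \<Rightarrow> real"
  assumes F: "\<And>x. (F has_real_derivative F' x) (at x)"
    and F': "\<And>x. F' x = x * F x + h x - m"
    and F_le: "\<And>x. \<bar>F x\<bar> \<le> A" and F'_le: "\<And>x. \<bar>F' x\<bar> \<le> B"
    and lip: "\<And>x y. \<bar>h x - h y\<bar> \<le> l * \<bar>x - y\<bar>" and B: "0 \<le> B" and l: "0 \<le> l"
  shows "\<bar>F w - F (w - d) - d * F' w\<bar> \<le> (A + l + B * \<bar>w\<bar>) * d\<^sup>2"
proof -
  have F_lip: "\<bar>F u - F w\<bar> \<le> B * \<bar>u - w\<bar>" for u
  proof -
    have "norm (F u - F w) \<le> B * norm (u - w)"
      by (rule field_differentiable_bound[OF convex_UNIV, of F F']) (use F F'_le in auto)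
    then show ?thesis by (simp only: real_norm_def)
  qed
  have A: "0 \<le> A" using F_le[of 0] by linarith
  have F'_lip: "\<bar>F' u - F' w\<bar> \<le> (A + l + B * \<bar>w\<bar>) * \<bar>u - w\<bar>" for u
  proof -
    have "F' u - F' w = (u - w) * F u + w * (F u - F w) + (h u - h w)"
      by (simp add: F' algebra_simps)
    also have "\<bar>\<dots>\<bar> \<le> \<bar>(u - w) * F u\<bar> + \<bar>w * (F u - F w)\<bar> + \<bar>h u - h w\<bar>" by linarith
    also have "\<dots> \<le> \<bar>u - w\<bar> * A + \<bar>w\<bar> * (B * \<bar>u - w\<bar>) + l * \<bar>u - w\<bar>"
      unfolding abs_mult by (intro add_mono mult_left_mono F_le F_lip lip) auto
    finally show ?thesis by (simp add: algebra_simps)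
  qed
  have mvt: "\<exists>z. u \<le> z \<and> z \<le> v \<and> F v - F u = (v - u) * F' z" if "u \<le> v" for u v
  proof (cases "u = v")
    case True then show ?thesis by auto
  next
    case False
    with that have "u < v" by simp
    from MVT2[of u v F F', OF this] F show ?thesis by (meson less_imp_le)
  qed
  obtain z where z: "\<bar>z - w\<bar> \<le> \<bar>d\<bar>" "F w - F (w - d) = d * F' z"
  proof (cases "0 \<le> d")
    case True
    with mvt[of "w - d" w] obtain z where "w - d \<le> z" "z \<le> w" "F w - F (w - d) = d * F' z" by force
    with that[of z] show ?thesis by linarith
  next
    case False
    with mvt[of w "w - d"] obtain z where "w \<le> z" "z \<le> w - d" "F (w - d) - F w = - (d * F' z)" by force
    with that[of z] show ?thesis by linarith
  qed
  have "\<bar>F w - F (w - d) - d * F' w\<bar> = \<bar>d\<bar> * \<bar>F' z - F' w\<bar>"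
    unfolding z(2) by (simp only: abs_mult flip: right_diff_distrib)
  also have "\<dots> \<le> \<bar>d\<bar> * ((A + l + B * \<bar>w\<bar>) * \<bar>d\<bar>)"
    using A B l z(1)
    by (intro mult_left_mono order_trans[OF F'_lip] mult_left_mono) auto
  finally show ?thesis by (simp add: power2_eq_square mult.commute mult.left_commute)
qed

section \<open>From smooth test functions to distribution functions\<close>

text \<open>
  A Lipschitz substitute for the indicator of \<open>{..t}\<close>, decreasing from \<open>1\<close> to \<open>0\<close> on \<open>[t, t + \<epsilon>]\<close>.
\<close>

definition ramp :: "real \<Rightarrow> real \<Rightarrow> real \<Rightarrow> real" where
  "ramp \<epsilon> t x = max 0 (min 1 ((t + \<epsilon> - x) / \<epsilon>))"

lemma ramp_props:
  assumes "0 < \<epsilon>"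
  shows "0 \<le> ramp \<epsilon> t x" "ramp \<epsilon> t x \<le> 1" "\<bar>ramp \<epsilon> t x - ramp \<epsilon> t y\<bar> \<le> \<bar>x - y\<bar> / \<epsilon>"
    "x \<le> t \<Longrightarrow> ramp \<epsilon> t x = 1" "t + \<epsilon> \<le> x \<Longrightarrow> ramp \<epsilon> t x = 0"
proof -
  have "(t + \<epsilon> - x) / \<epsilon> - (t + \<epsilon> - y) / \<epsilon> = (y - x) / \<epsilon>"
    by (simp add: diff_divide_distrib)
  then have "\<bar>(t + \<epsilon> - x) / \<epsilon> - (t + \<epsilon> - y) / \<epsilon>\<bar> = \<bar>x - y\<bar> / \<epsilon>"
    using assms by (simp add: abs_minus_commute)
  then show "\<bar>ramp \<epsilon> t x - ramp \<epsilon> t y\<bar> \<le> \<bar>x - y\<bar> / \<epsilon>"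
    unfolding ramp_def by (auto simp: max_def min_def)
qed (use assms in \<open>auto simp: ramp_def field_simps\<close>)

lemma ramp_measurable [measurable]: "ramp \<epsilon> t \<in> borel_measurable borel"
  unfolding ramp_def[abs_def] by measurable

lemma std_normal_cdf_increment:
  assumes "a \<le> b"
  shows "measure std_normal_distribution {..b} \<le> measure std_normal_distribution {..a} + (b - a)"
proof -
  interpret N: prob_space std_normal_distribution by (rule prob_space_normal_density) simp
  have "measure std_normal_distribution {a<..b} = (LINT x|lborel. std_normal_density x * indicator {a<..b} x)"
  proof -
    have "measure std_normal_distribution {a<..b} = (LINT x|std_normal_distribution. indicator {a<..b} x)"
      by simp
    also have "\<dots> = (LINT x|lborel. std_normal_density x * indicator {a<..b} x)"
      by (subst integral_density) auto
    finally show ?thesis .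
  qed
  also have "\<dots> \<le> (LINT x|lborel. indicator {a<..b} x)"
  proof (rule integral_mono')
    have "std_normal_density x \<le> 1" for x
    proof -
      have "1 \<le> sqrt (2 * pi)" using pi_ge_two by (intro real_le_rsqrt) auto
      then have "std_normal_density x \<le> 1 * 1" unfolding std_normal_density_def
        by (intro mult_mono) auto
      then show ?thesis by simp
    qed
    then show "std_normal_density x * indicator {a<..b} x \<le> indicator {a<..b} x" for x
      by (simp add: indicator_def)
  qed (use assms in auto)
  also have "\<dots> = b - a" using assms by simp
  finally have "measure std_normal_distribution {a<..b} \<le> b - a" .
  moreover have "measure std_normal_distribution {..b} = measure std_normal_distribution {..a} + measure std_normal_distribution {a<..b}"
    using assms by (subst N.finite_measure_Union[symmetric]) (auto simp: ivl_disj_un)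
  ultimately show ?thesis by simp
qed

text \<open>
  Indicators lie between two ramps, whose Gaussian integrals differ by at most \<open>\<epsilon>\<close>. Since ramps
  are Lipschitz, a perturbation \<open>R\<close> of the statistic costs its first absolute moment divided by
  \<open>\<epsilon>\<close>.
\<close>

lemma kolmogorov_distance_le:
  fixes Y R :: "'a \<Rightarrow> real"
  assumes P: "prob_space P" and Y [measurable]: "Y \<in> borel_measurable P" and R: "integrable P R"
    and \<epsilon>: "0 < \<epsilon>"
    and smooth: "\<And>H::real \<Rightarrow> real. (\<And>x y. \<bar>H x - H y\<bar> \<le> \<bar>x - y\<bar> / \<epsilon>) \<Longrightarrow> (\<And>x. 0 \<le> H x) \<Longrightarrow> (\<And>x. H x \<le> 1) \<Longrightarrow>
      \<bar>(LINT \<omega>|P. H (Y \<omega>)) - (LINT x|lborel. std_normal_density x * H x)\<bar> \<le> \<eta>"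
  shows "\<bar>measure P {\<omega> \<in> space P. Y \<omega> + R \<omega> \<le> t} - measure std_normal_distribution {..t}\<bar>
      \<le> \<eta> + \<epsilon> + (LINT \<omega>|P. \<bar>R \<omega>\<bar>) / \<epsilon>"
proof -
  interpret prob_space P by fact
  interpret N: prob_space std_normal_distribution by (rule prob_space_normal_density) simp
  have [measurable]: "R \<in> borel_measurable P" using R by auto
  have int: "integrable P (\<lambda>\<omega>. ramp \<epsilon> s (Z \<omega>))" if [measurable]: "Z \<in> borel_measurable P" for s Z
    using ramp_props[OF \<epsilon>] by (intro integrable_const_bound[where B=1]) auto
  have prob_eq: "measure P {\<omega> \<in> space P. Y \<omega> + R \<omega> \<le> t} = (LINT \<omega>|P. indicator {..t} (Y \<omega> + R \<omega>))"
  proof -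
    have "(LINT \<omega>|P. indicator {..t} (Y \<omega> + R \<omega>) :: real) = (LINT \<omega>|P. indicator {\<omega> \<in> space P. Y \<omega> + R \<omega> \<le> t} \<omega>)"
      by (intro Bochner_Integration.integral_cong) (auto simp: indicator_def)
    then show ?thesis by simp
  qed
  have int_ind: "integrable P (\<lambda>\<omega>. indicator {..t} (Y \<omega> + R \<omega>) :: real)"
    by (intro integrable_const_bound[where B=1]) (auto simp: indicator_def)
  have shift: "\<bar>(LINT \<omega>|P. ramp \<epsilon> s (Y \<omega> + R \<omega>)) - (LINT \<omega>|P. ramp \<epsilon> s (Y \<omega>))\<bar> \<le> (LINT \<omega>|P. \<bar>R \<omega>\<bar>) / \<epsilon>" for s
  proof -
    have "\<bar>(LINT \<omega>|P. ramp \<epsilon> s (Y \<omega> + R \<omega>)) - (LINT \<omega>|P. ramp \<epsilon> s (Y \<omega>))\<bar>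
       = \<bar>LINT \<omega>|P. ramp \<epsilon> s (Y \<omega> + R \<omega>) - ramp \<epsilon> s (Y \<omega>)\<bar>"
      by (subst Bochner_Integration.integral_diff) (auto intro: int)
    also have "\<dots> \<le> (LINT \<omega>|P. \<bar>ramp \<epsilon> s (Y \<omega> + R \<omega>) - ramp \<epsilon> s (Y \<omega>)\<bar>)" by (rule integral_abs_bound)
    also have "\<dots> \<le> (LINT \<omega>|P. \<bar>R \<omega>\<bar> / \<epsilon>)"
    proof (rule integral_mono)
      show "\<bar>ramp \<epsilon> s (Y \<omega> + R \<omega>) - ramp \<epsilon> s (Y \<omega>)\<bar> \<le> \<bar>R \<omega>\<bar> / \<epsilon>" for \<omega>
        using ramp_props(3)[OF \<epsilon>, of s "Y \<omega> + R \<omega>" "Y \<omega>"] by simp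
    qed (use R int in auto)
    finally show ?thesis by simp
  qed
  have sm: "\<bar>(LINT \<omega>|P. ramp \<epsilon> s (Y \<omega>)) - (LINT x|lborel. std_normal_density x * ramp \<epsilon> s x)\<bar> \<le> \<eta>" for s
    by (rule smooth) (rule ramp_props[OF \<epsilon>])+
  have nrm: "(LINT x|lborel. std_normal_density x * ramp \<epsilon> s x) = (LINT x|std_normal_distribution. ramp \<epsilon> s x)" for s
    by (subst integral_density) auto
  have intN: "integrable std_normal_distribution (ramp \<epsilon> s)" for s
    using ramp_props[OF \<epsilon>] by (intro N.integrable_const_bound[where B=1]) auto
  have cdf: "measure std_normal_distribution {..s} = (LINT x|std_normal_distribution. indicator {..s} x)" for s
    by simp
  have intI: "integrable std_normal_distribution (\<lambda>x. indicator {..s} x :: real)" for s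
    by (intro N.integrable_const_bound[where B=1]) (auto simp: indicator_def)
  have up: "measure P {\<omega> \<in> space P. Y \<omega> + R \<omega> \<le> t} \<le> (LINT \<omega>|P. ramp \<epsilon> t (Y \<omega> + R \<omega>))"
    unfolding prob_eq by (intro integral_mono int int_ind) (auto simp: indicator_def ramp_props[OF \<epsilon>])
  have lo: "(LINT \<omega>|P. ramp \<epsilon> (t - \<epsilon>) (Y \<omega> + R \<omega>)) \<le> measure P {\<omega> \<in> space P. Y \<omega> + R \<omega> \<le> t}"
    unfolding prob_eq by (intro integral_mono int int_ind) (auto simp: indicator_def ramp_props[OF \<epsilon>])
  have nup: "(LINT x|std_normal_distribution. ramp \<epsilon> t x) \<le> measure std_normal_distribution {..t + \<epsilon>}"
    unfolding cdf by (intro integral_mono intN intI) (auto simp: indicator_def ramp_props[OF \<epsilon>])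
  have nlo: "measure std_normal_distribution {..t - \<epsilon>} \<le> (LINT x|std_normal_distribution. ramp \<epsilon> (t - \<epsilon>) x)"
    unfolding cdf by (intro integral_mono intN intI) (auto simp: indicator_def ramp_props[OF \<epsilon>])
  show ?thesis
    using up lo nup nlo shift[of t] shift[of "t - \<epsilon>"] sm[of t] sm[of "t - \<epsilon>"]
      std_normal_cdf_increment[of t "t + \<epsilon>"] std_normal_cdf_increment[of "t - \<epsilon>" t] \<epsilon>
    unfolding nrm by linarith
qed

section \<open>Functions of independent coordinates\<close>

lemma mult_le_half_squares: "(p::real) * q \<le> (p\<^sup>2 + q\<^sup>2) / 2"
  using sum_squares_bound[of p q] by simp

text \<open>
  A sample from \<open>\<mu>\<close> is realised by the coordinates of a finite product. Conditional expectation
  given all coordinates but \<open>i\<close> then is plain integration over the coordinate \<open>i\<close>.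
\<close>

locale iid_product = prob_space \<mu> for \<mu> :: "'a measure" +
  fixes I :: "'i set"
  assumes finite_I: "finite I"
begin

abbreviation "\<Omega> \<equiv> Pi\<^sub>M I (\<lambda>_. \<mu>)"

sublocale P: prob_space \<Omega> by (rule prob_space_PiM) unfold_locales

sublocale PP: product_prob_space "\<lambda>_. \<mu>" I ..

abbreviation EE :: "(('i \<Rightarrow> 'a) \<Rightarrow> real) \<Rightarrow> real" where "EE F \<equiv> integral\<^sup>L \<Omega> F"

text \<open>
  Bounded measurable statistics form an algebra on which every expectation below exists.
\<close>

definition bdm :: "(('i \<Rightarrow> 'a) \<Rightarrow> real) \<Rightarrow> bool" where
  "bdm F \<longleftrightarrow> F \<in> borel_measurable \<Omega> \<and> (\<exists>B. \<forall>x. \<bar>F x\<bar> \<le> B)"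

lemma bdmI: "F \<in> borel_measurable \<Omega> \<Longrightarrow> (\<And>x. \<bar>F x\<bar> \<le> B) \<Longrightarrow> bdm F"
  by (auto simp: bdm_def)

lemma bdm_measurable [measurable_dest]: "bdm F \<Longrightarrow> F \<in> borel_measurable \<Omega>"
  by (simp add: bdm_def)

lemma bdm_integrable: "bdm F \<Longrightarrow> integrable \<Omega> F"
  unfolding bdm_def using P.integrable_const_bound by (metis AE_I2 real_norm_def)

lemma bdm_const: "bdm (\<lambda>_. c)"
  by (rule bdmI[of _ "\<bar>c\<bar>"]) auto

lemma bdm_add: "bdm F \<Longrightarrow> bdm G \<Longrightarrow> bdm (\<lambda>x. F x + G x)"
  unfolding bdm_def by (auto, meson abs_triangle_ineq add_mono order_trans)

lemma bdm_mult:
  assumes "bdm F" "bdm G" shows "bdm (\<lambda>x. F x * G x)"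
proof -
  obtain A B where "\<And>x. \<bar>F x\<bar> \<le> A" "\<And>x. \<bar>G x\<bar> \<le> B" using assms by (auto simp: bdm_def)
  moreover from this have "0 \<le> A" by (meson abs_ge_zero order_trans)
  ultimately show ?thesis using assms
    by (intro bdmI[of _ "A * B"]) (auto simp: abs_mult intro: mult_mono)
qed

lemma bdm_uminus: "bdm F \<Longrightarrow> bdm (\<lambda>x. - F x)"
  unfolding bdm_def by auto

lemma bdm_diff: "bdm F \<Longrightarrow> bdm G \<Longrightarrow> bdm (\<lambda>x. F x - G x)"
  using bdm_add[of F "\<lambda>x. - G x"] bdm_uminus[of G] by simp

lemma bdm_power: "bdm F \<Longrightarrow> bdm (\<lambda>x. F x ^ k)"
  by (induction k) (auto intro: bdm_const bdm_mult)

lemma bdm_abs: "bdm F \<Longrightarrow> bdm (\<lambda>x. \<bar>F x\<bar>)"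
  unfolding bdm_def by auto

lemma bdm_divide: "bdm F \<Longrightarrow> bdm (\<lambda>x. F x / c)"
  using bdm_mult[OF _ bdm_const, of F "1 / c"] by simp

lemma bdm_sum: "(\<And>a. a \<in> A \<Longrightarrow> bdm (F a)) \<Longrightarrow> bdm (\<lambda>x. \<Sum>a\<in>A. F a x)"
  by (induction A rule: infinite_finite_induct) (auto intro: bdm_const bdm_add)

lemma bdm_continuous:
  fixes F :: "real \<Rightarrow> real"
  assumes "bdm W" "continuous_on UNIV F" shows "bdm (\<lambda>x. F (W x))"
proof -
  obtain B where B: "\<And>x. \<bar>W x\<bar> \<le> B" using assms by (auto simp: bdm_def)
  have "compact (F ` {-B..B})"
    by (intro compact_continuous_image continuous_on_subset[OF assms(2)]) auto
  then obtain C where C: "\<forall>y\<in>F ` {-B..B}. \<bar>y\<bar> \<le> C"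
    unfolding real_norm_def[symmetric] by (meson compact_imp_bounded bounded_iff)
  then have "\<bar>F (W x)\<bar> \<le> C" for x using B[of x] C by (simp add: abs_le_iff)
  moreover have "(\<lambda>x. F (W x)) \<in> borel_measurable \<Omega>"
    using assms(1) borel_measurable_continuous_onI[OF assms(2)] by measurable
  ultimately show ?thesis by (intro bdmI)
qed

lemmas bdm_intros = bdm_const bdm_add bdm_mult bdm_uminus bdm_diff bdm_power bdm_abs bdm_divide bdm_sum

lemma EE_add: "bdm F \<Longrightarrow> bdm G \<Longrightarrow> EE (\<lambda>x. F x + G x) = EE F + EE G"
  by (simp add: bdm_integrable)
lemma EE_diff: "bdm F \<Longrightarrow> bdm G \<Longrightarrow> EE (\<lambda>x. F x - G x) = EE F - EE G"
  by (simp add: bdm_integrable)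
lemma EE_sum: "(\<And>a. a \<in> A \<Longrightarrow> bdm (F a)) \<Longrightarrow> EE (\<lambda>x. \<Sum>a\<in>A. F a x) = (\<Sum>a\<in>A. EE (F a))"
  by (simp add: bdm_integrable)
lemma EE_mono: "bdm F \<Longrightarrow> bdm G \<Longrightarrow> (\<And>x. F x \<le> G x) \<Longrightarrow> EE F \<le> EE G"
  by (intro integral_mono bdm_integrable)
lemma EE_const: "EE (\<lambda>x. c) = c" by (simp add: P.prob_space)
lemma EE_nonneg: "(\<And>x. 0 \<le> F x) \<Longrightarrow> 0 \<le> EE F" by simp
lemma EE_abs_le: "\<bar>EE F\<bar> \<le> EE (\<lambda>x. \<bar>F x\<bar>)" by (rule integral_abs_bound)

lemma space_coord: "x \<in> space \<Omega> \<Longrightarrow> i \<in> I \<Longrightarrow> x i \<in> space \<mu>"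
  by (auto simp: space_PiM)

lemma measurable_upd:
  assumes "i \<in> I"
  shows "(\<lambda>(x, y). x(i := y)) \<in> \<Omega> \<Otimes>\<^sub>M \<mu> \<rightarrow>\<^sub>M \<Omega>"
  unfolding split_beta' using assms by (intro measurable_fun_upd[where J=I]) auto

lemma bdm_coord_integral:
  assumes F: "bdm F" and i: "i \<in> I"
  shows "bdm (\<lambda>x. \<integral>y. F (x(i := y)) \<partial>\<mu>)"
proof -
  obtain B where B: "\<And>x. \<bar>F x\<bar> \<le> B" using F by (auto simp: bdm_def)
  have m: "(\<lambda>(x, y). F (x(i := y))) \<in> borel_measurable (\<Omega> \<Otimes>\<^sub>M \<mu>)"
    using measurable_compose[OF measurable_upd[OF i] bdm_measurable[OF F]] by (simp add: split_beta')
  have "\<bar>\<integral>y. F (x(i := y)) \<partial>\<mu>\<bar> \<le> B" for x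
  proof -
    have "0 \<le> B" using B by (meson abs_ge_zero order_trans)
    have "\<bar>\<integral>y. F (x(i := y)) \<partial>\<mu>\<bar> \<le> (\<integral>y. \<bar>F (x(i := y))\<bar> \<partial>\<mu>)" by (rule integral_abs_bound)
    also have "\<dots> \<le> (\<integral>y. B \<partial>\<mu>)" by (rule integral_mono') (use B \<open>0 \<le> B\<close> in auto)
    finally show ?thesis by (simp add: prob_space)
  qed
  then show ?thesis by (intro bdmI[of _ B] borel_measurable_lebesgue_integral m)
qed

lemma EE_coord:
  assumes F: "bdm F" and i: "i \<in> I"
  shows "EE F = EE (\<lambda>x. \<integral>y. F (x(i := y)) \<partial>\<mu>)"
proof -
  have I: "I = insert i (I - {i})" using i by auto
  have *: "EE G = (\<integral>x. (\<integral>y. G (x(i := y)) \<partial>\<mu>) \<partial>Pi\<^sub>M (I - {i}) (\<lambda>_. \<mu>))" if "bdm G" for G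
    using PP.product_integral_insert[of "I - {i}" i G] bdm_integrable[OF that] finite_I
    by (metis Diff_iff I finite_Diff insertI1)
  show ?thesis
    unfolding *[OF F] *[OF bdm_coord_integral[OF F i]] by (simp add: prob_space)
qed

text \<open>
  Integrate over the coordinate \<open>i\<close> first: \<open>Z\<close> is constant in it, and \<open>Y\<close> integrates to zero.
\<close>

lemma EE_orth:
  assumes "bdm Y" "bdm Z" "i \<in> I"
    and "\<And>x. x \<in> space \<Omega> \<Longrightarrow> (\<integral>y. Y (x(i := y)) \<partial>\<mu>) = 0"
    and "\<And>x y. Z (x(i := y)) = Z x"
  shows "EE (\<lambda>x. Y x * Z x) = 0"
proof -
  have "EE (\<lambda>x. Y x * Z x) = EE (\<lambda>x. \<integral>y. Y (x(i := y)) * Z (x(i := y)) \<partial>\<mu>)"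
    using assms by (intro EE_coord bdm_mult)
  also have "\<dots> = EE (\<lambda>x. 0)"
    by (intro Bochner_Integration.integral_cong refl) (simp add: assms)
  finally show ?thesis by simp
qed

lemma EE_single:
  assumes [measurable]: "u \<in> borel_measurable \<mu>" and u: "\<And>x. \<bar>u x\<bar> \<le> B" and i: "i \<in> I"
  shows "EE (\<lambda>x. u (x i)) = (\<integral>y. u y \<partial>\<mu>)" "bdm (\<lambda>x. u (x i))"
proof -
  show b: "bdm (\<lambda>x. u (x i))" using i u by (intro bdmI[of _ B]) measurable
  show "EE (\<lambda>x. u (x i)) = (\<integral>y. u y \<partial>\<mu>)"
    by (subst EE_coord[OF b i]) (simp add: P.prob_space)
qed

lemma EE_pair:
  assumes k[measurable]: "(\<lambda>(x, y). k x y) \<in> borel_measurable (\<mu> \<Otimes>\<^sub>M \<mu>)" and kB: "\<And>x y. \<bar>k x y\<bar> \<le> B"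
    and i: "i \<in> I" and l: "l \<in> I" 
  shows "bdm (\<lambda>x. k (x i) (x l))"
    and "i \<noteq> l \<Longrightarrow> EE (\<lambda>x. k (x i) (x l)) = (\<integral>x. \<integral>y. k x y \<partial>\<mu> \<partial>\<mu>)"
proof -
  have "(\<lambda>x. case (x i, x l) of (x, y) \<Rightarrow> k x y) \<in> borel_measurable \<Omega>"
    by (rule measurable_compose[OF _ k]) (use i l in measurable)
  then show b: "bdm (\<lambda>x. k (x i) (x l))" using kB by (intro bdmI[of _ B]) auto
  assume ne: "i \<noteq> l"
  have B: "0 \<le> B" using kB by (meson abs_ge_zero order_trans)
  have uB: "\<bar>\<integral>y. k x y \<partial>\<mu>\<bar> \<le> B" for x
  proof -
    have "\<bar>\<integral>y. k x y \<partial>\<mu>\<bar> \<le> (\<integral>y. \<bar>k x y\<bar> \<partial>\<mu>)" by (rule integral_abs_bound)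
    also have "\<dots> \<le> (\<integral>y. B \<partial>\<mu>)" by (rule integral_mono') (use kB B in auto)
    finally show ?thesis by (simp add: prob_space)
  qed
  have "EE (\<lambda>x. k (x i) (x l)) = EE (\<lambda>x. \<integral>y. k (x i) y \<partial>\<mu>)"
    by (subst EE_coord[OF b l]) (use ne in simp)
  also have "\<dots> = (\<integral>x. \<integral>y. k x y \<partial>\<mu> \<partial>\<mu>)"
    by (rule EE_single(1)[OF _ uB i]) measurable
  finally show "EE (\<lambda>x. k (x i) (x l)) = (\<integral>x. \<integral>y. k x y \<partial>\<mu> \<partial>\<mu>)" .
qed

text \<open>
  Only related pairs contribute to the square of the sum, and each mixed term is at most the mean
  of the two squares. Counting relatives replaces the computation of covariances.
\<close>

lemma EE_sum_square_le:
  assumes A: "finite A" and Y: "\<And>a. a \<in> A \<Longrightarrow> bdm (Y a)"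
    and orth: "\<And>a b. a \<in> A \<Longrightarrow> b \<in> A \<Longrightarrow> \<not> R a b \<Longrightarrow> EE (\<lambda>x. Y a x * Y b x) = 0"
    and R_sym: "\<And>a b. R a b = R b a"
    and few: "\<And>a. a \<in> A \<Longrightarrow> real (card {b \<in> A. R a b}) \<le> m"
  shows "EE (\<lambda>x. (\<Sum>a\<in>A. Y a x)\<^sup>2) \<le> m * (\<Sum>a\<in>A. EE (\<lambda>x. (Y a x)\<^sup>2))"
proof -
  define q where "q a = EE (\<lambda>x. (Y a x)\<^sup>2)" for a
  have le: "EE (\<lambda>x. Y a x * Y b x) \<le> (if R a b then (q a + q b) / 2 else 0)" if "a \<in> A" "b \<in> A" for a b
  proof (cases "R a b")
    case True
    have "EE (\<lambda>x. Y a x * Y b x) \<le> EE (\<lambda>x. ((Y a x)\<^sup>2 + (Y b x)\<^sup>2) / 2)"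
      using that by (intro EE_mono bdm_intros Y mult_le_half_squares)
    also have "\<dots> = (q a + q b) / 2"
      unfolding q_def using that by (simp add: bdm_integrable bdm_power Y)
    finally show ?thesis using True by simp
  qed (use orth that in auto)
  have "EE (\<lambda>x. (\<Sum>a\<in>A. Y a x)\<^sup>2) = (\<Sum>a\<in>A. \<Sum>b\<in>A. EE (\<lambda>x. Y a x * Y b x))"
    unfolding power2_eq_square sum_product
    by (subst EE_sum, intro bdm_intros Y, assumption+, intro sum.cong refl EE_sum bdm_intros Y)
  also have "\<dots> \<le> (\<Sum>a\<in>A. \<Sum>b\<in>A. if R a b then (q a + q b) / 2 else 0)"
    by (intro sum_mono le)
  also have "\<dots> = (\<Sum>a\<in>A. \<Sum>b\<in>A. if R a b then q a / 2 else 0) + (\<Sum>a\<in>A. \<Sum>b\<in>A. if R a b then q b / 2 else 0)"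
    unfolding sum.distrib[symmetric] by (intro sum.cong refl) (auto simp: add_divide_distrib)
  also have "(\<Sum>a\<in>A. \<Sum>b\<in>A. if R a b then q b / 2 else 0) = (\<Sum>a\<in>A. \<Sum>b\<in>A. if R a b then q a / 2 else 0)"
    by (subst sum.swap) (simp add: R_sym)
  also have "(\<Sum>a\<in>A. \<Sum>b\<in>A. if R a b then q a / 2 else 0) = (\<Sum>a\<in>A. real (card {b \<in> A. R a b}) * (q a / 2))"
    using A by (simp add: sum.If_cases Int_def)
  also have "\<dots> + \<dots> = (\<Sum>a\<in>A. real (card {b \<in> A. R a b}) * q a)"
    unfolding sum.distrib[symmetric] by (intro sum.cong refl) simp
  also have "\<dots> \<le> (\<Sum>a\<in>A. m * q a)"
    by (intro sum_mono mult_right_mono few) (auto simp: q_def)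
  finally show ?thesis by (simp add: sum_distrib_left q_def)
qed

text \<open>
  Two sets of the same size that differ leave a coordinate on which one of the two statistics
  depends, and in which it is degenerate, while the other does not involve it. Hence only equal
  supports are related.
\<close>

lemma EE_sum_square_le_support:
  assumes A: "finite A" and Y: "\<And>a. a \<in> A \<Longrightarrow> bdm (Y a)"
    and supp: "\<And>a. a \<in> A \<Longrightarrow> S a \<subseteq> I" "\<And>a. a \<in> A \<Longrightarrow> card (S a) = c"
    and deg: "\<And>a i x. a \<in> A \<Longrightarrow> i \<in> S a \<Longrightarrow> x \<in> space \<Omega> \<Longrightarrow> (\<integral>y. Y a (x(i := y)) \<partial>\<mu>) = 0"
    and indep: "\<And>a i x y. a \<in> A \<Longrightarrow> i \<notin> S a \<Longrightarrow> Y a (x(i := y)) = Y a x"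
    and few: "\<And>a. a \<in> A \<Longrightarrow> real (card {b \<in> A. S a = S b}) \<le> m"
  shows "EE (\<lambda>x. (\<Sum>a\<in>A. Y a x)\<^sup>2) \<le> m * (\<Sum>a\<in>A. EE (\<lambda>x. (Y a x)\<^sup>2))"
proof (rule EE_sum_square_le[OF A Y _ _ few])
  fix a b assume ab: "a \<in> A" "b \<in> A" "\<not> S a = S b"
  have "\<not> S a \<subseteq> S b"
    using ab supp finite_I by (metis card_subset_eq finite_subset)
  then obtain i where i: "i \<in> S a" "i \<notin> S b" by auto
  show "EE (\<lambda>x. Y a x * Y b x) = 0"
    by (rule EE_orth[of _ _ i]) (use i ab supp deg indep Y in auto)
qed auto

end

section \<open>Moments of degenerate quadratic forms\<close>

text \<open>
  The term of first order in \<open>e\<close> is kept apart on the right-hand side, since its expectation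
  vanishes when a new independent summand \<open>e\<close> is added.
\<close>

lemma quartic_increment_le:
  fixes a e b :: real
  assumes "\<bar>e\<bar> \<le> b"
  shows "(a + e)^4 \<le> a^4 + 4 * (e * a^3) + (8 * b\<^sup>2 * a\<^sup>2 + 3 * b\<^sup>2 * e\<^sup>2)"
proof -
  have e2: "e\<^sup>2 \<le> b\<^sup>2" using assms abs_le_square_iff[of e b] by simp
  have "4 * a * e^3 \<le> 2 * (a\<^sup>2 * e\<^sup>2) + 2 * (e\<^sup>2 * e\<^sup>2)"
    using mult_left_mono[OF mult_le_half_squares[of a e], of "4 * e\<^sup>2"]
    by (simp add: algebra_simps power2_eq_square power3_eq_cube)
  moreover have "a\<^sup>2 * e\<^sup>2 \<le> a\<^sup>2 * b\<^sup>2" "e\<^sup>2 * e\<^sup>2 \<le> e\<^sup>2 * b\<^sup>2"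
    by (intro mult_left_mono e2 zero_le_power2)+
  moreover have "(a + e)^4 = a^4 + 4 * (e * a^3) + 6 * (a\<^sup>2 * e\<^sup>2) + 4 * a * e^3 + e\<^sup>2 * e\<^sup>2"
    by (simp add: algebra_simps power2_eq_square power3_eq_cube power4_eq_xxxx)
  ultimately show ?thesis by (simp add: algebra_simps)
qed

text \<open>
  \<open>W\<close> is the quadratic form, \<open>D i\<close> its part involving the coordinate \<open>i\<close>, and \<open>T\<close> the random
  variance that takes the place of the constant \<open>1\<close> in Stein's equation. \<open>G\<close> is the iterated kernel;
  its second moment \<open>g\<close> is the trace of the fourth power of the integral operator with kernel \<open>h\<close>.
\<close>

locale degenerate_kernel = iid_product \<mu> I for \<mu> :: "'a measure" and I :: "'i set" +
  fixes h :: "'a \<Rightarrow> 'a \<Rightarrow> real" and b :: real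
  assumes h_meas [measurable]: "(\<lambda>(x, y). h x y) \<in> borel_measurable (\<mu> \<Otimes>\<^sub>M \<mu>)"
    and h_sym: "\<And>x y. h x y = h y x"
    and h_le: "\<And>x y. \<bar>h x y\<bar> \<le> b"
    and h_deg: "\<And>x. x \<in> space \<mu> \<Longrightarrow> (\<integral>y. h x y \<partial>\<mu>) = 0"
begin

definition v :: real where "v = (\<integral>x. \<integral>y. (h x y)\<^sup>2 \<partial>\<mu> \<partial>\<mu>)"
definition G :: "'a \<Rightarrow> 'a \<Rightarrow> real" where "G x y = (\<integral>z. h z x * h z y \<partial>\<mu>)"
definition g :: real where "g = (\<integral>x. \<integral>y. (G x y)\<^sup>2 \<partial>\<mu> \<partial>\<mu>)"
definition D :: "'i \<Rightarrow> ('i \<Rightarrow> 'a) \<Rightarrow> real" where "D i x = (\<Sum>k\<in>I - {i}. h (x i) (x k))"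
definition W :: "('i \<Rightarrow> 'a) \<Rightarrow> real" where "W x = (\<Sum>i\<in>I. D i x) / 2"
definition T :: "('i \<Rightarrow> 'a) \<Rightarrow> real" where "T x = (\<Sum>i\<in>I. (D i x)\<^sup>2) / 2"
abbreviation n :: real where "n \<equiv> real (card I)"

lemma b_nonneg: "0 \<le> b" using h_le by (meson abs_ge_zero order_trans)

lemma h_square_le: "(h x y)\<^sup>2 \<le> b\<^sup>2"
  using h_le[of x y] b_nonneg by (simp add: abs_le_square_iff[symmetric])

lemma h_section [measurable]: "x \<in> space \<mu> \<Longrightarrow> (\<lambda>y. h x y) \<in> borel_measurable \<mu>"
  by measurable

lemma h_section': "x \<in> space \<mu> \<Longrightarrow> (\<lambda>y. h y x) \<in> borel_measurable \<mu>"
  using h_section h_sym by simp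

lemma bdm_h: "i \<in> I \<Longrightarrow> k \<in> I \<Longrightarrow> bdm (\<lambda>x. h (x i) (x k))"
  by (rule EE_pair(1)[OF h_meas h_le])

lemma EE_h2: "i \<in> I \<Longrightarrow> k \<in> I \<Longrightarrow> i \<noteq> k \<Longrightarrow> EE (\<lambda>x. (h (x i) (x k))\<^sup>2) = v"
  unfolding v_def by (rule EE_pair(2)[where B = "b\<^sup>2"]) (auto simp: h_square_le)

lemma v_nonneg: "0 \<le> v" unfolding v_def by simp
lemma g_nonneg: "0 \<le> g" unfolding g_def by simp

lemma G_meas [measurable]: "(\<lambda>(x, y). G x y) \<in> borel_measurable (\<mu> \<Otimes>\<^sub>M \<mu>)"
  unfolding G_def by measurable

lemma G_le: "\<bar>G x y\<bar> \<le> b\<^sup>2"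
proof -
  have "\<bar>G x y\<bar> \<le> (\<integral>z. \<bar>h z x * h z y\<bar> \<partial>\<mu>)" unfolding G_def by (rule integral_abs_bound)
  also have "\<dots> \<le> (\<integral>z. b\<^sup>2 \<partial>\<mu>)"
    by (rule integral_mono') (auto simp: abs_mult power2_eq_square b_nonneg intro!: mult_mono h_le)
  finally show ?thesis by (simp add: prob_space)
qed

lemma bdm_G: "i \<in> I \<Longrightarrow> k \<in> I \<Longrightarrow> bdm (\<lambda>x. G (x i) (x k))"
  by (rule EE_pair(1)[OF G_meas G_le])

lemma G_deg:
  assumes x: "x \<in> space \<mu>" shows "(\<integral>y. G x y \<partial>\<mu>) = 0"
proof -
  interpret pair_sigma_finite \<mu> \<mu> ..
  have "integrable (\<mu> \<Otimes>\<^sub>M \<mu>) (\<lambda>(z, y). h z x * h z y)"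
  proof (rule finite_measure.integrable_const_bound[where B="b\<^sup>2"])
    show "finite_measure (\<mu> \<Otimes>\<^sub>M \<mu>)" by (rule finite_measure_pair_measure) unfold_locales
    show "AE p in \<mu> \<Otimes>\<^sub>M \<mu>. norm (case p of (z, y) \<Rightarrow> h z x * h z y) \<le> b\<^sup>2"
      by (intro AE_I2) (auto simp: abs_mult power2_eq_square b_nonneg split: prod.split intro!: mult_mono h_le)
    show "(\<lambda>(z, y). h z x * h z y) \<in> borel_measurable (\<mu> \<Otimes>\<^sub>M \<mu>)"
      using h_section'[OF x] by measurable
  qed
  then have "(\<integral>y. \<integral>z. h z x * h z y \<partial>\<mu> \<partial>\<mu>) = (\<integral>z. \<integral>y. h z x * h z y \<partial>\<mu> \<partial>\<mu>)"
    by (rule Fubini_integral)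
  also have "\<dots> = (\<integral>z. 0 \<partial>\<mu>)"
    by (intro Bochner_Integration.integral_cong refl) (simp add: h_deg)
  finally show ?thesis by (simp add: G_def)
qed

lemma G_sym: "G x y = G y x" unfolding G_def by (simp add: mult.commute)

lemma G_square_le: "(G x y)\<^sup>2 \<le> (b\<^sup>2)\<^sup>2"
  using G_le[of x y] abs_le_square_iff[of "G x y" "b\<^sup>2"] by simp

lemma EE_G2: "i \<in> I \<Longrightarrow> k \<in> I \<Longrightarrow> i \<noteq> k \<Longrightarrow> EE (\<lambda>x. (G (x i) (x k))\<^sup>2) = g"
  unfolding g_def
proof (rule EE_pair(2)[where B = "(b\<^sup>2)\<^sup>2"])
  show "\<bar>(G x y)\<^sup>2\<bar> \<le> (b\<^sup>2)\<^sup>2" for x y by (simp only: abs_power2 G_square_le)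
qed auto

text \<open>
  Given the coordinate \<open>i\<close>, a row sum is a sum of independent centred variables; both moments
  follow by adding one summand at a time.
\<close>

lemma row_sum_moments:
  assumes i: "i \<in> I" and K: "K \<subseteq> I - {i}"
  shows "EE (\<lambda>x. (\<Sum>k\<in>K. h (x i) (x k))\<^sup>2) = card K * v" (is ?A)
    and "EE (\<lambda>x. (\<Sum>k\<in>K. h (x i) (x k))^4) \<le> 4 * (real (card K))\<^sup>2 * b\<^sup>2 * v" (is ?B)
proof -
  have "finite K" using K finite_I finite_subset by blast
  then have "?A \<and> ?B" using K
  proof (induction K rule: finite_induct)
    case empty then show ?case by simp
  next
    case (insert k K)
    define S where "S x = (\<Sum>k\<in>K. h (x i) (x k))" for x
    define e where "e x = h (x i) (x k)" for x
    have k: "k \<in> I" "k \<noteq> i" "k \<notin> K" and KI: "K \<subseteq> I - {i}" using insert by auto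
    have bS: "bdm S" unfolding S_def using KI i by (intro bdm_sum bdm_h) auto
    have be: "bdm e" unfolding e_def by (intro bdm_h i k)
    have IH: "EE (\<lambda>x. (S x)\<^sup>2) = card K * v" "EE (\<lambda>x. (S x)^4) \<le> 4 * (real (card K))\<^sup>2 * b\<^sup>2 * v"
      using insert.IH KI unfolding S_def by auto
    have e_le: "\<bar>e x\<bar> \<le> b" for x unfolding e_def by (rule h_le)
    have e2: "EE (\<lambda>x. (e x)\<^sup>2) = v" unfolding e_def using i k by (intro EE_h2) auto
    have orth: "EE (\<lambda>x. e x * (S x)^p) = 0" for p
    proof (rule EE_orth[of _ _ k])
      show "(\<integral>y. e (x(k := y)) \<partial>\<mu>) = 0" if "x \<in> space \<Omega>" for x
        unfolding e_def using k h_deg[OF space_coord[OF that i]] by simp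
      show "S (x(k := y)) ^ p = S x ^ p" for x y
        unfolding S_def using k by (intro arg_cong[where f="\<lambda>z. z^p"] sum.cong) auto
    qed (use be bS k in \<open>auto intro: bdm_intros\<close>)
    have card: "card (insert k K) = Suc (card K)" using insert by simp
    have sum: "(\<Sum>l\<in>insert k K. h (x i) (x l)) = S x + e x" for x
      unfolding S_def e_def using insert by simp
    have "EE (\<lambda>x. (S x + e x)\<^sup>2) = EE (\<lambda>x. (S x)\<^sup>2 + 2 * (e x * S x ^ 1) + (e x)\<^sup>2)"
      by (intro Bochner_Integration.integral_cong) (auto simp: power2_eq_square algebra_simps)
    also have "\<dots> = EE (\<lambda>x. (S x)\<^sup>2) + 2 * EE (\<lambda>x. e x * S x ^ 1) + EE (\<lambda>x. (e x)\<^sup>2)"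
      using bS be by (simp add: bdm_integrable bdm_intros)
    finally have A: "EE (\<lambda>x. (S x + e x)\<^sup>2) = card (insert k K) * v"
      unfolding orth IH e2 card by (simp add: algebra_simps)
    have "EE (\<lambda>x. (S x + e x)^4) \<le> EE (\<lambda>x. (S x)^4 + 4 * (e x * (S x)^3) + (8 * b\<^sup>2 * (S x)\<^sup>2 + 3 * b\<^sup>2 * (e x)\<^sup>2))"
      using bS be by (intro EE_mono bdm_intros quartic_increment_le) (auto simp: e_le)
    also have "\<dots> = EE (\<lambda>x. (S x)^4) + 4 * EE (\<lambda>x. e x * (S x)^3) + (8 * b\<^sup>2 * EE (\<lambda>x. (S x)\<^sup>2) + 3 * b\<^sup>2 * EE (\<lambda>x. (e x)\<^sup>2))"
      using bS be by (simp add: bdm_integrable bdm_intros)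
    also have "\<dots> \<le> 4 * (real (card K))\<^sup>2 * b\<^sup>2 * v + (8 * b\<^sup>2 * (card K * v) + 3 * b\<^sup>2 * v)"
      unfolding orth IH(1) e2 using IH(2) by simp
    also have "\<dots> \<le> 4 * (real (card (insert k K)))\<^sup>2 * b\<^sup>2 * v"
      unfolding card using v_nonneg mult_nonneg_nonneg[OF zero_le_power2[of b] v_nonneg] by (simp add: power2_eq_square algebra_simps)
    finally show ?case using A unfolding sum by blast
  qed
  then show ?A ?B by auto
qed

lemma bdm_D: "i \<in> I \<Longrightarrow> bdm (D i)"
  unfolding D_def by (intro bdm_sum bdm_h) auto
lemma bdm_W: "bdm W"
  unfolding W_def by (intro bdm_intros bdm_D)
lemma bdm_T: "bdm T"
  unfolding T_def by (intro bdm_intros bdm_D)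

lemma EE_D2: "i \<in> I \<Longrightarrow> EE (\<lambda>x. (D i x)\<^sup>2) = (n - 1) * v"
proof -
  assume i: "i \<in> I"
  then have "Suc 0 \<le> card I" using finite_I by (auto simp: Suc_le_eq card_gt_0_iff)
  then show ?thesis
    unfolding D_def using row_sum_moments(1)[OF i order.refl] finite_I i by (simp add: of_nat_diff)
qed

lemma EE_T: "EE T = n * (n - 1) * v / 2"
  unfolding T_def by (simp add: EE_sum EE_D2 bdm_power bdm_D)

lemma sum_EE_D4_le: "(\<Sum>i\<in>I. EE (\<lambda>x. (D i x)^4)) \<le> 4 * (n^3 * b\<^sup>2 * v)"
proof -
  have "EE (\<lambda>x. (D i x)^4) \<le> 4 * n\<^sup>2 * b\<^sup>2 * v" if i: "i \<in> I" for i
  proof -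
    have "EE (\<lambda>x. (D i x)^4) \<le> 4 * (real (card (I - {i})))\<^sup>2 * b\<^sup>2 * v"
      unfolding D_def by (rule row_sum_moments(2)[OF i]) simp
    also have "\<dots> \<le> 4 * n\<^sup>2 * b\<^sup>2 * v"
      using v_nonneg finite_I by (intro mult_right_mono mult_left_mono power_mono) (auto intro: card_mono)
    finally show ?thesis .
  qed
  then have "(\<Sum>i\<in>I. EE (\<lambda>x. (D i x)^4)) \<le> (\<Sum>i\<in>I. 4 * n\<^sup>2 * b\<^sup>2 * v)" by (rule sum_mono)
  then show ?thesis by (simp add: power3_eq_cube power2_eq_square mult_ac)
qed

definition pairs :: "('i \<times> 'i) set" where "pairs = Sigma I (\<lambda>i. I - {i})"
definition triples :: "('i \<times> 'i \<times> 'i) set" where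
  "triples = Sigma I (\<lambda>i. Sigma (I - {i}) (\<lambda>k. I - {i, k}))"

lemma finite_pairs: "finite pairs" and finite_triples: "finite triples"
  using finite_I by (auto simp: pairs_def triples_def)

lemma card_pairs: "real (card pairs) = n * (n - 1)"
proof (cases "I = {}")
  case False
  then have "Suc 0 \<le> card I" using finite_I by (simp add: Suc_le_eq card_gt_0_iff)
  then show ?thesis using finite_I by (simp add: pairs_def of_nat_diff)
next
  case True
  then have "card (Sigma I (\<lambda>i. I - {i})) = 0" by simp
  then show ?thesis unfolding pairs_def using True by simp
qed

lemma card_pairs_le: "real (card pairs) \<le> n\<^sup>2"
  unfolding card_pairs by (simp add: power2_eq_square algebra_simps)

lemma card_triples_le: "real (card triples) \<le> n^3"
proof -
  have "card triples \<le> card (I \<times> I \<times> I)"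
    using finite_I by (intro card_mono) (auto simp: triples_def)
  then have "real (card triples) \<le> real (card (I \<times> I \<times> I))" by (rule of_nat_mono)
  then show ?thesis by (simp add: power3_eq_cube card_cartesian_product mult.assoc)
qed

text \<open>
  The products \<open>h(x\<^sub>i,x\<^sub>k) h(x\<^sub>i,x\<^sub>l)\<close> over distinct triples are degenerate in \<open>k\<close> and \<open>l\<close> but not in
  \<open>i\<close>. Subtracting \<open>G(x\<^sub>k,x\<^sub>l)\<close>, the mean over \<open>x\<^sub>i\<close>, makes them degenerate in all three indices.
\<close>

lemma T_decomp:
  "2 * (T x - EE T) = (\<Sum>(i, k)\<in>pairs. (h (x i) (x k))\<^sup>2 - v)
     + (\<Sum>(i, k, l)\<in>triples. h (x i) (x k) * h (x i) (x l) - G (x k) (x l))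
     + (\<Sum>(i, k, l)\<in>triples. G (x k) (x l))"
proof -
  have "(D i x)\<^sup>2 = (\<Sum>k\<in>I-{i}. (h (x i) (x k))\<^sup>2) + (\<Sum>k\<in>I-{i}. \<Sum>l\<in>I-{i,k}. h (x i) (x k) * h (x i) (x l))" for i
  proof -
    have "(D i x)\<^sup>2 = (\<Sum>k\<in>I-{i}. \<Sum>l\<in>I-{i}. h (x i) (x k) * h (x i) (x l))"
      unfolding D_def power2_eq_square sum_product ..
    also have "\<dots> = (\<Sum>k\<in>I-{i}. (h (x i) (x k))\<^sup>2 + (\<Sum>l\<in>I-{i,k}. h (x i) (x k) * h (x i) (x l)))"
    proof (intro sum.cong refl)
      fix k assume "k \<in> I - {i}"
      then show "(\<Sum>l\<in>I-{i}. h (x i) (x k) * h (x i) (x l)) = (h (x i) (x k))\<^sup>2 + (\<Sum>l\<in>I-{i,k}. h (x i) (x k) * h (x i) (x l))"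
        using finite_I sum.remove[of "I - {i}" k "\<lambda>l. h (x i) (x k) * h (x i) (x l)"]
          Diff_insert[of I k "{i}"] Diff_insert2[of I i "{k}"]
        by (simp only: power2_eq_square finite_Diff)
    qed
    finally show ?thesis by (simp add: sum.distrib)
  qed
  then have "2 * T x = (\<Sum>(i, k)\<in>pairs. (h (x i) (x k))\<^sup>2) + (\<Sum>(i, k, l)\<in>triples. h (x i) (x k) * h (x i) (x l))"
    unfolding T_def pairs_def triples_def using finite_I
    by (simp add: sum.distrib sum.Sigma)
  moreover have "2 * EE T = (\<Sum>(i, k)\<in>pairs. v)"
    using card_pairs by (simp add: EE_T split_beta')
  ultimately show ?thesis
    by (simp add: split_beta' sum_subtractf right_diff_distrib)
qed

text \<open>
  Terms without a common index are uncorrelated, and each pair meets at most \<open>4 n\<close> others.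
\<close>

lemma EE_pairs_part:
  "EE (\<lambda>x. (\<Sum>(i, k)\<in>pairs. (h (x i) (x k))\<^sup>2 - v)\<^sup>2) \<le> 4 * (n^3 * b\<^sup>2 * v)"
proof -
  define Y where "Y p x = (h (x (fst p)) (x (snd p)))\<^sup>2 - v" for p :: "'i \<times> 'i" and x :: "'i \<Rightarrow> 'a"
  define R where "R p q \<longleftrightarrow> {fst p, snd p} \<inter> {fst q, snd q} \<noteq> {}" for p q :: "'i \<times> 'i"
  have bY: "bdm (Y p)" if "p \<in> pairs" for p
    unfolding Y_def using that by (intro bdm_intros bdm_h) (auto simp: pairs_def)
  have "EE (\<lambda>x. (\<Sum>p\<in>pairs. Y p x)\<^sup>2) \<le> (4 * n) * (\<Sum>p\<in>pairs. EE (\<lambda>x. (Y p x)\<^sup>2))"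
  proof (rule EE_sum_square_le[where R = R])
    fix p q assume pq: "p \<in> pairs" "q \<in> pairs" "\<not> R p q"
    obtain i k i' k' where [simp]: "p = (i, k)" "q = (i', k')" by fastforce
    have ik: "i \<in> I" "k \<in> I" "i \<noteq> k" "i \<noteq> i'" "i \<noteq> k'" "k \<noteq> i'" "k \<noteq> k'"
      using pq by (auto simp: pairs_def R_def)
    define u where "u x = (\<integral>y. (h x y)\<^sup>2 \<partial>\<mu>)" for x
    have u_le: "\<bar>u x\<bar> \<le> b\<^sup>2" for x
    proof -
      have "\<bar>u x\<bar> \<le> (\<integral>y. \<bar>(h x y)\<^sup>2\<bar> \<partial>\<mu>)" unfolding u_def by (rule integral_abs_bound)
      also have "\<dots> \<le> (\<integral>y. b\<^sup>2 \<partial>\<mu>)" by (rule integral_mono') (auto simp: h_square_le)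
      finally show ?thesis by (simp add: prob_space)
    qed
    have u_meas: "u \<in> borel_measurable \<mu>" unfolding u_def by measurable
    have bu: "bdm (\<lambda>x. u (x i) - v)"
      by (intro bdm_intros EE_single(2)[OF u_meas u_le]) (rule ik)
    have int_h2: "integrable \<mu> (\<lambda>y. (h z y)\<^sup>2)" if "z \<in> space \<mu>" for z
      using that by (intro integrable_const_bound[where B="b\<^sup>2"]) (auto simp: h_square_le)
    have int_u: "integrable \<mu> u" using u_le u_meas by (intro integrable_const_bound[where B="b\<^sup>2"]) auto
    have "EE (\<lambda>x. Y p x * Y q x) = EE (\<lambda>x. \<integral>y. Y p (x(k := y)) * Y q (x(k := y)) \<partial>\<mu>)"
      using pq ik by (intro EE_coord bdm_mult bY)
    also have "\<dots> = EE (\<lambda>x. (u (x i) - v) * Y q x)"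
      using ik int_h2 space_coord[OF _ ik(1)]
      by (intro Bochner_Integration.integral_cong refl) (simp add: Y_def u_def prob_space)
    also have "\<dots> = 0"
    proof (rule EE_orth[OF bu bY[OF pq(2)] ik(1)])
      show "(\<integral>y. u ((x(i := y)) i) - v \<partial>\<mu>) = 0" for x
        using int_u by (simp add: prob_space) (simp add: u_def[abs_def] v_def)
    qed (use ik in \<open>auto simp: Y_def\<close>)
    finally show "EE (\<lambda>x. Y p x * Y q x) = 0" .
  next
    fix p assume "p \<in> pairs"
    have "{q \<in> pairs. R p q} \<subseteq> {fst p, snd p} \<times> I \<union> I \<times> {fst p, snd p}"
      by (auto simp: R_def pairs_def)
    then have "card {q \<in> pairs. R p q} \<le> card ({fst p, snd p} \<times> I \<union> I \<times> {fst p, snd p})"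
      using finite_I by (intro card_mono) auto
    also have "\<dots> \<le> card ({fst p, snd p} \<times> I) + card (I \<times> {fst p, snd p})" by (rule card_Un_le)
    also have "\<dots> = 2 * (card {fst p, snd p} * card I)" unfolding card_cartesian_product by simp
    also have "\<dots> \<le> 2 * (2 * card I)" by (intro mult_left_mono mult_right_mono) (auto simp: card_insert_if)
    finally show "real (card {q \<in> pairs. R p q}) \<le> 4 * n" by simp
  qed (auto simp: finite_pairs bY R_def)
  also have "\<dots> \<le> (4 * n) * (\<Sum>p\<in>pairs. b\<^sup>2 * v)"
  proof (intro mult_left_mono sum_mono)
    fix p assume p: "p \<in> pairs"
    obtain i k where [simp]: "p = (i, k)" by fastforce
    have ik: "i \<in> I" "k \<in> I" "i \<noteq> k" using p by (auto simp: pairs_def)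
    let ?e = "\<lambda>x. (h (x i) (x k))\<^sup>2"
    have "EE (\<lambda>x. (Y p x)\<^sup>2) \<le> EE (\<lambda>x. b\<^sup>2 * ?e x + v\<^sup>2 - 2 * v * ?e x)"
    proof (intro EE_mono bdm_intros bY p bdm_h ik)
      fix x have "?e x * ?e x \<le> b\<^sup>2 * ?e x" by (intro mult_right_mono h_square_le) auto
      then show "(Y p x)\<^sup>2 \<le> b\<^sup>2 * ?e x + v\<^sup>2 - 2 * v * ?e x"
        by (simp add: Y_def power2_eq_square algebra_simps)
    qed
    also have "\<dots> = b\<^sup>2 * v + v\<^sup>2 - 2 * v * v"
      using ik by (simp add: bdm_integrable bdm_intros bdm_h EE_h2 P.prob_space)
    also have "\<dots> \<le> b\<^sup>2 * v" by (simp add: power2_eq_square)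
    finally show "EE (\<lambda>x. (Y p x)\<^sup>2) \<le> b\<^sup>2 * v" .
  qed auto
  also have "\<dots> \<le> (4 * n) * (n\<^sup>2 * (b\<^sup>2 * v))"
    using card_pairs_le v_nonneg by (auto intro!: mult_left_mono mult_right_mono)
  finally show ?thesis unfolding Y_def by (simp add: split_beta' power3_eq_cube power2_eq_square mult_ac)
qed

text \<open>
  The summand does not depend on \<open>i\<close>, so that a triple has about \<open>2 n\<close> relatives with the same
  pair \<open>{k, l}\<close>. This is the dominant part of the variance of \<open>T\<close>.
\<close>

lemma EE_triples_G:
  "EE (\<lambda>x. (\<Sum>(i, k, l)\<in>triples. G (x k) (x l))\<^sup>2) \<le> 4 * (n^4 * g)"
proof -
  define Y where "Y t x = (case t of (i, k, l) \<Rightarrow> G (x k) (x l))" for t :: "'i \<times> 'i \<times> 'i" and x :: "'i \<Rightarrow> 'a"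
  define S where "S t = (case t of (i, k, l) \<Rightarrow> {k, l})" for t :: "'i \<times> 'i \<times> 'i"
  have "EE (\<lambda>x. (\<Sum>t\<in>triples. Y t x)\<^sup>2) \<le> (4 * n) * (\<Sum>t\<in>triples. EE (\<lambda>x. (Y t x)\<^sup>2))"
  proof (rule EE_sum_square_le_support[where S = S and c = 2])
    fix t assume t: "t \<in> triples"
    obtain i k l where [simp]: "t = (i, k, l)" by (cases t) auto
    have ikl: "i \<in> I" "k \<in> I" "l \<in> I" "k \<noteq> l" using t by (auto simp: triples_def)
    show "bdm (Y t)" unfolding Y_def using ikl by (auto intro: bdm_G)
    show "S t \<subseteq> I" "card (S t) = 2" using ikl by (auto simp: S_def)
    show "Y t (x(j := y)) = Y t x" if "j \<notin> S t" for j x y using that by (auto simp: Y_def S_def)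
    show "(\<integral>y. Y t (x(j := y)) \<partial>\<mu>) = 0" if j: "j \<in> S t" and x: "x \<in> space \<Omega>" for j x
    proof -
      have "j = k \<or> j = l" using j by (auto simp: S_def)
      then show ?thesis
      proof
        assume "j = k" then show ?thesis
          using ikl by (simp add: Y_def) (subst G_sym, simp add: G_deg space_coord[OF x])
      next
        assume "j = l" then show ?thesis
          using ikl by (simp add: Y_def G_deg space_coord[OF x])
      qed
    qed
    have "{t' \<in> triples. S t = S t'} \<subseteq> I \<times> {k, l} \<times> {k, l}"
      by (auto simp: S_def triples_def)
    then have "card {t' \<in> triples. S t = S t'} \<le> card (I \<times> {k, l} \<times> {k, l})"
      using finite_I by (intro card_mono) auto
    also have "\<dots> = 4 * card I" unfolding card_cartesian_product using ikl by simp
    finally show "real (card {t' \<in> triples. S t = S t'}) \<le> 4 * n" by simp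
  qed (rule finite_triples)
  also have "\<dots> = (4 * n) * (real (card triples) * g)"
  proof -
    have "EE (\<lambda>x. (Y t x)\<^sup>2) = g" if "t \<in> triples" for t
      using that by (auto simp: Y_def triples_def intro!: EE_G2)
    then show ?thesis by simp
  qed
  also have "\<dots> \<le> (4 * n) * (n^3 * g)"
    using card_triples_le g_nonneg by (intro mult_left_mono mult_right_mono) auto
  finally show ?thesis unfolding Y_def by (simp add: power4_eq_xxxx power3_eq_cube mult_ac)
qed

text \<open>
  By complete degeneracy only triples with the same underlying three-element set are correlated,
  hence at most \<open>27\<close> of them.
\<close>

lemma EE_triples_centered:
  "EE (\<lambda>x. (\<Sum>(i, k, l)\<in>triples. h (x i) (x k) * h (x i) (x l) - G (x k) (x l))\<^sup>2) \<le> 27 * (n^3 * b\<^sup>2 * v)"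
proof -
  define Y where "Y t x = (case t of (i, k, l) \<Rightarrow> h (x i) (x k) * h (x i) (x l) - G (x k) (x l))"
    for t :: "'i \<times> 'i \<times> 'i" and x :: "'i \<Rightarrow> 'a"
  define S where "S t = (case t of (i, k, l) \<Rightarrow> {i, k, l})" for t :: "'i \<times> 'i \<times> 'i"
  have bY: "bdm (Y t)" if "t \<in> triples" for t
    using that unfolding Y_def by (auto simp: triples_def intro!: bdm_intros bdm_h bdm_G)
  have int_hh: "integrable \<mu> (\<lambda>y. h y w * h y z)" if "w \<in> space \<mu>" "z \<in> space \<mu>" for w z
    using that h_section' by (intro integrable_const_bound[where B="b\<^sup>2"] AE_I2)
      (auto simp: abs_mult power2_eq_square b_nonneg intro!: mult_mono h_le)
  have int_h: "integrable \<mu> (\<lambda>y. h z y)" if "z \<in> space \<mu>" for z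
    using that by (intro integrable_const_bound[where B="b"] AE_I2) (auto simp: h_le)
  have int_G: "integrable \<mu> (\<lambda>y. G z y)" if "z \<in> space \<mu>" for z
    using that by (intro integrable_const_bound[where B="b\<^sup>2"] AE_I2) (auto simp: G_le)
  have "EE (\<lambda>x. (\<Sum>t\<in>triples. Y t x)\<^sup>2) \<le> 27 * (\<Sum>t\<in>triples. EE (\<lambda>x. (Y t x)\<^sup>2))"
  proof (rule EE_sum_square_le_support[where S = S and c = 3])
    fix t assume t: "t \<in> triples"
    obtain i k l where [simp]: "t = (i, k, l)" by (cases t) auto
    have ikl: "i \<in> I" "k \<in> I" "l \<in> I" "k \<noteq> l" "i \<noteq> k" "i \<noteq> l" using t by (auto simp: triples_def)
    show "bdm (Y t)" by (rule bY[OF t])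
    show "S t \<subseteq> I" "card (S t) = 3" using ikl by (auto simp: S_def)
    show "Y t (x(j := y)) = Y t x" if "j \<notin> S t" for j x y using that by (auto simp: Y_def S_def)
    show "(\<integral>y. Y t (x(j := y)) \<partial>\<mu>) = 0" if j: "j \<in> S t" and x: "x \<in> space \<Omega>" for j x
    proof -
      note sp = space_coord[OF x]
      consider "j = i" | "j = k" | "j = l" using j by (auto simp: S_def)
      then show ?thesis
      proof cases
        case 1 then show ?thesis
          using ikl int_hh[OF sp sp, of k l] by (simp add: Y_def prob_space G_def[symmetric])
      next
        case 2
        have "(\<integral>y. Y t (x(j := y)) \<partial>\<mu>) = (\<integral>y. h (x i) y * h (x i) (x l) - G (x l) y \<partial>\<mu>)"
          using ikl 2 by (intro Bochner_Integration.integral_cong refl) (simp add: Y_def G_sym)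
        then show ?thesis using ikl int_h[OF sp, of i] int_G[OF sp, of l]
          by (simp add: h_deg[OF sp] G_deg[OF sp])
      next
        case 3
        then show ?thesis using ikl int_h[OF sp, of i] int_G[OF sp, of k]
          by (simp add: Y_def h_deg[OF sp] G_deg[OF sp])
      qed
    qed
    have "{t' \<in> triples. S t = S t'} \<subseteq> {i, k, l} \<times> {i, k, l} \<times> {i, k, l}"
    proof
      fix t' assume "t' \<in> {t' \<in> triples. S t = S t'}"
      moreover obtain a c d where t': "t' = (a, c, d)" by (cases t') auto
      ultimately have "{i, k, l} = {a, c, d}" by (simp add: S_def)
      then have "a \<in> {i, k, l}" "c \<in> {i, k, l}" "d \<in> {i, k, l}" by blast+
      then show "t' \<in> {i, k, l} \<times> {i, k, l} \<times> {i, k, l}" unfolding t' by blast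
    qed
    then have "card {t' \<in> triples. S t = S t'} \<le> card ({i, k, l} \<times> {i, k, l} \<times> {i, k, l})"
      by (intro card_mono) auto
    also have "\<dots> = 27" unfolding card_cartesian_product using ikl by simp
    finally show "real (card {t' \<in> triples. S t = S t'}) \<le> 27" by simp
  qed (rule finite_triples)
  also have "\<dots> \<le> 27 * (\<Sum>t\<in>triples. b\<^sup>2 * v)"
  proof (intro mult_left_mono sum_mono)
    fix t assume t: "t \<in> triples"
    obtain i k l where [simp]: "t = (i, k, l)" by (cases t) auto
    have ikl: "i \<in> I" "k \<in> I" "l \<in> I" "k \<noteq> l" "i \<noteq> k" "i \<noteq> l" using t by (auto simp: triples_def)
    have bhh: "bdm (\<lambda>x. h (x i) (x k) * h (x i) (x l))" using ikl by (intro bdm_intros bdm_h)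
    have bG': "bdm (\<lambda>x. G (x k) (x l))" using ikl by (intro bdm_G)
    have cross: "EE (\<lambda>x. Y t x * G (x k) (x l)) = 0"
    proof (rule EE_orth[of _ _ i])
      show "(\<integral>y. Y t (x(i := y)) \<partial>\<mu>) = 0" if x: "x \<in> space \<Omega>" for x
        using ikl int_hh[OF space_coord[OF x] space_coord[OF x], of k l] by (simp add: Y_def prob_space G_def[symmetric])
      show "G ((x(i := y)) k) ((x(i := y)) l) = G (x k) (x l)" for x y using ikl by simp
    qed (rule bY[OF t] bG' ikl)+
    have "EE (\<lambda>x. (Y t x)\<^sup>2) \<le> EE (\<lambda>x. b\<^sup>2 * (h (x i) (x k))\<^sup>2 - 2 * (Y t x * G (x k) (x l)))"
    proof (intro EE_mono bdm_intros bY t bdm_h bG' ikl)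
      fix x
      have "(h (x i) (x k))\<^sup>2 * (h (x i) (x l))\<^sup>2 \<le> (h (x i) (x k))\<^sup>2 * b\<^sup>2"
        by (intro mult_left_mono h_square_le) auto
      moreover have "(Y t x)\<^sup>2 = (h (x i) (x k))\<^sup>2 * (h (x i) (x l))\<^sup>2 - 2 * (Y t x * G (x k) (x l)) - (G (x k) (x l))\<^sup>2"
        by (simp add: Y_def power2_eq_square algebra_simps)
      ultimately show "(Y t x)\<^sup>2 \<le> b\<^sup>2 * (h (x i) (x k))\<^sup>2 - 2 * (Y t x * G (x k) (x l))"
        using zero_le_power2[of "G (x k) (x l)"] by (simp only: mult.commute[of "b\<^sup>2"])
    qed
    also have "\<dots> = EE (\<lambda>x. b\<^sup>2 * (h (x i) (x k))\<^sup>2) - EE (\<lambda>x. 2 * (Y t x * G (x k) (x l)))"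
      using ikl by (intro EE_diff bdm_intros bY t bdm_h bG')
    also have "\<dots> = b\<^sup>2 * v"
      unfolding integral_mult_right_zero cross using ikl by (simp add: EE_h2)
    finally show "EE (\<lambda>x. (Y t x)\<^sup>2) \<le> b\<^sup>2 * v" .
  qed auto
  also have "\<dots> \<le> 27 * (n^3 * (b\<^sup>2 * v))"
    using card_triples_le v_nonneg by (auto intro!: mult_left_mono mult_right_mono)
  finally show ?thesis unfolding Y_def by (simp add: mult_ac)
qed

lemma T_variance_le: "EE (\<lambda>x. (T x - EE T)\<^sup>2) \<le> 24 * (n^3 * b\<^sup>2 * v) + 3 * (n^4 * g)"
proof -
  define A B C where "A x = (\<Sum>(i, k)\<in>pairs. (h (x i) (x k))\<^sup>2 - v)"
    and "B x = (\<Sum>(i, k, l)\<in>triples. h (x i) (x k) * h (x i) (x l) - G (x k) (x l))"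
    and "C x = (\<Sum>(i, k, l)\<in>triples. G (x k) (x l))" for x
  have bA: "bdm A"
    unfolding A_def split_beta'
    by (intro bdm_sum bdm_diff bdm_power bdm_const bdm_h) (auto simp: pairs_def)
  have bB: "bdm B"
    unfolding B_def split_beta'
    by (intro bdm_sum bdm_diff bdm_mult bdm_h bdm_G) (auto simp: triples_def)
  have bC: "bdm C"
    unfolding C_def split_beta' by (intro bdm_sum bdm_G) (auto simp: triples_def)
  note bd = bA bB bC
  have "EE (\<lambda>x. (T x - EE T)\<^sup>2) \<le> EE (\<lambda>x. 3/4 * ((A x)\<^sup>2 + (B x)\<^sup>2 + (C x)\<^sup>2))"
  proof (intro EE_mono bdm_intros bdm_T bd)
    fix x
    have e: "T x - EE T = (A x + B x + C x) / 2"
      using T_decomp[of x] unfolding A_def B_def C_def by simp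
    have "(A x + B x + C x)\<^sup>2 \<le> 3 * ((A x)\<^sup>2 + (B x)\<^sup>2 + (C x)\<^sup>2)"
      using sum_squares_bound[of "A x" "B x"] sum_squares_bound[of "A x" "C x"] sum_squares_bound[of "B x" "C x"]
      by (simp add: power2_eq_square algebra_simps)
    then show "(T x - EE T)\<^sup>2 \<le> 3/4 * ((A x)\<^sup>2 + (B x)\<^sup>2 + (C x)\<^sup>2)"
      unfolding e by (simp add: power_divide)
  qed
  also have "\<dots> = 3/4 * (EE (\<lambda>x. (A x)\<^sup>2) + EE (\<lambda>x. (B x)\<^sup>2) + EE (\<lambda>x. (C x)\<^sup>2))"
    unfolding integral_mult_right_zero by (simp only: EE_add bdm_add bdm_power bd)
  also have "\<dots> \<le> 3/4 * (4 * (n^3 * b\<^sup>2 * v) + 27 * (n^3 * b\<^sup>2 * v) + 4 * (n^4 * g))"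
    unfolding A_def B_def C_def
    by (intro mult_left_mono add_mono EE_pairs_part EE_triples_G EE_triples_centered) auto
  also have "\<dots> \<le> 24 * (n^3 * b\<^sup>2 * v) + 3 * (n^4 * g)"
    using v_nonneg by simp
  finally show ?thesis .
qed

section \<open>Normal approximation of degenerate quadratic forms\<close>

lemma W_leave_one_out:
  assumes i: "i \<in> I"
  shows "W x - D i x = (\<Sum>a\<in>I - {i}. \<Sum>k\<in>I - {a, i}. h (x a) (x k)) / 2"
proof -
  have "(\<Sum>a\<in>I. D a x) = D i x + (\<Sum>a\<in>I - {i}. D a x)"
    using i finite_I by (intro sum.remove)
  also have "(\<Sum>a\<in>I - {i}. D a x) = (\<Sum>a\<in>I - {i}. h (x i) (x a) + (\<Sum>k\<in>I - {a, i}. h (x a) (x k)))"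
  proof (intro sum.cong refl)
    fix a assume a: "a \<in> I - {i}"
    have "D a x = h (x a) (x i) + (\<Sum>k\<in>I - {a} - {i}. h (x a) (x k))"
      unfolding D_def using a i finite_I by (intro sum.remove) auto
    then show "D a x = h (x i) (x a) + (\<Sum>k\<in>I - {a, i}. h (x a) (x k))"
      by (simp only: h_sym[of "x a" "x i"] Diff_insert2[of I a "{i}"])
  qed
  also have "\<dots> = D i x + (\<Sum>a\<in>I - {i}. \<Sum>k\<in>I - {a, i}. h (x a) (x k))"
    by (simp add: sum.distrib D_def)
  finally show ?thesis unfolding W_def by (simp add: field_simps)
qed

lemma EE_D_leave_one_out:
  assumes i: "i \<in> I" and F: "continuous_on UNIV F"
  shows "EE (\<lambda>x. D i x * F (W x - D i x)) = 0"
proof (rule EE_orth[OF bdm_D[OF i] _ i])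
  show "bdm (\<lambda>x. F (W x - D i x))"
    by (rule bdm_continuous[OF _ F]) (intro bdm_diff bdm_W bdm_D i)
  show "(\<integral>y. D i (x(i := y)) \<partial>\<mu>) = 0" if x: "x \<in> space \<Omega>" for x
  proof -
    have "(\<integral>y. D i (x(i := y)) \<partial>\<mu>) = (\<integral>y. (\<Sum>k\<in>I - {i}. h (x k) y) \<partial>\<mu>)"
      unfolding D_def
      by (intro Bochner_Integration.integral_cong sum.cong refl) (simp add: h_sym[of "x _"])
    also have "\<dots> = (\<Sum>k\<in>I - {i}. \<integral>y. h (x k) y \<partial>\<mu>)"
    proof (rule Bochner_Integration.integral_sum)
      fix k assume "k \<in> I - {i}"
      then have "x k \<in> space \<mu>" using space_coord[OF x] by simp
      then show "integrable \<mu> (\<lambda>y. h (x k) y)"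
        by (intro integrable_const_bound[where B="b"] AE_I2) (auto simp: h_le)
    qed
    also have "\<dots> = 0" using space_coord[OF x] by (simp add: h_deg)
    finally show ?thesis .
  qed
  show "F (W (x(i := y)) - D i (x(i := y))) = F (W x - D i x)" for x y
    unfolding W_leave_one_out[OF i] by (intro arg_cong[where f=F] arg_cong2[where f="(/)"] sum.cong refl) auto
qed

text \<open>
  \<open>2 W\<close> is the sum of the \<open>D i\<close>, and subtracting \<open>E D i F(W - D i) = 0\<close> is free of charge.
\<close>

lemma EE_W_exchange:
  assumes F: "continuous_on UNIV F"
  shows "EE (\<lambda>x. W x * F (W x)) = EE (\<lambda>x. (\<Sum>i\<in>I. D i x * (F (W x) - F (W x - D i x))) / 2)"
proof -
  have b: "bdm (\<lambda>x. F (W x))" "\<And>i. i \<in> I \<Longrightarrow> bdm (\<lambda>x. F (W x - D i x))"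
    by (rule bdm_continuous[OF _ F], intro bdm_diff bdm_W bdm_D, assumption?)+
  have "EE (\<lambda>x. W x * F (W x)) = EE (\<lambda>x. \<Sum>i\<in>I. D i x * F (W x)) / 2"
    by (simp add: W_def sum_distrib_right)
  also have "EE (\<lambda>x. \<Sum>i\<in>I. D i x * F (W x)) = (\<Sum>i\<in>I. EE (\<lambda>x. D i x * F (W x)))"
    by (intro EE_sum bdm_mult bdm_D b)
  also have "\<dots> = (\<Sum>i\<in>I. EE (\<lambda>x. D i x * F (W x)) - EE (\<lambda>x. D i x * F (W x - D i x)))"
    by (simp add: EE_D_leave_one_out[OF _ F])
  also have "\<dots> = (\<Sum>i\<in>I. EE (\<lambda>x. D i x * F (W x) - D i x * F (W x - D i x)))"
    by (intro sum.cong refl EE_diff[symmetric] bdm_mult bdm_D b)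
  also have "\<dots> = EE (\<lambda>x. \<Sum>i\<in>I. D i x * F (W x) - D i x * F (W x - D i x))"
    by (intro EE_sum[symmetric] bdm_diff bdm_mult bdm_D b)
  finally show ?thesis by (simp add: right_diff_distrib)
qed

definition Q :: real where "Q = (\<Sum>i\<in>I. EE (\<lambda>x. (D i x)^4))"

lemma Q_eq: "Q = EE (\<lambda>x. \<Sum>i\<in>I. (D i x)^4)"
  unfolding Q_def by (intro EE_sum[symmetric] bdm_power bdm_D)

lemma sum_D2: "(\<Sum>i\<in>I. (D i x)\<^sup>2) = 2 * T x"
  by (simp add: T_def)

lemma bdm_sumD: "bdm (\<lambda>x. \<Sum>i\<in>I. (D i x)^p)" "bdm (\<lambda>x. \<Sum>i\<in>I. \<bar>D i x\<bar>^p)"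
  by (intro bdm_sum bdm_power bdm_abs bdm_D, assumption)+

text \<open>
  Apply the exchange identity to the cube. The leading term \<open>W\<^sup>2 T\<close> is absorbed by half of the
  fourth moment itself and by \<open>T\<^sup>2\<close>.
\<close>

lemma EE_W4_le: "EE (\<lambda>x. (W x)^4) \<le> 81/4 * EE (\<lambda>x. (T x)\<^sup>2) + 5/2 * Q"
proof -
  have *: "(\<Sum>i\<in>I. D i x * ((W x)^3 - (W x - D i x)^3)) / 2
      \<le> (W x)^4 / 2 + 81/8 * (T x)\<^sup>2 + 5/4 * (\<Sum>i\<in>I. (D i x)^4)" for x
  proof -
    have "D i x * ((W x)^3 - (W x - D i x)^3) \<le> 9/2 * ((W x)\<^sup>2 * (D i x)\<^sup>2) + 5/2 * (D i x)^4" for i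
    proof -
      let ?w = "W x" and ?d = "D i x"
      have "- (?w * ?d^3) \<le> (?w\<^sup>2 * ?d\<^sup>2 + ?d^4) / 2"
        using mult_left_mono[OF mult_le_half_squares[of "- ?w" ?d], of "?d\<^sup>2"]
        by (simp add: algebra_simps power2_eq_square power3_eq_cube power4_eq_xxxx)
      moreover have "?d * (?w^3 - (?w - ?d)^3) = 3 * (?w\<^sup>2 * ?d\<^sup>2) - 3 * (?w * ?d^3) + ?d^4"
        by (simp add: algebra_simps power2_eq_square power3_eq_cube power4_eq_xxxx)
      ultimately show ?thesis by (simp add: field_simps)
    qed
    then have "(\<Sum>i\<in>I. D i x * ((W x)^3 - (W x - D i x)^3))
        \<le> (\<Sum>i\<in>I. 9/2 * ((W x)\<^sup>2 * (D i x)\<^sup>2) + 5/2 * (D i x)^4)"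
      by (rule sum_mono)
    also have "\<dots> = 9/2 * ((W x)\<^sup>2 * (\<Sum>i\<in>I. (D i x)\<^sup>2)) + 5/2 * (\<Sum>i\<in>I. (D i x)^4)"
      by (simp only: sum.distrib sum_distrib_left)
    also have "(\<Sum>i\<in>I. (D i x)\<^sup>2) = 2 * T x" by (rule sum_D2)
    finally have 1: "(\<Sum>i\<in>I. D i x * ((W x)^3 - (W x - D i x)^3)) / 2
       \<le> 9/2 * ((W x)\<^sup>2 * T x) + 5/4 * (\<Sum>i\<in>I. (D i x)^4)" by simp
    have "(W x)\<^sup>2 * (9/2 * T x) \<le> ((W x)\<^sup>2)\<^sup>2 / 2 + (9/2 * T x)\<^sup>2 / 2"
      using mult_le_half_squares[of "(W x)\<^sup>2" "9/2 * T x"] by (simp only: add_divide_distrib)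
    then have "9/2 * ((W x)\<^sup>2 * T x) \<le> (W x)^4 / 2 + 81/8 * (T x)\<^sup>2"
      by (simp add: power2_eq_square power4_eq_xxxx algebra_simps)
    with 1 show ?thesis by linarith
  qed
  have "EE (\<lambda>x. (W x)^4) = EE (\<lambda>x. W x * (W x)^3)"
    by (simp add: power4_eq_xxxx power3_eq_cube mult.assoc)
  also have "\<dots> = EE (\<lambda>x. (\<Sum>i\<in>I. D i x * ((W x)^3 - (W x - D i x)^3)) / 2)"
    by (rule EE_W_exchange) (intro continuous_intros)
  also have "\<dots> \<le> EE (\<lambda>x. (W x)^4 / 2 + 81/8 * (T x)\<^sup>2 + 5/4 * (\<Sum>i\<in>I. (D i x)^4))"
    by (intro EE_mono * bdm_intros bdm_D bdm_W bdm_T)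
  also have "\<dots> = EE (\<lambda>x. (W x)^4 / 2) + EE (\<lambda>x. 81/8 * (T x)\<^sup>2) + EE (\<lambda>x. 5/4 * (\<Sum>i\<in>I. (D i x)^4))"
    by (simp only: EE_add bdm_add bdm_mult bdm_const bdm_power bdm_divide bdm_W bdm_T bdm_sumD)
  also have "\<dots> = EE (\<lambda>x. (W x)^4) / 2 + 81/8 * EE (\<lambda>x. (T x)\<^sup>2) + 5/4 * Q"
    by (simp add: Q_eq)
  finally show ?thesis by simp
qed

text \<open>
  Third moments are reached by interpolating between second and fourth ones; the weight \<open>\<kappa>\<close> is
  later chosen of the order of the square root of the fourth ones.
\<close>

lemma half_cube_le:
  fixes d \<kappa> :: real assumes "0 < \<kappa>"
  shows "\<bar>d\<bar>^3 \<le> (\<kappa> * d\<^sup>2 + d^4 / \<kappa>) / 2" "\<bar>w\<bar> * \<bar>d\<bar>^3 \<le> (\<kappa> * (w\<^sup>2 * d\<^sup>2) + d^4 / \<kappa>) / 2"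
proof -
  have *: "\<bar>w\<bar> * \<bar>d\<bar>^3 \<le> (\<kappa> * (w\<^sup>2 * d\<^sup>2) + d^4 / \<kappa>) / 2" for w :: real
  proof -
    have "0 \<le> (\<kappa> * \<bar>w\<bar> - \<bar>d\<bar>)\<^sup>2 * (d\<^sup>2 / (2 * \<kappa>))" using assms by simp
    also have "\<dots> = (\<kappa> * (w\<^sup>2 * d\<^sup>2) + d^4 / \<kappa>) / 2 - \<bar>w\<bar> * (\<bar>d\<bar> * d\<^sup>2)"
      using assms by (simp add: power2_eq_square power4_eq_xxxx field_simps)
    also have "\<bar>d\<bar> * d\<^sup>2 = \<bar>d\<bar>^3" by (simp add: power3_eq_cube power2_eq_square abs_mult_self_eq mult.assoc)
    finally show ?thesis by simp
  qed
  show "\<bar>d\<bar>^3 \<le> (\<kappa> * d\<^sup>2 + d^4 / \<kappa>) / 2" using *[of 1] by simp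
  show "\<bar>w\<bar> * \<bar>d\<bar>^3 \<le> (\<kappa> * (w\<^sup>2 * d\<^sup>2) + d^4 / \<kappa>) / 2" by (rule *)
qed

text \<open>
  Inserting Stein's solution into the exchange identity leaves \<open>E F'(W) (1 - T)\<close>, where \<open>F'\<close> is
  bounded by \<open>2\<close>, and a remainder of third order. The number \<open>n\<^sup>3 b\<^sup>2 v\<close> bounds fourth moments, and
  \<open>\<kappa>\<close> stands for its square root.
\<close>

theorem smooth_distance_le:
  fixes H :: "real \<Rightarrow> real"
  assumes H: "\<And>x y. \<bar>H x - H y\<bar> \<le> \<bar>x - y\<bar> / \<epsilon>" "\<And>x. 0 \<le> H x" "\<And>x. H x \<le> 1"
    and \<epsilon>: "0 < \<epsilon>" "\<epsilon> \<le> 1"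
    and small: "24 * (n^3 * b\<^sup>2 * v) + 3 * (n^4 * g) \<le> 1" and s: "EE T \<le> 2"
    and \<kappa>: "0 < \<kappa>" "n^3 * b\<^sup>2 * v \<le> \<kappa>\<^sup>2"
  shows "\<bar>EE (\<lambda>x. H (W x)) - (LINT x|lborel. std_normal_density x * H x)\<bar>
     \<le> 2 * (\<bar>1 - EE T\<bar> + sqrt (24 * (n^3 * b\<^sup>2 * v) + 3 * (n^4 * g))) + 126 * \<kappa> / \<epsilon>"
proof -
  define m where "m = (LINT x|lborel. std_normal_density x * H x)"
  define V where "V = 24 * (n^3 * b\<^sup>2 * v) + 3 * (n^4 * g)"
  define s where "s = EE T"
  have contH: "continuous_on UNIV H"
  proof (rule continuous_on_iff[THEN iffD2], intro ballI allI impI)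
    fix x e :: real assume e: "0 < e"
    show "\<exists>d>0. \<forall>y\<in>UNIV. dist y x < d \<longrightarrow> dist (H y) (H x) < e"
    proof (intro exI[of _ "e * \<epsilon>"] conjI ballI impI)
      fix y assume "dist y x < e * \<epsilon>"
      then have "\<bar>y - x\<bar> / \<epsilon> < e" using \<epsilon> by (simp add: dist_real_def field_simps)
      then show "dist (H y) (H x) < e" using H(1)[of y x] by (simp add: dist_real_def)
    qed (use e \<epsilon> in auto)
  qed
  obtain F F' where F: "\<And>x. (F has_real_derivative F' x) (at x)"
    and F': "\<And>x. F' x = x * F x + H x - m" and F_le: "\<And>x. \<bar>F x\<bar> \<le> 6" and F'_le: "\<And>x. \<bar>F' x\<bar> \<le> 2"
    by (rule stein_equation_solution[OF contH H(2,3), folded m_def]) (rule that; assumption)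
  have contF: "continuous_on UNIV F"
    using F by (meson DERIV_isCont continuous_at_imp_continuous_on)
  have contF': "continuous_on UNIV F'"
    unfolding F'[abs_def] by (intro continuous_intros contF contH)
  have bF: "bdm (\<lambda>x. F (W x))" "bdm (\<lambda>x. F' (W x))" "bdm (\<lambda>x. H (W x))"
    "\<And>i. i \<in> I \<Longrightarrow> bdm (\<lambda>x. F (W x - D i x))"
    by (rule bdm_continuous[OF _ contF] bdm_continuous[OF _ contF'] bdm_continuous[OF _ contH],
        intro bdm_diff bdm_W bdm_D, assumption?)+
  define A where "A = 6 + 1 / \<epsilon>"
  have rem: "\<bar>F w - F (w - d) - d * F' w\<bar> \<le> (A + 2 * \<bar>w\<bar>) * d\<^sup>2" for w d
    unfolding A_def by (rule stein_remainder[OF F F' F_le F'_le]) (use H(1) \<epsilon> in auto)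
  have A: "0 \<le> A" using \<epsilon> by (simp add: A_def)
  have bdT: "bdm (\<lambda>x. \<bar>1 - T x\<bar>)" by (intro bdm_intros bdm_T)
  have s_nonneg: "0 \<le> s" unfolding s_def T_def by (intro EE_nonneg divide_nonneg_nonneg sum_nonneg) auto
  have varT: "EE (\<lambda>x. (T x - s)\<^sup>2) \<le> V" unfolding V_def s_def by (rule T_variance_le)
  have "EE (\<lambda>x. \<bar>T x - s\<bar>) \<le> sqrt V"
  proof -
    have "(EE (\<lambda>x. \<bar>T x - s\<bar>))\<^sup>2 \<le> EE (\<lambda>x. \<bar>T x - s\<bar>\<^sup>2)"
    proof -
      have "0 \<le> EE (\<lambda>x. (\<bar>T x - s\<bar> - EE (\<lambda>x. \<bar>T x - s\<bar>))\<^sup>2)" by (rule EE_nonneg) simp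
      also have "\<dots> = EE (\<lambda>x. \<bar>T x - s\<bar>\<^sup>2) - (EE (\<lambda>x. \<bar>T x - s\<bar>))\<^sup>2"
        by (rule P.variance_eq) (intro bdm_integrable bdm_intros bdm_T)+
      finally show ?thesis by simp
    qed
    then show ?thesis using varT by (simp add: real_le_rsqrt)
  qed
  moreover have "EE (\<lambda>x. \<bar>1 - T x\<bar>) \<le> EE (\<lambda>x. \<bar>1 - s\<bar> + \<bar>T x - s\<bar>)"
    by (intro EE_mono bdm_intros bdm_T) linarith
  moreover have "EE (\<lambda>x. \<bar>1 - s\<bar> + \<bar>T x - s\<bar>) = \<bar>1 - s\<bar> + EE (\<lambda>x. \<bar>T x - s\<bar>)"
    by (subst EE_add) (auto intro!: bdm_intros bdm_T simp: P.prob_space)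
  ultimately have E1T: "EE (\<lambda>x. \<bar>1 - T x\<bar>) \<le> \<bar>1 - s\<bar> + sqrt V" by simp
  have ET2: "EE (\<lambda>x. (T x)\<^sup>2) \<le> 10"
  proof -
    have "EE (\<lambda>x. (T x)\<^sup>2) \<le> EE (\<lambda>x. 2 * (T x - s)\<^sup>2 + 2 * s\<^sup>2)"
      using zero_le_power2[of "T _ - 2 * s"]
      by (intro EE_mono bdm_intros bdm_T) (simp add: power2_eq_square algebra_simps)
    also have "\<dots> = EE (\<lambda>x. 2 * (T x - s)\<^sup>2) + EE (\<lambda>x. 2 * s\<^sup>2)"
      by (intro EE_add bdm_intros bdm_T)
    also have "\<dots> = 2 * EE (\<lambda>x. (T x - s)\<^sup>2) + 2 * s\<^sup>2"
      by (simp add: P.prob_space)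
    also have "s\<^sup>2 \<le> 2\<^sup>2" using s s_nonneg unfolding s_def by (intro power_mono)
    finally show ?thesis using varT small unfolding V_def by simp
  qed
  have Q: "Q \<le> 4 * (n^3 * b\<^sup>2 * v)" unfolding Q_def by (rule sum_EE_D4_le)
  have Q\<kappa>: "Q \<le> 4 * \<kappa>\<^sup>2" using Q \<kappa> by linarith
  have "0 \<le> n^3 * b\<^sup>2 * v" "0 \<le> n^4 * g" using v_nonneg g_nonneg by auto
  then have "Q \<le> 1" using Q small by linarith
  then have EW4: "EE (\<lambda>x. (W x)^4) \<le> 210" using EE_W4_le ET2 by linarith
  have EW2T: "EE (\<lambda>x. (W x)\<^sup>2 * T x) \<le> 110"
  proof -
    have "EE (\<lambda>x. (W x)\<^sup>2 * T x) \<le> EE (\<lambda>x. ((W x)^4 + (T x)\<^sup>2) / 2)"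
      using mult_le_half_squares[of "(W _)\<^sup>2"]
      by (intro EE_mono bdm_intros bdm_T bdm_W) (simp flip: power_mult)
    also have "\<dots> = (EE (\<lambda>x. (W x)^4) + EE (\<lambda>x. (T x)\<^sup>2)) / 2"
      using EE_add[OF bdm_power[OF bdm_W] bdm_power[OF bdm_T], of 4 2] by simp
    finally have le: "EE (\<lambda>x. (W x)\<^sup>2 * T x) \<le> (EE (\<lambda>x. (W x)^4) + EE (\<lambda>x. (T x)\<^sup>2)) / 2" .
    have "p \<le> 110" if "p \<le> (q + r) / 2" "q \<le> 210" "r \<le> 10" for p q r :: real
      using that by argo
    from this[OF le EW4 ET2] show ?thesis .
  qed
  define r where "r x = (\<Sum>i\<in>I. (A + 2 * \<bar>W x\<bar>) * \<bar>D i x\<bar>^3) / 2" for x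
  have br: "bdm r" unfolding r_def by (intro bdm_intros bdm_W bdm_D)
  have r_le: "EE r \<le> (2 * A + 112) * \<kappa>"
  proof -
    have le: "r x \<le> A * \<kappa> / 2 * T x + \<kappa> * ((W x)\<^sup>2 * T x) + (A + 2) / (4 * \<kappa>) * (\<Sum>i\<in>I. (D i x)^4)" for x
    proof -
      have "(A + 2 * \<bar>W x\<bar>) * \<bar>D i x\<bar>^3 \<le> A * \<kappa> / 2 * (D i x)\<^sup>2 + \<kappa> * (W x)\<^sup>2 * (D i x)\<^sup>2 + (A + 2) / (2 * \<kappa>) * (D i x)^4" for i
      proof -
        have "(A + 2 * \<bar>W x\<bar>) * \<bar>D i x\<bar>^3 = A * \<bar>D i x\<bar>^3 + 2 * (\<bar>W x\<bar> * \<bar>D i x\<bar>^3)"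
          by (simp add: algebra_simps)
        also have "\<dots> \<le> A * ((\<kappa> * (D i x)\<^sup>2 + (D i x)^4 / \<kappa>) / 2) + 2 * ((\<kappa> * ((W x)\<^sup>2 * (D i x)\<^sup>2) + (D i x)^4 / \<kappa>) / 2)"
          by (intro add_mono mult_left_mono half_cube_le \<kappa> A) simp
        also have "\<dots> = A * \<kappa> / 2 * (D i x)\<^sup>2 + \<kappa> * (W x)\<^sup>2 * (D i x)\<^sup>2 + (A + 2) / (2 * \<kappa>) * (D i x)^4"
          using \<kappa> by (simp add: field_simps)
        finally show ?thesis .
      qed
      then have "(\<Sum>i\<in>I. (A + 2 * \<bar>W x\<bar>) * \<bar>D i x\<bar>^3)
        \<le> (\<Sum>i\<in>I. A * \<kappa> / 2 * (D i x)\<^sup>2 + \<kappa> * (W x)\<^sup>2 * (D i x)\<^sup>2 + (A + 2) / (2 * \<kappa>) * (D i x)^4)"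
        by (rule sum_mono)
      also have "\<dots> = A * \<kappa> / 2 * (2 * T x) + \<kappa> * (W x)\<^sup>2 * (2 * T x) + (A + 2) / (2 * \<kappa>) * (\<Sum>i\<in>I. (D i x)^4)"
        unfolding sum_D2[symmetric] by (simp only: sum.distrib sum_distrib_left)
      finally show ?thesis unfolding r_def using \<kappa> by (simp add: field_simps)
    qed
    have "EE r \<le> EE (\<lambda>x. A * \<kappa> / 2 * T x + \<kappa> * ((W x)\<^sup>2 * T x) + (A + 2) / (4 * \<kappa>) * (\<Sum>i\<in>I. (D i x)^4))"
      by (intro EE_mono br le bdm_intros bdm_T bdm_W bdm_D)
    also have "\<dots> = EE (\<lambda>x. A * \<kappa> / 2 * T x) + EE (\<lambda>x. \<kappa> * ((W x)\<^sup>2 * T x)) + EE (\<lambda>x. (A + 2) / (4 * \<kappa>) * (\<Sum>i\<in>I. (D i x)^4))"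
      by (simp only: EE_add bdm_add bdm_mult bdm_const bdm_power bdm_W bdm_T bdm_sumD)
    also have "\<dots> = A * \<kappa> / 2 * s + \<kappa> * EE (\<lambda>x. (W x)\<^sup>2 * T x) + (A + 2) / (4 * \<kappa>) * Q"
      unfolding Q_eq s_def by (simp only: integral_mult_right_zero)
    also have "\<dots> \<le> A * \<kappa> / 2 * 2 + \<kappa> * 110 + (A + 2) / (4 * \<kappa>) * (4 * \<kappa>\<^sup>2)"
      using s A \<kappa> unfolding s_def
      by (intro add_mono mult_left_mono EW2T Q\<kappa>) auto
    also have "\<dots> = (2 * A + 112) * \<kappa>" using \<kappa> by (simp add: field_simps power2_eq_square)
    finally show ?thesis .
  qed
  have "EE (\<lambda>x. H (W x)) - m = EE (\<lambda>x. H (W x)) - EE (\<lambda>x. m)" by (simp add: P.prob_space)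
  also have "\<dots> = EE (\<lambda>x. H (W x) - m)" by (intro EE_diff[symmetric] bF bdm_const)
  also have "\<dots> = EE (\<lambda>x. F' (W x) - W x * F (W x))" by (simp add: F')
  also have "\<dots> = EE (\<lambda>x. F' (W x)) - EE (\<lambda>x. W x * F (W x))" by (intro EE_diff bF bdm_mult bdm_W)
  also have "\<dots> = EE (\<lambda>x. F' (W x)) - EE (\<lambda>x. (\<Sum>i\<in>I. D i x * (F (W x) - F (W x - D i x))) / 2)"
    by (simp only: EE_W_exchange[OF contF])
  also have "\<dots> = EE (\<lambda>x. F' (W x) - (\<Sum>i\<in>I. D i x * (F (W x) - F (W x - D i x))) / 2)"
    by (intro EE_diff[symmetric] bdm_intros bF bdm_D)
  finally have eq: "EE (\<lambda>x. H (W x)) - m = EE (\<lambda>x. F' (W x) - (\<Sum>i\<in>I. D i x * (F (W x) - F (W x - D i x))) / 2)" .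
  have pt: "\<bar>F' (W x) - (\<Sum>i\<in>I. D i x * (F (W x) - F (W x - D i x))) / 2\<bar> \<le> 2 * \<bar>1 - T x\<bar> + r x" for x
  proof -
    have "(\<Sum>i\<in>I. D i x * (F (W x) - F (W x - D i x)))
       = (\<Sum>i\<in>I. (D i x)\<^sup>2 * F' (W x)) + (\<Sum>i\<in>I. D i x * (F (W x) - F (W x - D i x) - D i x * F' (W x)))"
      unfolding sum.distrib[symmetric] by (intro sum.cong refl) (simp add: algebra_simps power2_eq_square)
    also have "(\<Sum>i\<in>I. (D i x)\<^sup>2 * F' (W x)) = 2 * T x * F' (W x)"
      by (simp only: sum_distrib_right[symmetric] sum_D2)
    finally have "F' (W x) - (\<Sum>i\<in>I. D i x * (F (W x) - F (W x - D i x))) / 2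
       = F' (W x) * (1 - T x) - (\<Sum>i\<in>I. D i x * (F (W x) - F (W x - D i x) - D i x * F' (W x))) / 2"
      by (simp add: algebra_simps add_divide_distrib)
    moreover have "\<bar>F' (W x) * (1 - T x)\<bar> \<le> 2 * \<bar>1 - T x\<bar>"
      unfolding abs_mult by (intro mult_right_mono F'_le) auto
    moreover have "\<bar>\<Sum>i\<in>I. D i x * (F (W x) - F (W x - D i x) - D i x * F' (W x))\<bar> \<le> 2 * r x"
    proof -
      have "\<bar>\<Sum>i\<in>I. D i x * (F (W x) - F (W x - D i x) - D i x * F' (W x))\<bar>
        \<le> (\<Sum>i\<in>I. \<bar>D i x * (F (W x) - F (W x - D i x) - D i x * F' (W x))\<bar>)" by (rule sum_abs)
      also have "\<dots> \<le> (\<Sum>i\<in>I. \<bar>D i x\<bar> * ((A + 2 * \<bar>W x\<bar>) * (D i x)\<^sup>2))"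
        unfolding abs_mult by (intro sum_mono mult_left_mono rem) auto
      also have "\<dots> = 2 * r x"
      proof -
        have "\<bar>d\<bar> * (c * d\<^sup>2) = c * \<bar>d\<bar>^3" for d c :: real
          unfolding power2_abs[of d, symmetric] by (simp add: power3_eq_cube power2_eq_square)
        then show ?thesis unfolding r_def by (simp only:)
      qed
      finally show ?thesis .
    qed
    ultimately show ?thesis by linarith
  qed
  have "\<bar>EE (\<lambda>x. H (W x)) - m\<bar> \<le> EE (\<lambda>x. \<bar>F' (W x) - (\<Sum>i\<in>I. D i x * (F (W x) - F (W x - D i x))) / 2\<bar>)"
    unfolding eq by (rule EE_abs_le)
  also have "\<dots> \<le> EE (\<lambda>x. 2 * \<bar>1 - T x\<bar> + r x)"
    by (intro EE_mono pt bdm_intros bF bdm_D bdm_T br)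
  also have "\<dots> = 2 * EE (\<lambda>x. \<bar>1 - T x\<bar>) + EE r"
    by (subst EE_add) (auto intro!: bdm_mult bdm_const bdT br)
  also have "\<dots> \<le> 2 * (\<bar>1 - s\<bar> + sqrt V) + (2 * A + 112) * \<kappa>"
    by (intro add_mono mult_left_mono E1T r_le) simp
  also have "(2 * A + 112) * \<kappa> \<le> 126 / \<epsilon> * \<kappa>" 
  proof (rule mult_right_mono)
    have "124 \<le> 124 / \<epsilon>" using \<epsilon> by (simp add: field_simps)
    then show "2 * A + 112 \<le> 126 / \<epsilon>" unfolding A_def by (simp add: field_simps)
  qed (use \<kappa> in auto)
  finally show ?thesis unfolding m_def s_def V_def by (simp add: mult.commute)
qed

end

section \<open>Orthonormal families of square-integrable functions\<close>

lemma L2_funD: "g \<in> L2_fun \<Longrightarrow> g \<in> borel_measurable borel" "g \<in> L2_fun \<Longrightarrow> integrable lborel (\<lambda>x. (g x)\<^sup>2)"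
  by (auto simp: L2_fun_def)

lemma L2_mult_integrable:
  assumes g: "g \<in> L2_fun" and h: "h \<in> L2_fun" shows "integrable lborel (\<lambda>x. g x * h x)"
proof (rule Bochner_Integration.integrable_bound)
  show "integrable lborel (\<lambda>x. (g x)\<^sup>2 + (h x)\<^sup>2)" using L2_funD g h by simp
  have "\<bar>a * b\<bar> \<le> a\<^sup>2 + b\<^sup>2" for a b :: real
    using sum_squares_bound[of "\<bar>a\<bar>" "\<bar>b\<bar>"] abs_ge_zero[of "a * b"] unfolding abs_mult power2_abs by linarith
  then show "AE x in lborel. norm (g x * h x) \<le> norm ((g x)\<^sup>2 + (h x)\<^sup>2)" by simp
qed (use L2_funD(1)[OF g] L2_funD(1)[OF h] in auto)

lemma L2_add: "g \<in> L2_fun \<Longrightarrow> h \<in> L2_fun \<Longrightarrow> (\<lambda>x. g x + h x) \<in> L2_fun"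
  using L2_mult_integrable[of g h] by (auto simp: L2_fun_def power2_sum mult.assoc)

lemma L2_cmult: "g \<in> L2_fun \<Longrightarrow> (\<lambda>x. c * g x) \<in> L2_fun"
  by (auto simp: L2_fun_def power_mult_distrib)

lemma L2_diff: "g \<in> L2_fun \<Longrightarrow> h \<in> L2_fun \<Longrightarrow> (\<lambda>x. g x - h x) \<in> L2_fun"
  using L2_add[of g "\<lambda>x. -1 * h x"] L2_cmult[of h "-1"] by simp

lemma L2_zero: "(\<lambda>x. 0) \<in> L2_fun" by (simp add: L2_fun_def)

lemma L2_sum: "(\<And>i. i \<in> F \<Longrightarrow> g i \<in> L2_fun) \<Longrightarrow> (\<lambda>x. \<Sum>i\<in>F. g i x) \<in> L2_fun"
  by (induction F rule: infinite_finite_induct) (auto intro: L2_add L2_zero)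

lemma l2norm_power2: "(l2norm g)\<^sup>2 = (LINT x|lborel. (g x)\<^sup>2)"
  by (simp add: l2norm_def)

lemma l2norm_less_iff: "0 < \<epsilon> \<Longrightarrow> l2norm g < \<epsilon> \<longleftrightarrow> (LINT x|lborel. (g x)\<^sup>2) < \<epsilon>\<^sup>2"
  using real_sqrt_less_iff[of _ "\<epsilon>\<^sup>2"] by (simp add: l2norm_def)

lemma l2inner_commute: "l2inner g h = l2inner h g"
  by (simp add: l2inner_def mult.commute)

lemma l2inner_diff_sum_right:
  assumes "finite F" "k \<in> L2_fun" "g \<in> L2_fun" "\<And>i. i \<in> F \<Longrightarrow> e i \<in> L2_fun"
  shows "l2inner k (\<lambda>x. g x - (\<Sum>i\<in>F. c i * e i x)) = l2inner k g - (\<Sum>i\<in>F. c i * l2inner k (e i))"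
proof -
  have "l2inner k (\<lambda>x. g x - (\<Sum>i\<in>F. c i * e i x)) = (LINT x|lborel. k x * g x - (\<Sum>i\<in>F. c i * (k x * e i x)))"
    unfolding l2inner_def
    by (intro Bochner_Integration.integral_cong) (auto simp: right_diff_distrib sum_distrib_left mult_ac)
  also have "\<dots> = l2inner k g - (\<Sum>i\<in>F. c i * l2inner k (e i))"
    unfolding l2inner_def using assms
    by (subst Bochner_Integration.integral_diff)
       (auto simp: L2_mult_integrable intro!: Bochner_Integration.integrable_sum)
  finally show ?thesis .
qed

text \<open>
  Countability of the index type provides an exhaustion by finite sets, along which almost
  everywhere convergence is extracted from convergence in \<open>L\<^sub>2\<close>.
\<close>

locale orthonormal_family =
  fixes e :: "'i :: countable \<Rightarrow> real \<Rightarrow> real"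
  assumes e_L2: "\<And>i. e i \<in> L2_fun"
    and e_orth: "\<And>i j. l2inner (e i) (e j) = (if i = j then 1 else 0)"
begin

text \<open>
  Among all combinations over \<open>F\<close> the orthogonal projection is the closest one, and the excess is
  the squared distance of the coefficients. Bessel's inequality and the monotonicity of the error
  in \<open>F\<close> are both contained in this identity.
\<close>

lemma residual_square:
  assumes g: "g \<in> L2_fun" and F: "finite F"
  shows "(LINT x|lborel. (g x - (\<Sum>i\<in>F. c i * e i x))\<^sup>2)
    = (LINT x|lborel. (g x)\<^sup>2) - (\<Sum>i\<in>F. (l2inner (e i) g)\<^sup>2) + (\<Sum>i\<in>F. (c i - l2inner (e i) g)\<^sup>2)"
proof -
  define r where "r x = g x - (\<Sum>i\<in>F. c i * e i x)" for x
  have r: "r \<in> L2_fun" unfolding r_def by (intro L2_diff L2_sum L2_cmult e_L2 g)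
  have re: "l2inner r (e i) = l2inner (e i) g - c i" if "i \<in> F" for i
  proof -
    have "(\<Sum>j\<in>F. c j * (if i = j then 1 else 0)) = (\<Sum>j\<in>F. if j = i then c j else 0)"
      by (intro sum.cong) auto
    also have "\<dots> = c i" using F that by simp
    finally show ?thesis
      unfolding r_def[abs_def] l2inner_commute[of _ "e i"]
      using F by (subst l2inner_diff_sum_right) (auto simp: e_L2 g e_orth)
  qed
  have "(LINT x|lborel. (r x)\<^sup>2) = l2inner r r" by (simp add: l2inner_def power2_eq_square)
  also have "\<dots> = l2inner r g - (\<Sum>i\<in>F. c i * l2inner r (e i))"
    using l2inner_diff_sum_right[where e = e and c = c, OF F r g e_L2] by (simp add: r_def[symmetric])
  also have "l2inner r g = l2inner g g - (\<Sum>i\<in>F. c i * l2inner g (e i))"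
    unfolding l2inner_commute[of r g] using l2inner_diff_sum_right[where e = e and c = c, OF F g g e_L2] by (simp add: r_def[symmetric])
  finally have *: "(LINT x|lborel. (r x)\<^sup>2) = l2inner g g - (\<Sum>i\<in>F. c i * l2inner g (e i)) - (\<Sum>i\<in>F. c i * l2inner r (e i))" .
  have "(LINT x|lborel. (r x)\<^sup>2) = l2inner g g - (\<Sum>i\<in>F. c i * l2inner (e i) g) - (\<Sum>i\<in>F. c i * (l2inner (e i) g - c i))"
  proof -
    have "(\<Sum>i\<in>F. c i * l2inner r (e i)) = (\<Sum>i\<in>F. c i * (l2inner (e i) g - c i))"
      by (intro sum.cong refl) (simp add: re)
    moreover have "(\<Sum>i\<in>F. c i * l2inner g (e i)) = (\<Sum>i\<in>F. c i * l2inner (e i) g)"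
      by (intro sum.cong refl) (simp add: l2inner_commute[of g "e _"])
    ultimately show ?thesis using * by linarith
  qed
  moreover have "(\<Sum>i\<in>F. c i * l2inner (e i) g) + (\<Sum>i\<in>F. c i * (l2inner (e i) g - c i))
      = (\<Sum>i\<in>F. (l2inner (e i) g)\<^sup>2 - (c i - l2inner (e i) g)\<^sup>2)"
    unfolding sum.distrib[symmetric] by (intro sum.cong refl) (simp add: power2_eq_square algebra_simps)
  ultimately have "(LINT x|lborel. (r x)\<^sup>2) = l2inner g g - (\<Sum>i\<in>F. (l2inner (e i) g)\<^sup>2 - (c i - l2inner (e i) g)\<^sup>2)"
    by linarith
  then show ?thesis
    by (simp add: r_def l2inner_def power2_eq_square sum_subtractf)
qed

lemma bessel: "g \<in> L2_fun \<Longrightarrow> finite F \<Longrightarrow> (\<Sum>i\<in>F. (l2inner (e i) g)\<^sup>2) \<le> (LINT x|lborel. (g x)\<^sup>2)"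
  using residual_square[of g F "\<lambda>i. l2inner (e i) g"]
    Bochner_Integration.integral_nonneg[of lborel "\<lambda>x. (g x - (\<Sum>i\<in>F. l2inner (e i) g * e i x))\<^sup>2"] by simp

lemma coefficients_summable:
  assumes "g \<in> L2_fun" shows "(\<lambda>i. (l2inner (e i) g)\<^sup>2) summable_on A"
  by (rule nonneg_bdd_above_summable_on) (auto simp: bdd_above_def intro!: bessel assms exI)

text \<open>
  The partial sums over an exhaustion converge in \<open>L\<^sub>2\<close>, hence almost everywhere along a
  subsequence. Where the series is summable, its sum must be that limit.
\<close>

lemma expansion_AE:
  assumes g: "g \<in> L2_fun"
    and approx: "\<And>\<epsilon>. 0 < \<epsilon> \<Longrightarrow> \<exists>F c. finite F \<and> l2norm (\<lambda>x. g x - (\<Sum>i\<in>F. c i * e i x)) < \<epsilon>"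
  shows "AE x in lborel. (\<lambda>i. l2inner (e i) g * e i x) summable_on UNIV \<longrightarrow> (\<Sum>\<^sub>\<infinity>i. l2inner (e i) g * e i x) = g x"
proof -
  define a where "a i = l2inner (e i) g" for i
  define P where "P n = {i :: 'i. to_nat i \<le> n}" for n
  have P: "finite (P n)" for n
    unfolding P_def by (rule finite_subset[OF _ finite_vimageI[of "{..n}" to_nat]]) auto
  have P_sub: "\<forall>\<^sub>F n in sequentially. F \<subseteq> P n" if "finite F" for F
  proof -
    have "F \<subseteq> P n" if "n \<ge> Max (to_nat ` F)" for n
    proof
      fix i assume "i \<in> F"
      then have "to_nat i \<le> Max (to_nat ` F)" using \<open>finite F\<close> by (intro Max_ge) auto
      with that show "i \<in> P n" by (simp add: P_def)
    qed
    then show ?thesis by (auto simp: eventually_sequentially)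
  qed
  have P_lim: "filterlim P (finite_subsets_at_top UNIV) sequentially"
    unfolding filterlim_iff eventually_finite_subsets_at_top
  proof safe
    fix Q and X :: "'i set" assume "finite X" "\<forall>Y. finite Y \<and> X \<subseteq> Y \<and> Y \<subseteq> UNIV \<longrightarrow> Q Y"
    then show "\<forall>\<^sub>F n in sequentially. Q (P n)"
      using P_sub[of X] P by (auto elim: eventually_mono)
  qed
  define u where "u n x = (g x - (\<Sum>i\<in>P n. a i * e i x))\<^sup>2" for n x
  have int_u: "integrable lborel (u n)" for n
    unfolding u_def by (rule L2_funD(2)) (intro L2_diff L2_sum L2_cmult e_L2 g)
  have "(\<lambda>n. LINT x|lborel. norm (u n x)) \<longlonglongrightarrow> 0"
  proof (rule LIMSEQ_I)
    fix r :: real assume r: "0 < r"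
    then obtain F c where F: "finite F" and lt: "l2norm (\<lambda>x. g x - (\<Sum>i\<in>F. c i * e i x)) < sqrt r"
      using approx[of "sqrt r"] by auto
    have "(LINT x|lborel. (g x - (\<Sum>i\<in>F. c i * e i x))\<^sup>2) < r"
      using lt r l2norm_less_iff[of "sqrt r"] by simp
    moreover have "(LINT x|lborel. u n x) \<le> (LINT x|lborel. (g x - (\<Sum>i\<in>F. c i * e i x))\<^sup>2)" if "F \<subseteq> P n" for n
      unfolding u_def residual_square[OF g P] residual_square[OF g F] a_def
      using sum_mono2[OF P that, of "\<lambda>i. (l2inner (e i) g)\<^sup>2"] sum_nonneg[of F "\<lambda>i. (c i - l2inner (e i) g)\<^sup>2"] by simp
    moreover have "0 \<le> (LINT x|lborel. u n x)" for n unfolding u_def by simp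
    ultimately have "norm ((LINT x|lborel. norm (u n x)) - 0) < r" if "F \<subseteq> P n" for n
      using that unfolding u_def by force
    then show "\<exists>n0. \<forall>n\<ge>n0. norm ((LINT x|lborel. norm (u n x)) - 0) < r"
      using P_sub[OF F] unfolding eventually_sequentially by blast
  qed
  from tendsto_L1_AE_subseq[OF int_u this] obtain r :: "nat \<Rightarrow> nat" where r: "strict_mono r"
    and ae: "AE x in lborel. (\<lambda>n. u (r n) x) \<longlonglongrightarrow> 0" by blast
  show ?thesis
    using ae
  proof eventually_elim
    case (elim x)
    show ?case
    proof
      assume "(\<lambda>i. l2inner (e i) g * e i x) summable_on UNIV"
      then have "((\<lambda>i. a i * e i x) has_sum (\<Sum>\<^sub>\<infinity>i. a i * e i x)) UNIV"
        unfolding a_def by (rule has_sum_infsum)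
      then have "(\<lambda>n. \<Sum>i\<in>P n. a i * e i x) \<longlonglongrightarrow> (\<Sum>\<^sub>\<infinity>i. a i * e i x)"
        unfolding has_sum_def by (rule filterlim_compose[OF _ P_lim])
      from LIMSEQ_subseq_LIMSEQ[OF this r]
      have "(\<lambda>n. (g x - (\<Sum>i\<in>P (r n). a i * e i x))\<^sup>2) \<longlonglongrightarrow> (g x - (\<Sum>\<^sub>\<infinity>i. a i * e i x))\<^sup>2"
        by (intro tendsto_intros) (simp add: o_def)
      with elim have "(g x - (\<Sum>\<^sub>\<infinity>i. a i * e i x))\<^sup>2 = 0"
        unfolding u_def by (rule LIMSEQ_unique[rotated])
      then show "(\<Sum>\<^sub>\<infinity>i. l2inner (e i) g * e i x) = g x" by (simp add: a_def)
    qed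
  qed
qed

end

lemma product_summable_on:
  fixes a b :: "'i \<Rightarrow> real"
  assumes "(\<lambda>i. (a i)\<^sup>2) summable_on A" "(\<lambda>i. (b i)\<^sup>2) summable_on A"
  shows "(\<lambda>i. a i * b i) summable_on A"
proof -
  have "(\<lambda>i. norm (a i * b i)) summable_on A"
  proof (rule Infinite_Sum.abs_summable_on_comparison_test')
    show "(\<lambda>i. (a i)\<^sup>2 + (b i)\<^sup>2) summable_on A" by (intro summable_on_add assms)
    show "norm (a i * b i) \<le> (a i)\<^sup>2 + (b i)\<^sup>2" for i
      using sum_squares_bound[of "\<bar>a i\<bar>" "\<bar>b i\<bar>"] abs_ge_zero[of "a i * b i"] unfolding real_norm_def abs_mult power2_abs by linarith
  qed
  then show ?thesis by (rule abs_summable_summable)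
qed

lemma AE_lborel_scale:
  assumes "AE x in lborel. P (x :: real)" "c \<noteq> 0" shows "AE x in lborel. P (c * x)"
proof -
  from assms(1) obtain N where N: "{x. \<not> P x} \<subseteq> N" "N \<in> null_sets lborel"
    unfolding eventually_ae_filter by auto
  have "AE x in lborel. x \<notin> N" using N(2) by (rule AE_not_in)
  then have "AE x in lborel. 0 + c * x \<notin> N"
    using N(2) assms(2) by (intro AE_borel_affine) auto
  then show ?thesis by eventually_elim (use N in auto)
qed

text \<open>
  Over a unit interval the sum of the squared translates integrates to the squared norm of \<open>h\<close>,
  so it is finite almost everywhere.
\<close>

lemma AE_shift_square_summable:
  assumes h: "h \<in> L2_fun"
  shows "AE x in lborel. (\<lambda>k::int. (h (x - of_int k))\<^sup>2) summable_on UNIV"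
proof -
  note [measurable] = L2_funD(1)[OF h]
  define d where "d n = real_of_int (int_decode n)" for n
  have "AE x in lborel. (\<Sum>n. ennreal ((h (x - d n))\<^sup>2) * indicator {real_of_int m..<real_of_int m + 1} x) \<noteq> \<infinity>" for m :: int
  proof (rule nn_integral_PInf_AE)
    have "(\<integral>\<^sup>+x. (\<Sum>n. ennreal ((h (x - d n))\<^sup>2) * indicator {real_of_int m..<real_of_int m + 1} x) \<partial>lborel)
      = (\<Sum>n. \<integral>\<^sup>+x. ennreal ((h (x - d n))\<^sup>2) * indicator {real_of_int m..<real_of_int m + 1} x \<partial>lborel)"
      by (rule nn_integral_suminf) measurable
    also have "\<dots> = (\<Sum>n. \<integral>\<^sup>+x. ennreal ((h x)\<^sup>2) * indicator {real_of_int m..<real_of_int m + 1} (d n + x) \<partial>lborel)"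
    proof (rule suminf_cong)
      fix n
      show "(\<integral>\<^sup>+x. ennreal ((h (x - d n))\<^sup>2) * indicator {real_of_int m..<real_of_int m + 1} x \<partial>lborel)
        = (\<integral>\<^sup>+x. ennreal ((h x)\<^sup>2) * indicator {real_of_int m..<real_of_int m + 1} (d n + x) \<partial>lborel)"
        by (subst nn_integral_real_affine[where c=1 and t="d n"]) auto
    qed
    also have "\<dots> = (\<integral>\<^sup>+x. (\<Sum>n. ennreal ((h x)\<^sup>2) * indicator {real_of_int m..<real_of_int m + 1} (d n + x)) \<partial>lborel)"
      by (rule nn_integral_suminf[symmetric]) measurable
    also have "\<dots> = (\<integral>\<^sup>+x. ennreal ((h x)\<^sup>2) \<partial>lborel)"
    proof (rule nn_integral_cong)
      fix x :: real
      \<comment> \<open>The only translate by which \<open>x\<close> is moved into the unit interval starting at \<open>m\<close>.\<close>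
      define n0 where "n0 = int_encode (m - \<lfloor>x\<rfloor>)"
      have iff: "d n + x \<in> {real_of_int m..<real_of_int m + 1} \<longleftrightarrow> n = n0" for n
      proof -
        have "d n + x \<in> {real_of_int m..<real_of_int m + 1} \<longleftrightarrow> \<lfloor>x\<rfloor> = m - int_decode n"
          unfolding d_def floor_eq_iff by auto
        also have "\<dots> \<longleftrightarrow> int_decode n = m - \<lfloor>x\<rfloor>" by arith
        also have "\<dots> \<longleftrightarrow> n = n0" unfolding n0_def by (metis int_decode_inverse int_encode_inverse)
        finally show ?thesis .
      qed
      have "(\<Sum>n. ennreal ((h x)\<^sup>2) * indicator {real_of_int m..<real_of_int m + 1} (d n + x))
         = (\<Sum>n\<in>{n0}. ennreal ((h x)\<^sup>2) * indicator {real_of_int m..<real_of_int m + 1} (d n + x))"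
        by (rule suminf_finite) (use iff in \<open>auto simp: indicator_def\<close>)
      also have "\<dots> = ennreal ((h x)\<^sup>2)" using iff[of n0] by (simp add: indicator_def)
      finally show "(\<Sum>n. ennreal ((h x)\<^sup>2) * indicator {real_of_int m..<real_of_int m + 1} (d n + x)) = ennreal ((h x)\<^sup>2)" .
    qed
    also have "\<dots> < \<infinity>" using L2_funD(2)[OF h] by (simp add: nn_integral_eq_integral)
    finally show "(\<integral>\<^sup>+x. (\<Sum>n. ennreal ((h (x - d n))\<^sup>2) * indicator {real_of_int m..<real_of_int m + 1} x) \<partial>lborel) \<noteq> \<infinity>"
      by simp
  qed measurable
  then have "AE x in lborel. \<forall>m::int. (\<Sum>n. ennreal ((h (x - d n))\<^sup>2) * indicator {real_of_int m..<real_of_int m + 1} x) \<noteq> \<infinity>"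
    unfolding AE_all_countable by blast
  then show ?thesis
  proof eventually_elim
    case (elim x)
    have "(\<Sum>n. ennreal ((h (x - d n))\<^sup>2) * indicator {real_of_int \<lfloor>x\<rfloor>..<real_of_int \<lfloor>x\<rfloor> + 1} x) = (\<Sum>n. ennreal ((h (x - d n))\<^sup>2))"
      by (simp add: indicator_def)
    with elim have "(\<Sum>n. ennreal ((h (x - d n))\<^sup>2)) \<noteq> top" by (metis infinity_ennreal_def)
    then have "summable (\<lambda>n. (h (x - d n))\<^sup>2)" by (intro summable_suminf_not_top) auto
    then have "(\<lambda>n. (h (x - d n))\<^sup>2) summable_on UNIV" by (intro norm_summable_imp_summable_on) simp
    then show ?case
      using summable_on_reindex_bij_betw[OF bij_int_decode, of "\<lambda>k. (h (x - of_int k))\<^sup>2"] by (simp add: d_def)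
  qed
qed

section \<open>Multiresolution analyses\<close>

lemma weighted_am_gm:
  fixes a b t :: real assumes t: "0 < t"
  shows "\<bar>a * b\<bar> \<le> t / 2 * a\<^sup>2 + 1 / (2 * t) * b\<^sup>2"
proof -
  have "0 \<le> (t * \<bar>a\<bar> - \<bar>b\<bar>)\<^sup>2 / (2 * t)" using t by simp
  also have "\<dots> = t / 2 * \<bar>a\<bar>\<^sup>2 + 1 / (2 * t) * \<bar>b\<bar>\<^sup>2 - \<bar>a\<bar> * \<bar>b\<bar>"
    using t unfolding power2_eq_square by (simp add: field_simps)
  finally show ?thesis by (simp add: abs_mult)
qed

lemma lborel_integral_scale:
  fixes F :: "real \<Rightarrow> real" assumes "0 < c"
  shows "(LINT x|lborel. F (c * x - t)) = (LINT x|lborel. F x) / c"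
  using lborel_integral_real_affine[of c F "- t"] assms by simp

lemma mother_L2: "h \<in> L2_fun \<Longrightarrow> mother h j k \<in> L2_fun"
proof -
  assume h: "h \<in> L2_fun"
  note [measurable] = L2_funD(1)[OF h]
  have "integrable lborel (\<lambda>x. (h (- real_of_int k + 2 ^ j * x))\<^sup>2)"
    using lborel_integrable_real_affine[OF L2_funD(2)[OF h], of "2 ^ j" "- of_int k"] by simp
  then have "integrable lborel (\<lambda>x. (2 powr (real j / 2))\<^sup>2 * (h (2 ^ j * x - of_int k))\<^sup>2)"
    by simp
  then show ?thesis unfolding L2_fun_def mother_def[abs_def] by (simp add: power_mult_distrib)
qed

lemma powr_half_square: "2 powr (real j / 2) * 2 powr (real j / 2) = (2::real) ^ j"
  by (simp add: powr_add[symmetric] powr_realpow)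

lemma l2inner_mother: "l2inner (mother a j k) (mother b j l) = l2inner (father a k) (father b l)"
proof -
  have "l2inner (mother a j k) (mother b j l) = (LINT x|lborel. 2 ^ j * (a (2 ^ j * x - of_int k) * b (2 ^ j * x - of_int l)))"
    unfolding l2inner_def mother_def
    by (intro Bochner_Integration.integral_cong refl)
       (simp add: powr_half_square[symmetric] mult_ac)
  also have "\<dots> = 2 ^ j * (LINT x|lborel. (\<lambda>u. a (u - of_int k) * b (u - of_int l)) (2 ^ j * x - 0))"
    by simp
  also have "\<dots> = l2inner (father a k) (father b l)"
    by (subst lborel_integral_scale) (auto simp: l2inner_def father_def)
  finally show ?thesis .
qed

lemma mother_0: "mother a 0 k = father a k"
  by (simp add: mother_def father_def fun_eq_iff)

text \<open>
  The factor \<open>2 powr (j / 2)\<close> makes dilation by \<open>2 ^ j\<close> an isometry of \<open>L\<^sub>2\<close>.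
\<close>

lemma l2norm_dilation:
  assumes "\<And>x. g x = 2 powr (real j / 2) * h (2 ^ j * x - t)"
  shows "l2norm g = l2norm h"
proof -
  have "(LINT x|lborel. (g x)\<^sup>2) = (LINT x|lborel. 2 ^ j * (h (2 ^ j * x - t))\<^sup>2)"
    by (intro Bochner_Integration.integral_cong refl)
       (simp add: assms power_mult_distrib power2_eq_square[of "2 powr _"] powr_half_square)
  also have "\<dots> = (LINT x|lborel. (h x)\<^sup>2)"
    using lborel_integral_scale[of "2 ^ j" "\<lambda>u. (h u)\<^sup>2" t] by simp
  finally show ?thesis by (simp add: l2norm_def)
qed

locale mra =
  fixes V \<phi> assumes mra: "orthonormal_mra V \<phi>"
begin

lemma closed: "closed_L2_subspace (V m)"
  and mono1: "V m \<subseteq> V (m + 1)"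
  and dilate: "g \<in> V m \<longleftrightarrow> (\<lambda>x. g (2 * x)) \<in> V (m + 1)"
  and basis: "L2_orthonormal_basis (father \<phi>) (V 0)"
  using mra unfolding orthonormal_mra_def by blast+

lemma V_L2: "g \<in> V m \<Longrightarrow> g \<in> L2_fun"
  using closed[of m] by (auto simp: closed_L2_subspace_def)

lemma phi_L2: "\<phi> \<in> L2_fun"
proof -
  have "father \<phi> 0 \<in> V 0" using basis by (auto simp: L2_orthonormal_basis_def)
  then show ?thesis using V_L2 by (simp add: father_def[abs_def])
qed

lemma father_orth: "l2inner (father \<phi> k) (father \<phi> l) = (if k = l then 1 else 0)"
  using basis by (auto simp: L2_orthonormal_basis_def)

lemma V_cmult: "g \<in> V m \<Longrightarrow> (\<lambda>x. c * g x) \<in> V m"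
  using closed[of m] by (auto simp: closed_L2_subspace_def)

lemma V_sum: "finite F \<Longrightarrow> (\<And>i. i \<in> F \<Longrightarrow> g i \<in> V m) \<Longrightarrow> (\<lambda>x. \<Sum>i\<in>F. g i x) \<in> V m"
proof (induction F rule: finite_induct)
  case empty then show ?case using closed[of m] by (simp add: closed_L2_subspace_def)
next
  case (insert i F)
  then have "g i \<in> V m" "(\<lambda>x. \<Sum>i\<in>F. g i x) \<in> V m" by auto
  then show ?case using closed[of m] insert.hyps by (simp add: closed_L2_subspace_def)
qed

lemma V_mono: "i \<le> j \<Longrightarrow> V (int i) \<subseteq> V (int j)"
proof (induction j rule: dec_induct)
  case (step n)
  then show ?case using mono1[of "int n"] by (simp add: add.commute)
qed simp

lemma V_dilate_pow: "g \<in> V 0 \<longleftrightarrow> (\<lambda>x. g (2 ^ j * x)) \<in> V (int j)"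
proof (induction j)
  case (Suc j)
  show ?case
    unfolding Suc dilate[of "\<lambda>x. g (2 ^ j * x)" "int j"] by (simp add: mult_ac add.commute)
qed simp

lemma mother_in_V: "mother \<phi> j l \<in> V (int j)"
proof -
  have "father \<phi> l \<in> V 0" using basis by (auto simp: L2_orthonormal_basis_def)
  then have "(\<lambda>x. father \<phi> l (2 ^ j * x)) \<in> V (int j)" using V_dilate_pow by blast
  from V_cmult[OF this, of "2 powr (real j / 2)"] show ?thesis
    by (simp add: mother_def[abs_def] father_def)
qed

text \<open>
  Dilate to level zero, where the translates of the scaling function form a basis.
\<close>

lemma V_approx:
  assumes g: "g \<in> V (int j)" and \<epsilon>: "0 < \<epsilon>"
  shows "\<exists>F c. finite F \<and> l2norm (\<lambda>x. g x - (\<Sum>l\<in>F. c l * mother \<phi> j l x)) < \<epsilon>"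
proof -
  define h where "h x = 2 powr (- real j / 2) * g (x / 2 ^ j)" for x
  have g_eq: "g x = 2 powr (real j / 2) * h (2 ^ j * x)" for x
    unfolding h_def by (simp add: powr_minus field_simps)
  have "(\<lambda>x. g (x / 2 ^ j)) \<in> V 0" unfolding V_dilate_pow[of _ j] using g by simp
  then have "h \<in> V 0" unfolding h_def[abs_def] by (rule V_cmult)
  then obtain F c where F: "finite F" and lt: "l2norm (\<lambda>x. h x - (\<Sum>i\<in>F. c i * father \<phi> i x)) < \<epsilon>"
    using basis \<epsilon> unfolding L2_orthonormal_basis_def by blast
  have eq: "l2norm (\<lambda>x. g x - (\<Sum>l\<in>F. c l * mother \<phi> j l x)) = l2norm (\<lambda>x. h x - (\<Sum>i\<in>F. c i * father \<phi> i x))"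
    by (rule l2norm_dilation[where j = j and t = 0])
       (simp add: g_eq mother_def father_def right_diff_distrib sum_distrib_left mult_ac)
  show ?thesis by (intro exI[of _ F] exI[of _ c] conjI F) (simp only: eq lt)
qed

lemma ONF: "orthonormal_family (mother \<phi> j)"
  by unfold_locales (simp_all add: mother_L2 phi_L2 l2inner_mother father_orth)

text \<open>
  Dilating and translating an approximation of \<open>\<psi>\<close> by scaling functions of level one yields scaling
  functions of level \<open>j + 1\<close>, the translation by \<open>k\<close> becoming one by \<open>2 k\<close>. Closedness of the space
  does the rest.
\<close>

lemma wavelet_in_V:
  assumes \<psi>: "\<psi> \<in> V 1" shows "mother \<psi> j k \<in> V (int (Suc j))"
proof -
  have \<psi>2: "\<psi> \<in> L2_fun" using \<psi> by (rule V_L2)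
  have "\<exists>h\<in>V (int (Suc j)). l2norm (\<lambda>x. mother \<psi> j k x - h x) < \<epsilon>" if \<epsilon>: "0 < \<epsilon>" for \<epsilon>
  proof -
    obtain F c where F: "finite F" and lt: "l2norm (\<lambda>x. \<psi> x - (\<Sum>l\<in>F. c l * mother \<phi> 1 l x)) < \<epsilon>"
      using V_approx[of \<psi> 1 \<epsilon>] \<psi> \<epsilon> by (metis of_nat_1)
    have "2 powr (real j / 2) * mother \<phi> 1 l (2 ^ j * x - of_int k) = mother \<phi> (Suc j) (2 * k + l) x" for l x
      unfolding mother_def by (simp add: powr_add[symmetric] add_divide_distrib algebra_simps flip: mult.assoc)
    then have "l2norm (\<lambda>x. mother \<psi> j k x - (\<Sum>l\<in>F. c l * mother \<phi> (Suc j) (2 * k + l) x))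
       = l2norm (\<lambda>x. \<psi> x - (\<Sum>l\<in>F. c l * mother \<phi> 1 l x))"
      by (intro l2norm_dilation[where j = j and t = "of_int k"])
         (simp add: mother_def[of \<psi>] right_diff_distrib sum_distrib_left mult.left_commute)
    moreover have "(\<lambda>x. \<Sum>l\<in>F. c l * mother \<phi> (Suc j) (2 * k + l) x) \<in> V (int (Suc j))"
      by (intro V_sum F V_cmult mother_in_V)
    ultimately show ?thesis using lt by (intro bexI) auto
  qed
  then show ?thesis
    using closed[of "int (Suc j)"] mother_L2[OF \<psi>2] unfolding closed_L2_subspace_def by blast
qed

text \<open>
  Orthogonality to the scaling functions of level \<open>j\<close> passes to the limit; the Cauchy--Schwarz
  estimate needed is replaced by a weighted arithmetic-geometric mean inequality.
\<close>

lemma wavelet_orth_V: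
  assumes \<psi>: "\<psi> \<in> L2_fun" and orth: "\<And>k l. l2inner (father \<phi> k) (father \<psi> l) = 0" and g: "g \<in> V (int j)"
  shows "l2inner (mother \<psi> j k) g = 0"
proof (rule ccontr)
  assume nz: "l2inner (mother \<psi> j k) g \<noteq> 0"
  let ?m = "mother \<psi> j k"
  have m2: "?m \<in> L2_fun" by (rule mother_L2[OF \<psi>])
  have g2: "g \<in> L2_fun" by (rule V_L2[OF g])
  \<comment> \<open>Adding \<open>1\<close> keeps the bound on the squared norm positive.\<close>
  define B where "B = (LINT x|lborel. (?m x)\<^sup>2) + 1"
  have B: "0 < B" unfolding B_def by (simp add: add_nonneg_pos)
  \<comment> \<open>A distance small enough to contradict a nonzero inner product.\<close>
  define t where "t = \<bar>l2inner ?m g\<bar> / B"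
  have t: "0 < t" using nz B by (simp add: t_def)
  obtain F c where F: "finite F" and lt: "l2norm (\<lambda>x. g x - (\<Sum>l\<in>F. c l * mother \<phi> j l x)) < t"
    using V_approx[OF g t] by auto
  define r where "r x = g x - (\<Sum>l\<in>F. c l * mother \<phi> j l x)" for x
  have r2: "r \<in> L2_fun" unfolding r_def by (intro L2_diff L2_sum L2_cmult g2 mother_L2 phi_L2)
  have "l2inner ?m r = l2inner ?m g - (\<Sum>l\<in>F. c l * l2inner ?m (mother \<phi> j l))"
    unfolding r_def[abs_def] by (rule l2inner_diff_sum_right[OF F m2 g2]) (rule mother_L2[OF phi_L2])
  also have "\<dots> = l2inner ?m g"
    by (simp add: l2inner_mother l2inner_commute[of "father \<psi> _"] orth)
  finally have eq: "l2inner ?m r = l2inner ?m g" .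
  have "\<bar>l2inner ?m r\<bar> \<le> (LINT x|lborel. \<bar>?m x * r x\<bar>)" unfolding l2inner_def by (rule integral_abs_bound)
  also have "\<dots> \<le> (LINT x|lborel. t / 2 * (?m x)\<^sup>2 + 1 / (2 * t) * (r x)\<^sup>2)"
  proof (rule integral_mono)
    show "\<bar>?m x * r x\<bar> \<le> t / 2 * (?m x)\<^sup>2 + 1 / (2 * t) * (r x)\<^sup>2" for x
      by (rule weighted_am_gm[OF t])
  qed (use L2_funD(2)[OF m2] L2_funD(2)[OF r2] L2_mult_integrable[OF m2 r2] in auto)
  also have "\<dots> = t / 2 * (LINT x|lborel. (?m x)\<^sup>2) + 1 / (2 * t) * (LINT x|lborel. (r x)\<^sup>2)"
    using L2_funD(2)[OF m2] L2_funD(2)[OF r2] by simp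
  also have "\<dots> < t / 2 * B + 1 / (2 * t) * t\<^sup>2"
  proof (rule add_less_le_mono)
    show "t / 2 * (LINT x|lborel. (?m x)\<^sup>2) < t / 2 * B" using t by (simp add: B_def)
    have "(LINT x|lborel. (r x)\<^sup>2) < t\<^sup>2" using lt l2norm_less_iff[OF t] by (simp add: r_def)
    then show "1 / (2 * t) * (LINT x|lborel. (r x)\<^sup>2) \<le> 1 / (2 * t) * t\<^sup>2"
      using t by (intro mult_left_mono) auto
  qed
  also have "\<dots> = t * (B + 1) / 2" using t by (simp add: power2_eq_square field_simps)
  also have "\<dots> \<le> t * B"
  proof -
    have "1 \<le> B" unfolding B_def by simp
    then have "t * ((B + 1) / 2) \<le> t * B" using t by (intro mult_left_mono) auto
    then show ?thesis by simp
  qed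
  also have "\<dots> = \<bar>l2inner ?m g\<bar>" using B by (simp add: t_def)
  finally show False using eq by simp
qed

end

section \<open>The wavelet estimator as a kernel estimator\<close>

lemma has_sum_finite_sum:
  fixes f :: "'b \<Rightarrow> 'a \<Rightarrow> real"
  assumes "finite F" "\<And>l. l \<in> F \<Longrightarrow> (f l has_sum S l) A"
  shows "((\<lambda>k. \<Sum>l\<in>F. f l k) has_sum (\<Sum>l\<in>F. S l)) A"
  using assms by (induction F rule: finite_induct) (auto intro: has_sum_add)

definition proj_kernel :: "(real \<Rightarrow> real) \<Rightarrow> nat \<Rightarrow> real \<Rightarrow> real \<Rightarrow> real" where
  "proj_kernel \<phi> J x y = (\<Sum>\<^sub>\<infinity>l. mother \<phi> J l x * mother \<phi> J l y)"

lemma finite_near_ints: fixes u R :: real shows "finite {l :: int. \<bar>u - of_int l\<bar> \<le> R}"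
proof (rule finite_subset)
  show "{l :: int. \<bar>u - of_int l\<bar> \<le> R} \<subseteq> {\<lfloor>u - R\<rfloor>..\<lceil>u + R\<rceil>}"
  proof
    fix l :: int assume "l \<in> {l. \<bar>u - of_int l\<bar> \<le> R}"
    then have "u - R \<le> of_int l" "of_int l \<le> u + R" by auto
    then show "l \<in> {\<lfloor>u - R\<rfloor>..\<lceil>u + R\<rceil>}" by (auto simp: floor_le_iff le_ceiling_iff)
  qed
qed simp

text \<open>
  By compact support only the translates in the finite set \<open>near J x\<close> are nonzero at \<open>x\<close>, so that
  series over them are finite sums at each point.
\<close>

locale compact_support =
  fixes \<phi> :: "real \<Rightarrow> real" and R :: real
  assumes phi_supp: "\<And>x. R < \<bar>x\<bar> \<Longrightarrow> \<phi> x = 0"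
begin

definition near :: "nat \<Rightarrow> real \<Rightarrow> int set" where "near J x = {l. \<bar>2 ^ J * x - of_int l\<bar> \<le> R}"

lemma finite_near: "finite (near J x)"
  unfolding near_def by (rule finite_near_ints)

lemma mother_eq_0: "l \<notin> near J x \<Longrightarrow> mother \<phi> J l x = 0"
  unfolding near_def mother_def by (auto intro!: phi_supp)

lemma has_sum_near: "((\<lambda>l. c l * mother \<phi> J l x) has_sum (\<Sum>l\<in>near J x. c l * mother \<phi> J l x)) UNIV"
  by (rule has_sum_finite_neutralI[OF finite_near]) (auto simp: mother_eq_0)

lemma proj_kernel_near: "proj_kernel \<phi> J x y = (\<Sum>l\<in>near J x. mother \<phi> J l y * mother \<phi> J l x)"
  unfolding proj_kernel_def using infsumI[OF has_sum_near[of "\<lambda>l. mother \<phi> J l y" J x]] by (simp add: mult.commute)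

end

text \<open>
  The wavelet itself may have unbounded support; only the scaling function is compactly supported.
\<close>

locale compact_wavelet = mra V \<phi> + compact_support \<phi> R for V \<phi> R +
  fixes \<psi> :: "real \<Rightarrow> real"
  assumes psi_V: "\<psi> \<in> V 1"
    and system: "L2_orthonormal_basis (wavelet_system \<phi> \<psi>) L2_fun"
begin

abbreviation "sys \<equiv> wavelet_system \<phi> \<psi>"

lemma psi_L2: "\<psi> \<in> L2_fun" by (rule V_L2[OF psi_V])

lemma sys_ONF: "orthonormal_family sys"
  using system by unfold_locales (auto simp: L2_orthonormal_basis_def)

lemma psi_orth: "l2inner (father \<phi> k) (father \<psi> l) = 0"
proof -
  have "l2inner (sys (Inl k)) (sys (Inr (0, l))) = 0"
    using system by (simp add: L2_orthonormal_basis_def)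
  then show ?thesis by (simp add: wavelet_system_def mother_0)
qed

lemma sys_in_V:
  "sys (Inl k) \<in> V (int J)" "j < J \<Longrightarrow> sys (Inr (j, k)) \<in> V (int J)"
proof -
  show "sys (Inl k) \<in> V (int J)"
    using mother_in_V[of 0 k] V_mono[of 0 J] by (auto simp: wavelet_system_def mother_0)
  assume "j < J"
  then show "sys (Inr (j, k)) \<in> V (int J)"
    using wavelet_in_V[OF psi_V, of j k] V_mono[of "Suc j" J] by (auto simp: wavelet_system_def)
qed

lemma coefficient_eq_0: "J \<le> j \<Longrightarrow> l2inner (sys (Inr (j, k))) (mother \<phi> J l) = 0"
  using wavelet_orth_V[OF psi_L2 psi_orth, of "mother \<phi> J l" j k] mother_in_V[of J l] V_mono[of J j]
  by (auto simp: wavelet_system_def)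

text \<open>
  Since the series is a finite sum at every point, convergence in \<open>L\<^sub>2\<close> forces equality almost
  everywhere.
\<close>

lemma expand_in_scaling:
  assumes g: "g \<in> V (int J)"
  shows "AE x in lborel. g x = (\<Sum>l\<in>near J x. l2inner (mother \<phi> J l) g * mother \<phi> J l x)"
proof -
  interpret orthonormal_family "mother \<phi> J" by (rule ONF)
  have "AE x in lborel. (\<lambda>l. l2inner (mother \<phi> J l) g * mother \<phi> J l x) summable_on UNIV \<longrightarrow>
      (\<Sum>\<^sub>\<infinity>l. l2inner (mother \<phi> J l) g * mother \<phi> J l x) = g x"
    by (rule expansion_AE[OF V_L2[OF g] V_approx[OF g]])
  then show ?thesis
  proof eventually_elim
    case (elim x)
    have hs: "((\<lambda>l. l2inner (mother \<phi> J l) g * mother \<phi> J l x) has_sum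
        (\<Sum>l\<in>near J x. l2inner (mother \<phi> J l) g * mother \<phi> J l x)) UNIV" by (rule has_sum_near)
    then have "(\<lambda>l. l2inner (mother \<phi> J l) g * mother \<phi> J l x) summable_on UNIV" by (rule has_sum_imp_summable)
    with elim infsumI[OF hs] show ?case by simp
  qed
qed

lemma has_sum_sys:
  fixes c :: "int + nat \<times> int \<Rightarrow> real"
  assumes A: "(\<lambda>k. c (Inl k)) summable_on UNIV"
    and B: "\<And>j. (\<lambda>k. c (Inr (j, k))) summable_on UNIV"
    and zero: "\<And>j k. J \<le> j \<Longrightarrow> c (Inr (j, k)) = 0"
  shows "(c has_sum ((\<Sum>\<^sub>\<infinity>k. c (Inl k)) + (\<Sum>j<J. \<Sum>\<^sub>\<infinity>k. c (Inr (j, k))))) UNIV"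
proof -
  have base: "(c has_sum (\<Sum>\<^sub>\<infinity>k. c (Inl k))) (range Inl)"
    using has_sum_reindex[of Inl UNIV c] has_sum_infsum[OF A] by (simp add: o_def)
  have row: "(c has_sum (\<Sum>\<^sub>\<infinity>k. c (Inr (j, k)))) (range (\<lambda>k. Inr (j, k)))" for j
    using has_sum_reindex[of "\<lambda>k. Inr (j, k)" UNIV c] has_sum_infsum[OF B[of j]] by (simp add: o_def inj_on_def)
  have "(c has_sum ((\<Sum>\<^sub>\<infinity>k. c (Inl k)) + (\<Sum>j<m. \<Sum>\<^sub>\<infinity>k. c (Inr (j, k)))))
      (range Inl \<union> (\<Union>j<m. range (\<lambda>k. Inr (j, k))))" for m
  proof (induction m)
    case 0 show ?case using base by simp
  next
    case (Suc m)
    have "(c has_sum ((\<Sum>\<^sub>\<infinity>k. c (Inl k)) + (\<Sum>j<m. \<Sum>\<^sub>\<infinity>k. c (Inr (j, k)))) + (\<Sum>\<^sub>\<infinity>k. c (Inr (m, k))))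
      ((range Inl \<union> (\<Union>j<m. range (\<lambda>k. Inr (j, k)))) \<union> range (\<lambda>k. Inr (m, k)))"
      by (rule has_sum_Un_disjoint[OF Suc row]) auto
    moreover have "(range Inl \<union> (\<Union>j<m. range (\<lambda>k. Inr (j, k)))) \<union> range (\<lambda>k. Inr (m, k))
      = range Inl \<union> (\<Union>j<Suc m. range (\<lambda>k. Inr (j, k) :: int + nat \<times> int))"
      by (auto simp: lessThan_Suc)
    ultimately show ?case by (simp add: add.assoc)
  qed
  from this[of J] show ?thesis
  proof (rule has_sum_cong_neutral[THEN iffD1, rotated -1])
    fix i :: "int + nat \<times> int" assume iU: "i \<in> UNIV - (range Inl \<union> (\<Union>j<J. range (\<lambda>k. Inr (j, k))))"
    show "c i = 0"
    proof (cases i)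
      case (Inr p)
      then obtain j k where i: "i = Inr (j, k)" by (cases p) auto
      then have "\<not> j < J" using iU by blast
      then show ?thesis using zero i by simp
    next
      case (Inl k)
      with iU show ?thesis by blast
    qed
  qed auto
qed

lemma square_summable_AE:
  "AE x in lborel. \<forall>j. (\<lambda>k. (mother \<psi> j k x)\<^sup>2) summable_on UNIV"
proof -
  have "AE x in lborel. (\<lambda>k. (mother \<psi> j k x)\<^sup>2) summable_on UNIV" for j
  proof -
    have "AE x in lborel. (\<lambda>k::int. (\<psi> (2 ^ j * x - of_int k))\<^sup>2) summable_on UNIV"
      by (rule AE_lborel_scale[OF AE_shift_square_summable[OF psi_L2]]) simp
    then show ?thesis
      by eventually_elim (simp add: mother_def power_mult_distrib summable_on_cmult_right)
  qed
  then show ?thesis by (simp add: AE_all_countable)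
qed

lemma father_summable: "(\<lambda>k. c k * father \<phi> k x) summable_on UNIV"
  using has_sum_near[of c 0 x, THEN has_sum_imp_summable] by (simp add: mother_0)

text \<open>
  The scaling functions of level \<open>J\<close> are expanded in the basis of the whole space. Wavelets of
  level \<open>J\<close> or higher are orthogonal to them, and for the lower levels square summability of
  coefficients and of the wavelets at a point gives absolute convergence.
\<close>

lemma expand_in_system:
  "AE y in lborel. \<forall>l. mother \<phi> J l y =
     (\<Sum>\<^sub>\<infinity>k. l2inner (sys (Inl k)) (mother \<phi> J l) * sys (Inl k) y) +
     (\<Sum>j<J. \<Sum>\<^sub>\<infinity>k. l2inner (sys (Inr (j, k))) (mother \<phi> J l) * sys (Inr (j, k)) y)"
proof -
  interpret orthonormal_family sys by (rule sys_ONF)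
  have "AE y in lborel. mother \<phi> J l y =
     (\<Sum>\<^sub>\<infinity>k. l2inner (sys (Inl k)) (mother \<phi> J l) * sys (Inl k) y) +
     (\<Sum>j<J. \<Sum>\<^sub>\<infinity>k. l2inner (sys (Inr (j, k))) (mother \<phi> J l) * sys (Inr (j, k)) y)" for l
  proof -
    let ?g = "mother \<phi> J l"
    have g: "?g \<in> L2_fun" by (rule mother_L2[OF phi_L2])
    have "AE y in lborel. (\<lambda>i. l2inner (sys i) ?g * sys i y) summable_on UNIV \<longrightarrow>
        (\<Sum>\<^sub>\<infinity>i. l2inner (sys i) ?g * sys i y) = ?g y"
      by (rule expansion_AE[OF g]) (use system g in \<open>simp add: L2_orthonormal_basis_def\<close>)
    with square_summable_AE show ?thesis
    proof eventually_elim
      case (elim y)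
      have hs: "((\<lambda>i. l2inner (sys i) ?g * sys i y) has_sum
         (\<Sum>\<^sub>\<infinity>k. l2inner (sys (Inl k)) ?g * sys (Inl k) y) +
         (\<Sum>j<J. \<Sum>\<^sub>\<infinity>k. l2inner (sys (Inr (j, k))) ?g * sys (Inr (j, k)) y)) UNIV"
      proof (rule has_sum_sys)
        show "(\<lambda>k. l2inner (sys (Inl k)) ?g * sys (Inl k) y) summable_on UNIV"
          using father_summable by (simp add: wavelet_system_def)
        show "(\<lambda>k. l2inner (sys (Inr (j, k))) ?g * sys (Inr (j, k)) y) summable_on UNIV" for j
        proof (rule product_summable_on)
          have "(\<lambda>i. (l2inner (sys i) ?g)\<^sup>2) summable_on range (\<lambda>k. Inr (j, k))"
            by (rule coefficients_summable[OF g])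
          then show "(\<lambda>k. (l2inner (sys (Inr (j, k))) ?g)\<^sup>2) summable_on UNIV"
            using summable_on_reindex[of "\<lambda>k. Inr (j, k)" UNIV "\<lambda>i. (l2inner (sys i) ?g)\<^sup>2"]
            by (simp add: o_def inj_on_def)
          show "(\<lambda>k. (sys (Inr (j, k)) y)\<^sup>2) summable_on UNIV"
            using elim by (simp add: wavelet_system_def)
        qed
      qed (simp add: coefficient_eq_0)
      with elim infsumI[OF hs] has_sum_imp_summable[OF hs] show ?case by simp
    qed
  qed
  then show ?thesis by (simp add: AE_all_countable)
qed

text \<open>
  Expand each scaling function of level \<open>J\<close> at \<open>y\<close> in the wavelet system and exchange the sums. The
  sum over translates is finite at \<open>x\<close>, so the exchange is harmless, and the expansion of the
  wavelets at \<open>x\<close> in scaling functions collapses the inner sum. All exceptional points lie in one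
  null set, because there are countably many functions.
\<close>

lemma wavelet_kernel_identity:
  obtains N where "N \<in> null_sets lborel"
    "\<And>x y. x \<notin> N \<Longrightarrow> y \<notin> N \<Longrightarrow>
      (\<lambda>k. father \<phi> k y * father \<phi> k x) summable_on UNIV \<and>
      (\<forall>j. (\<lambda>k. mother \<psi> j k y * mother \<psi> j k x) summable_on UNIV) \<and>
      (\<Sum>\<^sub>\<infinity>k. father \<phi> k y * father \<phi> k x) + (\<Sum>j<J. \<Sum>\<^sub>\<infinity>k. mother \<psi> j k y * mother \<psi> j k x)
        = proj_kernel \<phi> J x y"
proof -
  let ?c = "\<lambda>i l. l2inner (sys i) (mother \<phi> J l)"
  define good where "good x \<longleftrightarrow> (\<forall>j. (\<lambda>k. (mother \<psi> j k x)\<^sup>2) summable_on UNIV) \<and>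
    (\<forall>l. mother \<phi> J l x = (\<Sum>\<^sub>\<infinity>k. ?c (Inl k) l * sys (Inl k) x) + (\<Sum>j<J. \<Sum>\<^sub>\<infinity>k. ?c (Inr (j, k)) l * sys (Inr (j, k)) x)) \<and>
    (\<forall>i. (\<forall>j k. i = Inr (j, k) \<longrightarrow> j < J) \<longrightarrow> sys i x = (\<Sum>l\<in>near J x. ?c i l * mother \<phi> J l x))" for x
  have "AE x in lborel. (\<forall>j k. i = Inr (j, k) \<longrightarrow> j < J) \<longrightarrow> sys i x = (\<Sum>l\<in>near J x. ?c i l * mother \<phi> J l x)" for i
  proof (cases "\<forall>j k. i = Inr (j, k) \<longrightarrow> j < J")
    case True
    then have "sys i \<in> V (int J)" using sys_in_V by (cases i) auto
    from expand_in_scaling[OF this] show ?thesis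
      by eventually_elim (simp add: l2inner_commute[of "sys i"])
  qed auto
  then have "AE x in lborel. \<forall>i. (\<forall>j k. i = Inr (j, k) \<longrightarrow> j < J) \<longrightarrow> sys i x = (\<Sum>l\<in>near J x. ?c i l * mother \<phi> J l x)"
    unfolding AE_all_countable by blast
  with square_summable_AE expand_in_system[of J] have "AE x in lborel. good x"
    by eventually_elim (simp only: good_def simp_thms)
  then obtain N where N: "{x. \<not> good x} \<subseteq> N" "N \<in> null_sets lborel"
    unfolding eventually_ae_filter by auto
  show thesis
  proof (rule that[OF N(2)])
    fix x y assume "x \<notin> N" "y \<notin> N"
    then have x: "good x" and y: "good y" using N by auto
    have gx: "\<forall>i. (\<forall>j k. i = Inr (j, k) \<longrightarrow> j < J) \<longrightarrow> sys i x = (\<Sum>l\<in>near J x. ?c i l * mother \<phi> J l x)"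
      using x unfolding good_def by (elim conjE)
    have sysx: "sys (Inl k) x = (\<Sum>l\<in>near J x. ?c (Inl k) l * mother \<phi> J l x)"
      "j < J \<Longrightarrow> sys (Inr (j, k)) x = (\<Sum>l\<in>near J x. ?c (Inr (j, k)) l * mother \<phi> J l x)" for j k
      by (rule gx[rule_format], simp)+
    have sm_father: "(\<lambda>k. c k * father \<phi> k x) summable_on UNIV" for c x by (rule father_summable)
    have sm_mother: "(\<lambda>k. mother \<psi> j k y * mother \<psi> j k x) summable_on UNIV" for j
      using x y unfolding good_def by (intro product_summable_on) auto
    have sm_c: "(\<lambda>k. ?c (Inr (j, k)) l * sys (Inr (j, k)) y) summable_on UNIV" for j l
    proof (rule product_summable_on)
      have "(\<lambda>i. (?c i l)\<^sup>2) summable_on range (\<lambda>k. Inr (j, k))"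
        by (rule orthonormal_family.coefficients_summable[OF sys_ONF mother_L2[OF phi_L2]])
      then show "(\<lambda>k. (?c (Inr (j, k)) l)\<^sup>2) summable_on UNIV"
        using summable_on_reindex[of "\<lambda>k. Inr (j, k)" UNIV "\<lambda>i. (?c i l)\<^sup>2"]
        by (simp add: o_def inj_on_def)
      show "(\<lambda>k. (sys (Inr (j, k)) y)\<^sup>2) summable_on UNIV"
        using y unfolding good_def by (simp add: wavelet_system_def)
    qed
    have swap: "(\<Sum>l\<in>near J x. mother \<phi> J l x * (\<Sum>\<^sub>\<infinity>k. a k l * s k)) = (\<Sum>\<^sub>\<infinity>k. s k * (\<Sum>l\<in>near J x. a k l * mother \<phi> J l x))"
      if "\<And>l. (\<lambda>k. a k l * s k) summable_on UNIV" for a :: "int \<Rightarrow> int \<Rightarrow> real" and s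
    proof -
      have "((\<lambda>k. \<Sum>l\<in>near J x. mother \<phi> J l x * (a k l * s k)) has_sum (\<Sum>l\<in>near J x. mother \<phi> J l x * (\<Sum>\<^sub>\<infinity>k. a k l * s k))) UNIV"
        by (intro has_sum_finite_sum finite_near has_sum_cmult_right has_sum_infsum that)
      from infsumI[OF this] show ?thesis by (simp add: sum_distrib_left mult_ac)
    qed
    have "proj_kernel \<phi> J x y = (\<Sum>l\<in>near J x. mother \<phi> J l x * ((\<Sum>\<^sub>\<infinity>k. ?c (Inl k) l * sys (Inl k) y)
        + (\<Sum>j<J. \<Sum>\<^sub>\<infinity>k. ?c (Inr (j, k)) l * sys (Inr (j, k)) y)))"
      unfolding proj_kernel_near
    proof (intro sum.cong refl)
      fix l
      have "mother \<phi> J l y = (\<Sum>\<^sub>\<infinity>k. ?c (Inl k) l * sys (Inl k) y) + (\<Sum>j<J. \<Sum>\<^sub>\<infinity>k. ?c (Inr (j, k)) l * sys (Inr (j, k)) y)"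
        using y unfolding good_def by blast
      then show "mother \<phi> J l y * mother \<phi> J l x = mother \<phi> J l x * ((\<Sum>\<^sub>\<infinity>k. ?c (Inl k) l * sys (Inl k) y)
        + (\<Sum>j<J. \<Sum>\<^sub>\<infinity>k. ?c (Inr (j, k)) l * sys (Inr (j, k)) y))" by (simp only: mult.commute)
    qed
    also have "\<dots> = (\<Sum>l\<in>near J x. mother \<phi> J l x * (\<Sum>\<^sub>\<infinity>k. ?c (Inl k) l * sys (Inl k) y))
        + (\<Sum>j<J. \<Sum>l\<in>near J x. mother \<phi> J l x * (\<Sum>\<^sub>\<infinity>k. ?c (Inr (j, k)) l * sys (Inr (j, k)) y))"
      unfolding distrib_left sum.distrib sum_distrib_left by (subst (2) sum.swap) (rule refl)
    also have "(\<Sum>l\<in>near J x. mother \<phi> J l x * (\<Sum>\<^sub>\<infinity>k. ?c (Inl k) l * sys (Inl k) y))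
        = (\<Sum>\<^sub>\<infinity>k. sys (Inl k) y * sys (Inl k) x)"
    proof -
      have "(\<lambda>k. ?c (Inl k) l * sys (Inl k) y) summable_on UNIV" for l
        using sm_father by (simp add: wavelet_system_def)
      from swap[OF this] show ?thesis by (simp only: sysx(1))
    qed
    also have "(\<Sum>j<J. \<Sum>l\<in>near J x. mother \<phi> J l x * (\<Sum>\<^sub>\<infinity>k. ?c (Inr (j, k)) l * sys (Inr (j, k)) y))
        = (\<Sum>j<J. \<Sum>\<^sub>\<infinity>k. sys (Inr (j, k)) y * sys (Inr (j, k)) x)"
    proof (intro sum.cong refl)
      fix j assume "j \<in> {..<J}"
      then show "(\<Sum>l\<in>near J x. mother \<phi> J l x * (\<Sum>\<^sub>\<infinity>k. ?c (Inr (j, k)) l * sys (Inr (j, k)) y))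
          = (\<Sum>\<^sub>\<infinity>k. sys (Inr (j, k)) y * sys (Inr (j, k)) x)"
        using swap[OF sm_c] by (simp only: sysx(2) lessThan_iff)
    qed
    finally show "(\<lambda>k. father \<phi> k y * father \<phi> k x) summable_on UNIV \<and>
      (\<forall>j. (\<lambda>k. mother \<psi> j k y * mother \<psi> j k x) summable_on UNIV) \<and>
      (\<Sum>\<^sub>\<infinity>k. father \<phi> k y * father \<phi> k x) + (\<Sum>j<J. \<Sum>\<^sub>\<infinity>k. mother \<psi> j k y * mother \<psi> j k x)
        = proj_kernel \<phi> J x y"
      using sm_father sm_mother by (simp add: wavelet_system_def)
  qed
qed

lemma estimator_eq_kernel:
  "\<exists>N\<in>null_sets lborel. \<forall>(X :: nat \<Rightarrow> 'a \<Rightarrow> real) n \<omega> x. x \<notin> N \<longrightarrow> (\<forall>i\<in>{1..n}. X i \<omega> \<notin> N) \<longrightarrow>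
     wavelet_estimator \<phi> \<psi> (int J) X n \<omega> x = (1 / real n) * (\<Sum>i=1..n. proj_kernel \<phi> J x (X i \<omega>))"
proof -
  obtain N where N: "N \<in> null_sets lborel" and id: "\<And>x y. x \<notin> N \<Longrightarrow> y \<notin> N \<Longrightarrow>
      (\<lambda>k. father \<phi> k y * father \<phi> k x) summable_on UNIV \<and>
      (\<forall>j. (\<lambda>k. mother \<psi> j k y * mother \<psi> j k x) summable_on UNIV) \<and>
      (\<Sum>\<^sub>\<infinity>k. father \<phi> k y * father \<phi> k x) + (\<Sum>j<J. \<Sum>\<^sub>\<infinity>k. mother \<psi> j k y * mother \<psi> j k x)
        = proj_kernel \<phi> J x y"
    by (rule wavelet_kernel_identity[of J]) blast
  show ?thesis
  proof (intro bexI[OF _ N] allI impI)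
    fix X :: "nat \<Rightarrow> 'a \<Rightarrow> real" and n \<omega> x
    assume x: "x \<notin> N" and X': "\<forall>i\<in>{1..n}. X i \<omega> \<notin> N"
    have X: "X i \<omega> \<notin> N" if "i \<in> {1..n}" for i using X' that by (rule bspec)
    have lin: "(\<Sum>\<^sub>\<infinity>k. ((1 / real n) * (\<Sum>i=1..n. s k (X i \<omega>))) * s k x) = (1 / real n) * (\<Sum>i=1..n. \<Sum>\<^sub>\<infinity>k. s k (X i \<omega>) * s k x)"
      if "\<And>i. i \<in> {1..n} \<Longrightarrow> (\<lambda>k. s k (X i \<omega>) * s k x) summable_on UNIV" for s :: "int \<Rightarrow> real \<Rightarrow> real"
    proof -
      have "((\<lambda>k. (1 / real n) * (\<Sum>i\<in>{1..n}. s k (X i \<omega>) * s k x)) has_sum (1 / real n) * (\<Sum>i\<in>{1..n}. \<Sum>\<^sub>\<infinity>k. s k (X i \<omega>) * s k x)) UNIV"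
        by (intro has_sum_cmult_right has_sum_finite_sum finite_atLeastAtMost has_sum_infsum that)
      from infsumI[OF this] show ?thesis by (simp only: sum_distrib_right mult.assoc)
    qed
    have "wavelet_estimator \<phi> \<psi> (int J) X n \<omega> x = (1 / real n) * (\<Sum>i=1..n. \<Sum>\<^sub>\<infinity>k. father \<phi> k (X i \<omega>) * father \<phi> k x)
      + (\<Sum>j<J. (1 / real n) * (\<Sum>i=1..n. \<Sum>\<^sub>\<infinity>k. mother \<psi> j k (X i \<omega>) * mother \<psi> j k x))"
      unfolding wavelet_estimator_def alpha_hat_def beta_hat_def nat_int
    proof (intro arg_cong2[where f="(+)"] sum.cong refl)
      show "(\<Sum>\<^sub>\<infinity>k. 1 / real n * (\<Sum>i = 1..n. father \<phi> k (X i \<omega>)) * father \<phi> k x) =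
        1 / real n * (\<Sum>i = 1..n. \<Sum>\<^sub>\<infinity>k. father \<phi> k (X i \<omega>) * father \<phi> k x)"
        by (rule lin) (use id[OF x X] in blast)
      show "(\<Sum>\<^sub>\<infinity>k. 1 / real n * (\<Sum>i = 1..n. mother \<psi> j k (X i \<omega>)) * mother \<psi> j k x) =
        1 / real n * (\<Sum>i = 1..n. \<Sum>\<^sub>\<infinity>k. mother \<psi> j k (X i \<omega>) * mother \<psi> j k x)" for j
        by (rule lin) (use id[OF x X] in blast)
    qed
    also have "\<dots> = (1 / real n) * (\<Sum>i=1..n. (\<Sum>\<^sub>\<infinity>k. father \<phi> k (X i \<omega>) * father \<phi> k x)
      + (\<Sum>j<J. \<Sum>\<^sub>\<infinity>k. mother \<psi> j k (X i \<omega>) * mother \<psi> j k x))"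
      unfolding sum.distrib distrib_left sum_distrib_left[symmetric] by (subst sum.swap) (rule refl)
    also have "\<dots> = (1 / real n) * (\<Sum>i=1..n. proj_kernel \<phi> J x (X i \<omega>))"
      by (intro arg_cong2[where f="(*)"] sum.cong refl) (use id[OF x X] in blast)
    finally show "wavelet_estimator \<phi> \<psi> (int J) X n \<omega> x = (1 / real n) * (\<Sum>i=1..n. proj_kernel \<phi> J x (X i \<omega>))" .
  qed
qed

end

section \<open>The integral modulus of continuity of the density\<close>

text \<open>
  On a monotone tail the integral of the increment telescopes to an integral over an interval of
  length \<open>t\<close>, whatever jumps \<open>f\<close> has there. On \<open>[-L, L]\<close> the Hoelder bound applies, and the points
  within \<open>t\<close> of the two junctions contribute at most \<open>M t\<close> each.
\<close>

lemma L1_modulus_of_continuity: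
  fixes f :: "real \<Rightarrow> real"
  assumes [measurable]: "f \<in> borel_measurable borel" and int: "integrable lborel f"
    and f: "\<And>x. 0 \<le> f x" "\<And>x. f x \<le> M"
    and L: "0 \<le> L" and \<alpha>: "0 < \<alpha>" "\<alpha> \<le> 1"
    and holder: "holder_on {-L..L} \<alpha> f" and incr: "mono_on {..-L} f" and decr: "antimono_on {L..} f"
  obtains C where "0 \<le> C" "\<And>t. \<bar>t\<bar> \<le> 1 \<Longrightarrow> (LINT x|lborel. \<bar>f (x + t) - f x\<bar>) \<le> C * \<bar>t\<bar> powr \<alpha>"
proof -
  have M: "0 \<le> M" using f[of 0] by linarith
  obtain H0 where H0: "\<And>x y. x \<in> {-L..L} \<Longrightarrow> y \<in> {-L..L} \<Longrightarrow> \<bar>f x - f y\<bar> \<le> H0 * \<bar>x - y\<bar> powr \<alpha>"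
    using holder unfolding holder_on_def by blast
  define H where "H = \<bar>H0\<bar>"
  have H: "\<bar>f x - f y\<bar> \<le> H * \<bar>x - y\<bar> powr \<alpha>" if "x \<in> {-L..L}" "y \<in> {-L..L}" for x y
    using H0[OF that] mult_right_mono[OF abs_ge_self[of H0], of "\<bar>x - y\<bar> powr \<alpha>"] by (simp add: H_def)
  have shift: "integrable lborel (\<lambda>x. f (x + t))" for t
    using lborel_integrable_real_affine[OF int, of 1 t] by (simp add: add.commute)
  have indI: "integrable lborel (indicat_real {a..b})" for a b :: real
    by (rule integrable_real_indicator) (auto simp: emeasure_lborel_Icc_eq)
  define C where "C = 4 * M + 2 * L * H"
  have pos: "(LINT x|lborel. \<bar>f (x + t) - f x\<bar>) \<le> C * t powr \<alpha>" if t: "0 < t" "t \<le> 1" for t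
  proof -
    \<comment> \<open>The five regions are the two tails, the two junctions and the interval in between.\<close>
    define g1 where "g1 x = indicator {..-L-t} x * (f (x + t) - f x)" for x
    define g2 where "g2 x = M * indicator {-L-t..-L} x" for x :: real
    define g3 where "g3 x = H * t powr \<alpha> * indicator {-L..L} x" for x :: real
    define g4 where "g4 x = M * indicator {L-t..L} x" for x :: real
    define g5 where "g5 x = indicator {L..} x * (f x - f (x + t))" for x
    have ind: "integrable lborel (\<lambda>x. indicator A x * F x)" if "A \<in> sets borel" "integrable lborel F" for A and F :: "real \<Rightarrow> real"
      using integrable_mult_indicator[of A lborel F] that by simp
    have ig: "integrable lborel g1" "integrable lborel g2" "integrable lborel g3" "integrable lborel g4" "integrable lborel g5"
      unfolding g1_def g2_def g3_def g4_def g5_def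
      using int shift by (auto intro!: ind indI)
    have n1: "0 \<le> g1 x" and n5: "0 \<le> g5 x" for x
      using monotone_onD[OF incr, of x "x + t"] monotone_onD[OF decr, of x "x + t"] t
      unfolding g1_def g5_def by (auto simp: indicator_def)
    have n: "0 \<le> g2 x" "0 \<le> g3 x" "0 \<le> g4 x" for x
      using M unfolding g2_def g3_def g4_def H_def by auto
    have osc: "\<bar>f (x + t) - f x\<bar> \<le> M" for x
      using f[of x] f[of "x + t"] by linarith
    have pt: "\<bar>f (x + t) - f x\<bar> \<le> g1 x + g2 x + g3 x + g4 x + g5 x" for x
    proof -
      consider "x \<le> -L-t" | "-L-t < x" "x \<le> -L" | "-L < x" "x + t \<le> L" | "L - t < x" "x \<le> L" | "L < x"
        by linarith
      then show ?thesis
      proof cases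
        case 1
        then have "f x \<le> f (x + t)" using monotone_onD[OF incr, of x "x + t"] t by auto
        then have "\<bar>f (x + t) - f x\<bar> = g1 x" using 1 by (simp add: g1_def)
        then show ?thesis using n[of x] n5[of x] by linarith
      next
        case 2
        then have "g2 x = M" by (simp add: g2_def)
        then show ?thesis using n[of x] n5[of x] n1[of x] osc[of x] by linarith
      next
        case 3
        then have "g3 x = H * t powr \<alpha>" using t by (simp add: g3_def)
        moreover have "\<bar>f (x + t) - f x\<bar> \<le> H * t powr \<alpha>" using H[of "x + t" x] 3 t by simp
        ultimately show ?thesis using n[of x] n5[of x] n1[of x] by linarith
      next
        case 4
        then have "g4 x = M" by (simp add: g4_def)
        then show ?thesis using n[of x] n5[of x] n1[of x] osc[of x] by linarith
      next
        case 5
        then have "f (x + t) \<le> f x" using monotone_onD[OF decr, of x "x + t"] t by auto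
        then have "\<bar>f (x + t) - f x\<bar> = g5 x" using 5 by (simp add: g5_def)
        then show ?thesis using n[of x] n1[of x] by linarith
      qed
    qed
    have i1: "(LINT x|lborel. g1 x) \<le> M * t"
    proof -
      have "(LINT x|lborel. g1 x) = (LINT x|lborel. indicator {..-L} (x + t) * f (x + t) - indicator {..-L-t} x * f x)"
        unfolding g1_def by (intro Bochner_Integration.integral_cong) (auto simp: indicator_def)
      also have "\<dots> = (LINT x|lborel. indicator {..-L} (x + t) * f (x + t)) - (LINT x|lborel. indicator {..-L-t} x * f x)"
      proof (rule Bochner_Integration.integral_diff)
        have "(\<lambda>x. indicator {..-L} (x + t) * f (x + t)) = (\<lambda>x. indicator {..-L-t} x * f (x + t))"
          by (auto simp: indicator_def)
        then show "integrable lborel (\<lambda>x. indicator {..-L} (x + t) * f (x + t))"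
          using ind[OF _ shift, of "{..-L-t}" t] by simp
      qed (intro ind int, simp)
      also have "(LINT x|lborel. indicator {..-L} (x + t) * f (x + t)) = (LINT x|lborel. indicator {..-L} x * f x)"
        using lborel_integral_real_affine[of 1 "\<lambda>x. indicator {..-L} x * f x" t] by (simp add: add.commute)
      also have "\<dots> - (LINT x|lborel. indicator {..-L-t} x * f x) = (LINT x|lborel. indicator {..-L} x * f x - indicator {..-L-t} x * f x)"
        by (intro Bochner_Integration.integral_diff[symmetric] ind int) auto
      also have "\<dots> \<le> (LINT x|lborel. M * indicator {-L-t..-L} x)"
        using f t M by (intro integral_mono Bochner_Integration.integrable_diff integrable_mult_right ind int indI) (auto simp: indicator_def)
      also have "\<dots> = M * t" using t by simp
      finally show ?thesis .
    qed
    have i5: "(LINT x|lborel. g5 x) \<le> M * t"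
    proof -
      have "(LINT x|lborel. g5 x) = (LINT x|lborel. indicator {L..} x * f x - indicator {L+t..} (x + t) * f (x + t))"
        unfolding g5_def by (intro Bochner_Integration.integral_cong) (auto simp: indicator_def)
      also have "\<dots> = (LINT x|lborel. indicator {L..} x * f x) - (LINT x|lborel. indicator {L+t..} (x + t) * f (x + t))"
      proof (rule Bochner_Integration.integral_diff)
        have "(\<lambda>x. indicator {L+t..} (x + t) * f (x + t)) = (\<lambda>x. indicator {L..} x * f (x + t))"
          by (auto simp: indicator_def)
        then show "integrable lborel (\<lambda>x. indicator {L+t..} (x + t) * f (x + t))"
          using ind[OF _ shift, of "{L..}" t] by simp
      qed (intro ind int, simp)
      also have "(LINT x|lborel. indicator {L+t..} (x + t) * f (x + t)) = (LINT x|lborel. indicator {L+t..} x * f x)"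
        using lborel_integral_real_affine[of 1 "\<lambda>x. indicator {L+t..} x * f x" t] by (simp add: add.commute)
      also have "(LINT x|lborel. indicator {L..} x * f x) - (LINT x|lborel. indicator {L+t..} x * f x) = (LINT x|lborel. indicator {L..} x * f x - indicator {L+t..} x * f x)"
        by (intro Bochner_Integration.integral_diff[symmetric] ind int) auto
      also have "\<dots> \<le> (LINT x|lborel. M * indicator {L..L+t} x)"
        using f t M by (intro integral_mono Bochner_Integration.integrable_diff integrable_mult_right ind int indI) (auto simp: indicator_def)
      also have "\<dots> = M * t" using t by simp
      finally show ?thesis .
    qed
    have i2: "(LINT x|lborel. g2 x) = M * t" "(LINT x|lborel. g4 x) = M * t"
      using t by (simp_all add: g2_def g4_def)
    have i3: "(LINT x|lborel. g3 x) = H * t powr \<alpha> * (2 * L)"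
      using L by (simp add: g3_def)
    have "(LINT x|lborel. \<bar>f (x + t) - f x\<bar>) \<le> (LINT x|lborel. g1 x + g2 x + g3 x + g4 x + g5 x)"
      by (intro integral_mono pt) (use ig int shift in auto)
    also have "\<dots> = (LINT x|lborel. g1 x) + (LINT x|lborel. g2 x) + (LINT x|lborel. g3 x) + (LINT x|lborel. g4 x) + (LINT x|lborel. g5 x)"
      using ig by simp
    also have "\<dots> \<le> 4 * M * t + 2 * L * H * t powr \<alpha>"
      using i1 i2 i3 i5 by simp
    also have "\<dots> \<le> 4 * M * t powr \<alpha> + 2 * L * H * t powr \<alpha>"
    proof -
      have "t powr 1 \<le> t powr \<alpha>" using t \<alpha> by (intro powr_mono') auto
      then have "t \<le> t powr \<alpha>" using t by simp
      then show ?thesis using M by (simp add: mult_left_mono)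
    qed
    finally show ?thesis by (simp add: C_def algebra_simps)
  qed
  show thesis
  proof (rule that[of C])
    show "0 \<le> C" unfolding C_def H_def using M L by simp
    fix t :: real assume t: "\<bar>t\<bar> \<le> 1"
    consider "t = 0" | "0 < t" | "t < 0" by linarith
    then show "(LINT x|lborel. \<bar>f (x + t) - f x\<bar>) \<le> C * \<bar>t\<bar> powr \<alpha>"
    proof cases
      case 2 then show ?thesis using pos[of t] t by simp
    next
      case 3
      have "(LINT x|lborel. \<bar>f (x + t) - f x\<bar>) = (LINT x|lborel. \<bar>f (x + (- t)) - f x\<bar>)"
        using lborel_integral_real_affine[of 1 "\<lambda>x. \<bar>f (x + t) - f x\<bar>" "- t"]
        by (simp add: add.commute abs_minus_commute)
      then show ?thesis using pos[of "- t"] t 3 by simp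
    qed simp
  qed
qed

section \<open>The projection kernel\<close>

text \<open>
  The value of an unordered sum jumps to zero where it diverges; absolute convergence is a
  measurable event, and on it the sum is an ordinary series.
\<close>

lemma borel_measurable_infsum_int [measurable (raw)]:
  fixes f :: "int \<Rightarrow> 'a \<Rightarrow> real"
  assumes [measurable]: "\<And>k. f k \<in> borel_measurable M"
  shows "(\<lambda>x. \<Sum>\<^sub>\<infinity>k. f k x) \<in> borel_measurable M"
proof -
  have eq: "(\<Sum>\<^sub>\<infinity>k. f k x) = (if summable (\<lambda>n. \<bar>f (int_decode n) x\<bar>) then \<Sum>n. f (int_decode n) x else 0)" for x
  proof -
    have re: "(\<Sum>\<^sub>\<infinity>k. f k x) = (\<Sum>\<^sub>\<infinity>n. f (int_decode n) x)"
      by (rule infsum_reindex_bij_betw[OF bij_int_decode, symmetric])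
    show ?thesis
    proof (cases "summable (\<lambda>n. \<bar>f (int_decode n) x\<bar>)")
      case True
      then have s: "summable (\<lambda>n. f (int_decode n) x)" by (rule summable_rabs_cancel)
      have "((\<lambda>n. f (int_decode n) x) has_sum (\<Sum>n. f (int_decode n) x)) UNIV"
        using norm_summable_imp_has_sum[OF _ summable_sums[OF s]] True by (simp only: real_norm_def)
      from infsumI[OF this] show ?thesis unfolding re using True by (simp only: if_True)
    next
      case False
      have "\<not> (\<lambda>n. f (int_decode n) x) summable_on UNIV"
      proof
        assume "(\<lambda>n. f (int_decode n) x) summable_on UNIV"
        then have "(\<lambda>n. norm (f (int_decode n) x)) summable_on UNIV"
          by (rule summable_on_iff_abs_summable_on_real[THEN iffD1])
        from summable_on_imp_summable[OF this] False show False by (simp only: real_norm_def)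
      qed
      from infsum_not_exists[OF this] show ?thesis unfolding re using False by (simp only: if_False)
    qed
  qed
  have "summable (\<lambda>n. \<bar>f (int_decode n) x\<bar>) \<longleftrightarrow> (\<Sum>n. ennreal \<bar>f (int_decode n) x\<bar>) \<noteq> top" for x
  proof
    assume "summable (\<lambda>n. \<bar>f (int_decode n) x\<bar>)"
    then have "(\<Sum>n. ennreal \<bar>f (int_decode n) x\<bar>) = ennreal (\<Sum>n. \<bar>f (int_decode n) x\<bar>)"
      by (intro suminf_ennreal2 abs_ge_zero)
    then show "(\<Sum>n. ennreal \<bar>f (int_decode n) x\<bar>) \<noteq> top" by (simp only: ennreal_neq_top not_False_eq_True)
  qed (intro summable_suminf_not_top abs_ge_zero)
  note eq' = eq[unfolded this]
  have "(\<lambda>x. if (\<Sum>n. ennreal \<bar>f (int_decode n) x\<bar>) \<noteq> top then \<Sum>n. f (int_decode n) x else 0) \<in> borel_measurable M"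
    by measurable
  then show ?thesis unfolding eq' .
qed

locale scaling_kernel = compact_support \<phi> R for \<phi> R +
  fixes B :: real
  assumes phi_meas [measurable]: "\<phi> \<in> borel_measurable borel"
    and phi_le: "\<And>x. \<bar>\<phi> x\<bar> \<le> B"
    and R_pos: "0 < R"
    and phi_L2: "\<phi> \<in> L2_fun"
    and father_orth: "\<And>k l. l2inner (father \<phi> k) (father \<phi> l) = (if k = l then 1 else 0)"
begin

abbreviation P :: "nat \<Rightarrow> real \<Rightarrow> real \<Rightarrow> real" where "P \<equiv> proj_kernel \<phi>"
text \<open>
  At most \<open>2 R + 2\<close> translates are nonzero at a given point.
\<close>

definition Kb :: real where "Kb = (2 * R + 2) * B\<^sup>2"

lemma mother_borel [measurable]: "mother \<phi> J l \<in> borel_measurable borel"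
  unfolding mother_def[abs_def] by measurable

lemma P_measurable [measurable]: "(\<lambda>(x, y). P J x y) \<in> borel_measurable (borel \<Otimes>\<^sub>M borel)"
  unfolding proj_kernel_def split_beta' by measurable

lemma P_commute: "P J x y = P J y x"
  unfolding proj_kernel_def by (simp add: mult.commute)

lemma P_near: "P J x y = (\<Sum>l\<in>near J x. mother \<phi> J l x * mother \<phi> J l y)"
  unfolding proj_kernel_near by (intro sum.cong refl mult.commute)

lemma P_near_right: "P J x y = (\<Sum>l\<in>near J y. mother \<phi> J l y * mother \<phi> J l x)"
  unfolding P_commute[of J x y] by (rule P_near)

lemma card_near: "real (card (near J x)) \<le> 2 * R + 2"
proof -
  define u where "u = 2 ^ J * x"
  have "near J x \<subseteq> {\<lceil>u - R\<rceil>..\<lfloor>u + R\<rfloor>}"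
    unfolding near_def u_def by (auto simp: ceiling_le_iff le_floor_iff)
  then have "card (near J x) \<le> card {\<lceil>u - R\<rceil>..\<lfloor>u + R\<rfloor>}" by (intro card_mono) auto
  also have "\<dots> = nat (\<lfloor>u + R\<rfloor> + 1 - \<lceil>u - R\<rceil>)" by simp
  finally have "real (card (near J x)) \<le> real (nat (\<lfloor>u + R\<rfloor> + 1 - \<lceil>u - R\<rceil>))" by simp
  also have "\<dots> \<le> 2 * R + 2"
  proof -
    have "real_of_int (\<lfloor>u + R\<rfloor> + 1 - \<lceil>u - R\<rceil>) \<le> 2 * R + 2"
      using of_int_floor_le[of "u + R"] le_of_int_ceiling[of "u - R"]
      unfolding of_int_add of_int_diff of_int_1 by linarith
    then show ?thesis using R_pos by (cases "0 \<le> \<lfloor>u + R\<rfloor> + 1 - \<lceil>u - R\<rceil>") auto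
  qed
  finally show ?thesis .
qed

lemma B_nonneg: "0 \<le> B" using phi_le[of 0] by linarith
lemma Kb_nonneg: "0 \<le> Kb" unfolding Kb_def using R_pos by simp

lemma mother_mult_le: "\<bar>mother \<phi> J l x * mother \<phi> J l y\<bar> \<le> 2 ^ J * B\<^sup>2"
proof -
  have "\<bar>mother \<phi> J l x * mother \<phi> J l y\<bar> = 2 ^ J * (\<bar>\<phi> (2 ^ J * x - of_int l)\<bar> * \<bar>\<phi> (2 ^ J * y - of_int l)\<bar>)"
    unfolding mother_def powr_half_square[symmetric] by (simp add: abs_mult)
  also have "\<dots> \<le> 2 ^ J * (B * B)"
    by (intro mult_left_mono mult_mono phi_le B_nonneg) auto
  finally show ?thesis by (simp add: power2_eq_square)
qed

lemma P_le: "\<bar>P J x y\<bar> \<le> 2 ^ J * Kb"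
proof -
  have "\<bar>P J x y\<bar> \<le> (\<Sum>l\<in>near J x. \<bar>mother \<phi> J l x * mother \<phi> J l y\<bar>)" unfolding P_near by (rule sum_abs)
  also have "\<dots> \<le> (\<Sum>l\<in>near J x. 2 ^ J * B\<^sup>2)" by (intro sum_mono mother_mult_le)
  also have "\<dots> = real (card (near J x)) * (2 ^ J * B\<^sup>2)" by simp
  also have "\<dots> \<le> (2 * R + 2) * (2 ^ J * B\<^sup>2)" by (intro mult_right_mono card_near) auto
  finally show ?thesis by (simp add: Kb_def mult_ac)
qed

lemma P_eq_0: assumes "2 * R / 2 ^ J < \<bar>x - y\<bar>" shows "P J x y = 0"
  unfolding P_near
proof (rule sum.neutral, rule ballI)
  fix l assume "l \<in> near J x"
  then have 1: "\<bar>2 ^ J * x - of_int l\<bar> \<le> R" by (simp add: near_def)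
  have "2 * R < 2 ^ J * \<bar>x - y\<bar>" using assms by (simp add: divide_less_eq mult.commute)
  also have "\<dots> = \<bar>2 ^ J * x - 2 ^ J * y\<bar>" by (simp add: abs_mult flip: right_diff_distrib)
  finally have "R < \<bar>2 ^ J * y - of_int l\<bar>" using 1 by linarith
  then have "mother \<phi> J l y = 0" by (intro mother_eq_0) (simp add: near_def)
  then show "mother \<phi> J l x * mother \<phi> J l y = 0" by simp
qed

text \<open>
  Both factors are finite combinations of the same orthonormal functions of \<open>x\<close>.
\<close>

lemma P_reproducing: "(LINT x|lborel. P J x u * P J x v) = P J u v" "integrable lborel (\<lambda>x. P J x u * P J x v)"
proof -
  have int: "integrable lborel (\<lambda>x. mother \<phi> J l x * mother \<phi> J k x)" for l k
    by (intro L2_mult_integrable mother_L2 phi_L2)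
  have eq: "P J x u * P J x v = (\<Sum>l\<in>near J u. \<Sum>k\<in>near J v. mother \<phi> J l u * mother \<phi> J k v * (mother \<phi> J l x * mother \<phi> J k x))" for x
    unfolding P_near_right[of J x] sum_product by (intro sum.cong refl) (simp add: mult_ac)
  show "integrable lborel (\<lambda>x. P J x u * P J x v)"
    unfolding eq by (intro Bochner_Integration.integrable_sum integrable_mult_right int)
  have "(LINT x|lborel. P J x u * P J x v) = (\<Sum>l\<in>near J u. \<Sum>k\<in>near J v. mother \<phi> J l u * mother \<phi> J k v * (if l = k then 1 else 0))"
    unfolding eq
    by (simp add: Bochner_Integration.integral_sum int l2inner_def[symmetric] l2inner_mother father_orth)
  also have "\<dots> = (\<Sum>l\<in>near J u. mother \<phi> J l u * mother \<phi> J l v)"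
  proof (intro sum.cong refl)
    fix l
    have "(\<Sum>k\<in>near J v. mother \<phi> J l u * mother \<phi> J k v * (if l = k then 1 else 0))
      = (\<Sum>k\<in>near J v. if k = l then mother \<phi> J l u * mother \<phi> J l v else 0)"
      by (intro sum.cong refl) auto
    also have "\<dots> = mother \<phi> J l u * mother \<phi> J l v"
      using finite_near[of J v] mother_eq_0[of l J v] by simp
    finally show "(\<Sum>k\<in>near J v. mother \<phi> J l u * mother \<phi> J k v * (if l = k then 1 else 0)) = mother \<phi> J l u * mother \<phi> J l v" .
  qed
  finally show "(LINT x|lborel. P J x u * P J x v) = P J u v" unfolding P_near .
qed

lemma P_square_integral: "(LINT y|lborel. (P J x y)\<^sup>2) = P J x x" "integrable lborel (\<lambda>y. (P J x y)\<^sup>2)"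
proof -
  have eq: "(\<lambda>y. (P J x y)\<^sup>2) = (\<lambda>y. P J y x * P J y x)"
    unfolding power2_eq_square by (intro ext arg_cong2[where f="(*)"] P_commute)
  show "(LINT y|lborel. (P J x y)\<^sup>2) = P J x x" "integrable lborel (\<lambda>y. (P J x y)\<^sup>2)"
    unfolding eq by (rule P_reproducing)+
qed

text \<open>
  Up to the factor \<open>2 ^ J\<close>, the average over one period of the sum of squared translates of \<open>\<phi>\<close>
  unfolds to the integral of \<open>\<phi>\<^sup>2\<close>, which is \<open>1\<close>.
\<close>

lemma P_diag_average:
  "(LINT t|lborel. indicator {0..<1} t * P J (x + t / 2 ^ J) (x + t / 2 ^ J)) = 2 ^ J"
proof -
  define u where "u = 2 ^ J * x"
  define L where "L = {\<lfloor>u - R\<rfloor>..\<lceil>u + 1 + R\<rceil>}"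
  have arg: "2 ^ J * (x + t / 2 ^ J) = u + t" for t unfolding u_def by (simp add: distrib_left)
  have P_eq: "indicator {0..<1} t * P J (x + t / 2 ^ J) (x + t / 2 ^ J) = 2 ^ J * (\<Sum>l\<in>L. indicator {0..<1} t * (\<phi> (u + t - of_int l))\<^sup>2)" for t
  proof (cases "t \<in> {0..<1}")
    case True
    have sub: "near J (x + t / 2 ^ J) \<subseteq> L"
      unfolding near_def L_def arg using True by (auto simp: floor_le_iff le_ceiling_iff)
    have "P J (x + t / 2 ^ J) (x + t / 2 ^ J) = (\<Sum>l\<in>L. mother \<phi> J l (x + t / 2 ^ J) * mother \<phi> J l (x + t / 2 ^ J))"
      unfolding P_near by (intro sum.mono_neutral_left sub) (auto simp: L_def mother_eq_0)
    also have "\<dots> = (\<Sum>l\<in>L. 2 ^ J * (\<phi> (u + t - of_int l))\<^sup>2)"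
    proof (intro sum.cong refl)
      fix l
      have "mother \<phi> J l (x + t / 2 ^ J) = 2 powr (real J / 2) * \<phi> (u + t - of_int l)"
        unfolding mother_def arg ..
      then show "mother \<phi> J l (x + t / 2 ^ J) * mother \<phi> J l (x + t / 2 ^ J) = 2 ^ J * (\<phi> (u + t - of_int l))\<^sup>2"
        using powr_half_square[of J] by (simp only: power2_eq_square mult_ac)
    qed
    finally show ?thesis using True by (simp add: sum_distrib_left)
  qed simp
  have phi2: "(LINT y|lborel. (\<phi> y)\<^sup>2) = 1"
    using father_orth[of 0 0] by (simp add: l2inner_def father_def power2_eq_square)
  have int_phi2: "integrable lborel (\<lambda>y. (\<phi> y)\<^sup>2)" by (rule L2_funD(2)[OF phi_L2])
  have int1: "integrable lborel (\<lambda>t. indicator {0..<1} t * (\<phi> (u + t - of_int l))\<^sup>2)" for l :: int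
  proof -
    have "integrable lborel (\<lambda>t. (\<phi> ((u - of_int l) + 1 * t))\<^sup>2)"
      by (rule lborel_integrable_real_affine[OF int_phi2]) simp
    then have "integrable lborel (\<lambda>t. (\<phi> (u + t - of_int l))\<^sup>2)" by (simp add: algebra_simps)
    then show ?thesis
      using integrable_mult_indicator[of "{0..<1}" lborel "\<lambda>t. (\<phi> (u + t - of_int l))\<^sup>2"] by simp
  qed
  have int2: "integrable lborel (\<lambda>y. indicator {0..<1} (y + of_int l - u) * (\<phi> y)\<^sup>2)" for l :: int
    by (rule Bochner_Integration.integrable_bound[OF int_phi2]) (auto simp: indicator_def)
  have sh: "(LINT t|lborel. indicator {0..<1} t * (\<phi> (u + t - of_int l))\<^sup>2)
     = (LINT y|lborel. indicator {0..<1} (y + of_int l - u) * (\<phi> y)\<^sup>2)" for l :: int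
    using lborel_integral_real_affine[of 1 "\<lambda>t. indicator {0..<1} t * (\<phi> (u + t - of_int l))\<^sup>2" "of_int l - u"]
    by (simp add: algebra_simps)
  have one: "(\<Sum>l\<in>L. indicator {0..<1} (y + of_int l - u) * (\<phi> y)\<^sup>2) = (\<phi> y)\<^sup>2" for y
  proof (cases "R < \<bar>y\<bar>")
    case False
    \<comment> \<open>The only translate that brings \<open>y\<close> into the unit interval starting at \<open>u\<close>.\<close>
    define l0 where "l0 = \<lceil>u - y\<rceil>"
    have iff: "y + of_int l - u \<in> {0..<1} \<longleftrightarrow> l = l0" for l :: int
    proof -
      have "l0 = l \<longleftrightarrow> of_int l - 1 < u - y \<and> u - y \<le> of_int l" unfolding l0_def by (rule ceiling_eq_iff)
      also have "\<dots> \<longleftrightarrow> y + of_int l - u \<in> {0..<1}"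
        unfolding atLeastLessThan_iff by (intro iffI conjI; elim conjE; linarith)
      finally show ?thesis by metis
    qed
    have "l0 \<in> L"
    proof -
      have "\<bar>y\<bar> \<le> R" using False by simp
      then have "u - R \<le> u - y" "u - y \<le> u + R" by linarith+
      moreover have "u - y \<le> of_int l0" "of_int l0 < u - y + 1" unfolding l0_def by linarith+
      ultimately have "u - R \<le> of_int l0" "of_int l0 \<le> u + 1 + R" by linarith+
      then show ?thesis unfolding L_def by (auto simp: floor_le_iff le_ceiling_iff)
    qed
    have "(\<Sum>l\<in>L. indicator {0..<1} (y + of_int l - u) * (\<phi> y)\<^sup>2) = (\<Sum>l\<in>L. if l = l0 then (\<phi> y)\<^sup>2 else 0)"
      by (intro sum.cong refl) (simp only: indicator_def iff, simp)
    also have "\<dots> = (\<phi> y)\<^sup>2" using \<open>l0 \<in> L\<close> by (simp add: L_def)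
    finally show ?thesis .
  qed (simp add: phi_supp)
  have "(LINT t|lborel. indicator {0..<1} t * P J (x + t / 2 ^ J) (x + t / 2 ^ J))
     = 2 ^ J * (\<Sum>l\<in>L. LINT t|lborel. indicator {0..<1} t * (\<phi> (u + t - of_int l))\<^sup>2)"
    unfolding P_eq by (simp add: Bochner_Integration.integral_sum int1)
  also have "\<dots> = 2 ^ J * (LINT y|lborel. (\<Sum>l\<in>L. indicator {0..<1} (y + of_int l - u) * (\<phi> y)\<^sup>2))"
    unfolding sh by (simp add: Bochner_Integration.integral_sum int2)
  also have "\<dots> = 2 ^ J" unfolding one phi2 by simp
  finally show ?thesis .
qed

end

section \<open>Second moment of the projection kernel\<close>

lemma integrable_product_mult:
  fixes u w :: "real \<Rightarrow> real"
  assumes w: "integrable lborel w" and u: "integrable lborel u"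
  shows "integrable (lborel \<Otimes>\<^sub>M lborel) (\<lambda>(t, x). u t * w x)"
proof -
  have [measurable]: "u \<in> borel_measurable borel" "w \<in> borel_measurable borel" using u w by auto
  show ?thesis
  proof (rule lborel_pair.Fubini_integrable)
    have "(\<lambda>t. LINT x|lborel. norm (case (t, x) of (t, x) \<Rightarrow> u t * w x)) = (\<lambda>t. \<bar>u t\<bar> * (LINT x|lborel. \<bar>w x\<bar>))"
      by (simp add: abs_mult)
    then show "integrable lborel (\<lambda>t. LINT x|lborel. norm (case (t, x) of (t, x) \<Rightarrow> u t * w x))"
      using u by simp
    show "AE t in lborel. integrable lborel (\<lambda>x. case (t, x) of (t, x) \<Rightarrow> u t * w x)"
      using w by (intro AE_I2) simp
  qed measurable
qed

text \<open>
  \<open>\<alpha>\<close> and \<open>C\<close> describe the \<open>L\<^sub>1\<close> modulus of continuity; this is the only form in which regularity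
  of the density enters.
\<close>

locale smoothed_density = scaling_kernel \<phi> R B for \<phi> :: "real \<Rightarrow> real" and R B :: real +
  fixes f :: "real \<Rightarrow> real" and M C \<alpha> :: real
  assumes f_meas [measurable]: "f \<in> borel_measurable borel"
    and f_nonneg: "\<And>x. 0 \<le> f x" and f_le: "\<And>x. f x \<le> M"
    and f_int: "integrable lborel f" and f_one: "(LINT x|lborel. f x) = 1"
    and C_nonneg: "0 \<le> C"
    and modulus: "\<And>t. \<bar>t\<bar> \<le> 1 \<Longrightarrow> (LINT x|lborel. \<bar>f (x + t) - f x\<bar>) \<le> C * \<bar>t\<bar> powr \<alpha>"
    and alpha: "0 < \<alpha>" "\<alpha> \<le> 1"
begin

definition \<mu> :: "real measure" where "\<mu> = density lborel (\<lambda>x. ennreal (f x))"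

lemma M_nonneg: "0 \<le> M" using f_nonneg[of 0] f_le[of 0] by linarith

lemma sets_mu [measurable_cong, simp]: "sets \<mu> = sets borel" by (simp add: \<mu>_def)
lemma space_mu [simp]: "space \<mu> = UNIV" by (simp add: \<mu>_def)

lemma prob_mu: "prob_space \<mu>"
proof
  have "emeasure \<mu> (space \<mu>) = (\<integral>\<^sup>+x. ennreal (f x) \<partial>lborel)"
    by (simp add: \<mu>_def emeasure_density)
  also have "\<dots> = 1" using f_int f_nonneg f_one by (subst nn_integral_eq_integral) auto
  finally show "emeasure \<mu> (space \<mu>) = 1" .
qed

lemma integral_mu: "g \<in> borel_measurable borel \<Longrightarrow> (LINT x|\<mu>. g x) = (LINT x|lborel. f x * (g x :: real))"
  unfolding \<mu>_def by (subst integral_density) (auto simp: f_nonneg)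

lemma shift_int: "integrable lborel (\<lambda>x. f (x + t))"
  using lborel_integrable_real_affine[OF f_int, of 1 t] by (simp add: add.commute)

lemma f_mult_int: 
  assumes [measurable]: "g \<in> borel_measurable borel" and g: "\<And>x. \<bar>g x\<bar> \<le> c"
  shows "integrable lborel (\<lambda>x. f x * g x)" "integrable lborel (\<lambda>x. (f x)\<^sup>2 * g x)"
proof -
  have c: "0 \<le> c" using g[of 0] by linarith
  have le: "\<bar>f x * g x\<bar> \<le> c * f x" for x
    unfolding abs_mult using f_nonneg[of x] mult_left_mono[OF g[of x] f_nonneg[of x]] by (simp add: mult.commute)
  show "integrable lborel (\<lambda>x. f x * g x)"
  proof (rule Bochner_Integration.integrable_bound[of _ "\<lambda>x. c * f x"])
    show "AE x in lborel. norm (f x * g x) \<le> norm (c * f x)"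
      using le c f_nonneg by (intro AE_I2) (simp add: abs_mult)
  qed (use f_int in auto)
  show "integrable lborel (\<lambda>x. (f x)\<^sup>2 * g x)"
  proof (rule Bochner_Integration.integrable_bound[of _ "\<lambda>x. M * (c * f x)"])
    have "\<bar>(f x)\<^sup>2 * g x\<bar> \<le> M * (c * f x)" for x
    proof -
      have "\<bar>(f x)\<^sup>2 * g x\<bar> = f x * \<bar>f x * g x\<bar>" using f_nonneg[of x] by (simp add: power2_eq_square abs_mult)
      also have "\<dots> \<le> M * (c * f x)" by (intro mult_mono f_le le M_nonneg) auto
      finally show ?thesis .
    qed
    then show "AE x in lborel. norm ((f x)\<^sup>2 * g x) \<le> norm (M * (c * f x))"
      by (intro AE_I2) (metis abs_ge_self order_trans real_norm_def)
  qed (use f_int in auto)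
qed

lemma P_section [measurable]: "(\<lambda>y. P J x y) \<in> borel_measurable borel" 
proof -
  have "(\<lambda>y. case (x, y) of (x, y) \<Rightarrow> P J x y) \<in> borel_measurable borel"
    by (rule measurable_compose[OF _ P_measurable]) simp
  then show ?thesis by simp
qed

text \<open>
  The kernel has height \<open>2 ^ J * Kb\<close> and is supported within \<open>2 R / 2 ^ J\<close> of the diagonal, so its
  absolute value integrates against the density to at most this number, uniformly in \<open>J\<close>.
\<close>

definition cg :: real where "cg = 4 * R * Kb * M"

lemma cg_nonneg: "0 \<le> cg" unfolding cg_def using R_pos Kb_nonneg M_nonneg by simp

lemma P_abs_le_window: "\<bar>P J x y\<bar> \<le> 2 ^ J * Kb * indicator {x - 2 * R / 2 ^ J..x + 2 * R / 2 ^ J} y"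
proof (cases "y \<in> {x - 2 * R / 2 ^ J..x + 2 * R / 2 ^ J}")
  case True then show ?thesis using P_le[of J x y] by simp
next
  case False
  then have "2 * R / 2 ^ J < \<bar>x - y\<bar>" unfolding atLeastAtMost_iff by linarith
  then have "P J x y = 0" by (rule P_eq_0)
  with False show ?thesis by (simp only: indicator_simps) simp
qed

lemma window_int: "integrable lborel (indicat_real {a..b})" "a \<le> b \<Longrightarrow> (LINT x|lborel. indicat_real {a..b} x) = b - a"
  by (rule integrable_real_indicator) (auto simp: emeasure_lborel_Icc_eq)

lemma r_nonneg: "0 \<le> R / 2 ^ J" using R_pos by simp

lemma P_abs_integral_le: "(LINT y|lborel. f y * \<bar>P J x y\<bar>) \<le> cg"
proof -
  let ?r = "2 * R / 2 ^ J"
  have "(LINT y|lborel. f y * \<bar>P J x y\<bar>) \<le> (LINT y|lborel. M * (2 ^ J * Kb) * indicator {x - ?r..x + ?r} y)"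
  proof (rule integral_mono)
    show "integrable lborel (\<lambda>y. f y * \<bar>P J x y\<bar>)"
      by (rule f_mult_int(1)[where c = "2 ^ J * Kb"]) (auto simp: P_le)
    show "integrable lborel (\<lambda>y. M * (2 ^ J * Kb) * indicator {x - ?r..x + ?r} y)"
      by (intro integrable_mult_right window_int)
    show "f y * \<bar>P J x y\<bar> \<le> M * (2 ^ J * Kb) * indicator {x - ?r..x + ?r} y" for y
      unfolding mult.assoc[of M]
      by (intro mult_mono f_le P_abs_le_window M_nonneg) auto
  qed
  also have "\<dots> = M * (2 ^ J * Kb) * (2 * ?r)"
    using r_nonneg[of J] by (subst integral_mult_right_zero, subst window_int(2)) auto
  also have "\<dots> = cg" by (simp add: cg_def)
  finally show ?thesis .
qed

text \<open>
  Substituting \<open>y = x + t\<close> and exchanging the integrals leaves an average of the \<open>L\<^sub>1\<close> modulus over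
  \<open>\<bar>t\<bar> \<le> r\<close>.
\<close>

lemma local_oscillation:
  assumes r: "0 \<le> r" "r \<le> 1"
  shows "(LINT x|lborel. LINT y|lborel. indicator {x - r..x + r} y * \<bar>f y - f x\<bar>) \<le> 2 * r * (C * r powr \<alpha>)"
    and "integrable lborel (\<lambda>x. LINT y|lborel. indicator {x - r..x + r} y * \<bar>f y - f x\<bar>)"
proof -
  let ?F = "\<lambda>t x. indicator {- r..r} t * \<bar>f (x + t) - f x\<bar>"
  have sh: "(LINT y|lborel. indicator {x - r..x + r} y * \<bar>f y - f x\<bar>) = (LINT t|lborel. ?F t x)" for x
  proof -
    have "(LINT y|lborel. indicator {x - r..x + r} y * \<bar>f y - f x\<bar>) =
      (LINT t|lborel. indicator {x - r..x + r} (x + t) * \<bar>f (x + t) - f x\<bar>)"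
      using lborel_integral_real_affine[of 1 "\<lambda>y. indicator {x - r..x + r} y * \<bar>f y - f x\<bar>" x] by simp
    also have "(\<lambda>t. indicator {x - r..x + r} (x + t) * \<bar>f (x + t) - f x\<bar>) = (\<lambda>t. ?F t x)"
      by (intro ext) (auto simp: indicator_def)
    finally show ?thesis .
  qed
  have inner: "(LINT x|lborel. \<bar>f (x + t) - f x\<bar>) \<le> C * r powr \<alpha>" if "t \<in> {-r..r}" for t
  proof -
    have "\<bar>t\<bar> \<le> r" using that by auto
    then have "C * \<bar>t\<bar> powr \<alpha> \<le> C * r powr \<alpha>"
      using alpha C_nonneg by (intro mult_left_mono powr_mono2) auto
    moreover have "(LINT x|lborel. \<bar>f (x + t) - f x\<bar>) \<le> C * \<bar>t\<bar> powr \<alpha>"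
      by (rule modulus) (use \<open>\<bar>t\<bar> \<le> r\<close> r in linarith)
    ultimately show ?thesis by linarith
  qed
  have le: "(LINT x|lborel. ?F t x) \<le> C * r powr \<alpha> * indicator {-r..r} t" for t
    using inner[of t] by (cases "t \<in> {-r..r}") auto
  have nn: "0 \<le> (LINT x|lborel. ?F t x)" for t by (intro Bochner_Integration.integral_nonneg) auto
  have int_outer: "integrable lborel (\<lambda>t. LINT x|lborel. ?F t x)"
  proof (rule Bochner_Integration.integrable_bound[of _ "\<lambda>t. C * r powr \<alpha> * indicator {-r..r} t"])
    show "integrable lborel (\<lambda>t. C * r powr \<alpha> * indicat_real {-r..r} t)"
      by (intro integrable_mult_right window_int)
    show "AE t in lborel. norm (LINT x|lborel. ?F t x) \<le> norm (C * r powr \<alpha> * indicator {-r..r} t)"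
    proof (rule AE_I2)
      fix t show "norm (LINT x|lborel. ?F t x) \<le> norm (C * r powr \<alpha> * indicator {-r..r} t)"
        unfolding real_norm_def using le[of t] nn[of t] by linarith
    qed
  qed measurable
  have int2: "integrable (lborel \<Otimes>\<^sub>M lborel) (\<lambda>(t, x). ?F t x)"
  proof (rule lborel_pair.Fubini_integrable)
    show "integrable lborel (\<lambda>t. LINT x|lborel. norm (case (t, x) of (t, x) \<Rightarrow> ?F t x))"
      using int_outer by (simp add: abs_mult)
    show "AE t in lborel. integrable lborel (\<lambda>x. case (t, x) of (t, x) \<Rightarrow> ?F t x)"
      using f_int shift_int by (intro AE_I2) auto
  qed measurable
  show "integrable lborel (\<lambda>x. LINT y|lborel. indicator {x - r..x + r} y * \<bar>f y - f x\<bar>)"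
    unfolding sh using lborel_pair.integrable_snd[OF int2] by simp
  have "(LINT x|lborel. LINT y|lborel. indicator {x - r..x + r} y * \<bar>f y - f x\<bar>) = (LINT x|lborel. LINT t|lborel. ?F t x)"
    unfolding sh ..
  also have "\<dots> = (LINT t|lborel. LINT x|lborel. ?F t x)"
    using lborel_pair.Fubini_integral[OF int2] by simp
  also have "\<dots> \<le> (LINT t|lborel. C * r powr \<alpha> * indicator {-r..r} t)"
    by (intro integral_mono int_outer le integrable_mult_right window_int)
  also have "\<dots> = 2 * r * (C * r powr \<alpha>)"
    using r by (subst integral_mult_right_zero, subst window_int(2)) auto
  finally show "(LINT x|lborel. LINT y|lborel. indicator {x - r..x + r} y * \<bar>f y - f x\<bar>) \<le> 2 * r * (C * r powr \<alpha>)" .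
qed

definition P2 :: "nat \<Rightarrow> real" where
  "P2 J = (LINT x|lborel. f x * (LINT y|lborel. f y * (P J x y)\<^sup>2))"

lemma P_square_le: "(P J x y)\<^sup>2 \<le> (2 ^ J * Kb)\<^sup>2"
  using power_mono[OF P_le[of J x y] abs_ge_zero, of 2] by (simp only: power2_abs)

lemma inner_square_le: "\<bar>LINT y|lborel. f y * (P J x y)\<^sup>2\<bar> \<le> (2 ^ J * Kb)\<^sup>2"
proof -
  have "(LINT y|lborel. f y * (P J x y)\<^sup>2) \<le> (LINT y|lborel. (2 ^ J * Kb)\<^sup>2 * f y)"
  proof (rule integral_mono)
    show "integrable lborel (\<lambda>y. f y * (P J x y)\<^sup>2)"
      by (rule f_mult_int(1)[where c = "(2 ^ J * Kb)\<^sup>2"]) (auto simp only: abs_power2 P_square_le intro: borel_measurable_power P_section)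
    show "f y * (P J x y)\<^sup>2 \<le> (2 ^ J * Kb)\<^sup>2 * f y" for y
      using mult_left_mono[OF P_square_le f_nonneg] by (simp only: mult.commute)
  qed (intro integrable_mult_right f_int)
  moreover have "0 \<le> (LINT y|lborel. f y * (P J x y)\<^sup>2)"
    by (intro Bochner_Integration.integral_nonneg mult_nonneg_nonneg f_nonneg zero_le_power2)
  ultimately show ?thesis using f_one by simp
qed

lemma diag_measurable [measurable]: "(\<lambda>x. P J x x) \<in> borel_measurable borel"
proof -
  have "(\<lambda>x. case (x, x) of (x, y) \<Rightarrow> P J x y) \<in> borel_measurable borel"
    by (rule measurable_compose[OF _ P_measurable]) simp
  then show ?thesis by simp
qed

text \<open>
  Were \<open>f\<close> constant near \<open>x\<close>, the inner integral would be \<open>f x * P J x x\<close> by the reproducing property.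
  The error is governed by the oscillation of \<open>f\<close> on the scale of the support of the kernel.
\<close>

lemma P2_vs_diag:
  assumes J: "2 * R / 2 ^ J \<le> 1"
  shows "\<bar>P2 J - (LINT x|lborel. (f x)\<^sup>2 * P J x x)\<bar> \<le> 2 ^ J * (Kb\<^sup>2 * M * (4 * R) * C * (2 * R / 2 ^ J) powr \<alpha>)"
proof -
  define r where "r = 2 * R / 2 ^ J"
  have r: "0 \<le> r" "r \<le> 1" using J r_nonneg[of J] by (auto simp: r_def)
  let ?A = "\<lambda>x. LINT y|lborel. f y * (P J x y)\<^sup>2"
  let ?O = "\<lambda>x. LINT y|lborel. indicator {x - r..x + r} y * \<bar>f y - f x\<bar>"
  have mA: "?A \<in> borel_measurable borel" by measurable
  have iA: "integrable lborel (\<lambda>x. f x * ?A x)" by (rule f_mult_int(1)[OF mA inner_square_le])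
  have iD: "integrable lborel (\<lambda>x. (f x)\<^sup>2 * P J x x)" by (rule f_mult_int(2)[OF diag_measurable P_le])
  have pt: "\<bar>f x * ?A x - (f x)\<^sup>2 * P J x x\<bar> \<le> M * ((2 ^ J * Kb)\<^sup>2 * ?O x)" for x
  proof -
    have i1: "integrable lborel (\<lambda>y. f y * (P J x y)\<^sup>2)"
      by (rule f_mult_int(1)[where c = "(2 ^ J * Kb)\<^sup>2"]) (auto simp only: abs_power2 P_square_le intro: borel_measurable_power P_section)
    have i2: "integrable lborel (\<lambda>y. f x * (P J x y)\<^sup>2)" by (intro integrable_mult_right P_square_integral(2))
    have i3: "integrable lborel (\<lambda>y. indicator {x - r..x + r} y * \<bar>f y - f x\<bar>)"
    proof (rule Bochner_Integration.integrable_bound[of _ "\<lambda>y. M * indicat_real {x - r..x + r} y"])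
      have "\<bar>f y - f x\<bar> \<le> M" for y using f_nonneg[of y] f_nonneg[of x] f_le[of y] f_le[of x] by linarith
      then show "AE y in lborel. norm (indicator {x - r..x + r} y * \<bar>f y - f x\<bar>) \<le> norm (M * indicat_real {x - r..x + r} y)"
        using M_nonneg by (intro AE_I2) (simp add: indicator_def)
    qed (auto intro!: integrable_mult_right window_int)
    have "f x * ?A x - (f x)\<^sup>2 * P J x x = f x * (?A x - (LINT y|lborel. f x * (P J x y)\<^sup>2))"
      unfolding integral_mult_right_zero P_square_integral(1)
      by (simp add: power2_eq_square right_diff_distrib)
    also have "?A x - (LINT y|lborel. f x * (P J x y)\<^sup>2) = (LINT y|lborel. f y * (P J x y)\<^sup>2 - f x * (P J x y)\<^sup>2)"
      by (rule Bochner_Integration.integral_diff[symmetric, OF i1 i2])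
    finally have eq: "f x * ?A x - (f x)\<^sup>2 * P J x x = f x * (LINT y|lborel. f y * (P J x y)\<^sup>2 - f x * (P J x y)\<^sup>2)" .
    have "\<bar>LINT y|lborel. f y * (P J x y)\<^sup>2 - f x * (P J x y)\<^sup>2\<bar> \<le> (LINT y|lborel. \<bar>f y * (P J x y)\<^sup>2 - f x * (P J x y)\<^sup>2\<bar>)"
      by (rule integral_abs_bound)
    also have "\<dots> \<le> (LINT y|lborel. (2 ^ J * Kb)\<^sup>2 * (indicator {x - r..x + r} y * \<bar>f y - f x\<bar>))"
    proof (intro integral_mono integrable_mult_right i3 Bochner_Integration.integrable_abs Bochner_Integration.integrable_diff i1 i2)
      fix y
      have "(P J x y)\<^sup>2 \<le> (2 ^ J * Kb)\<^sup>2 * indicator {x - r..x + r} y"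
      proof (cases "y \<in> {x - r..x + r}")
        case True then show ?thesis using P_square_le by simp
      next
        case False
        then have "\<bar>P J x y\<bar> \<le> 0" using P_abs_le_window[of J x y] by (simp add: r_def)
        then show ?thesis by simp
      qed
      then have "\<bar>f y - f x\<bar> * (P J x y)\<^sup>2 \<le> \<bar>f y - f x\<bar> * ((2 ^ J * Kb)\<^sup>2 * indicator {x - r..x + r} y)"
        by (rule mult_left_mono) simp
      moreover have "\<bar>f y * (P J x y)\<^sup>2 - f x * (P J x y)\<^sup>2\<bar> = \<bar>f y - f x\<bar> * (P J x y)\<^sup>2"
        unfolding left_diff_distrib[symmetric] abs_mult by simp
      ultimately show "\<bar>f y * (P J x y)\<^sup>2 - f x * (P J x y)\<^sup>2\<bar> \<le> (2 ^ J * Kb)\<^sup>2 * (indicator {x - r..x + r} y * \<bar>f y - f x\<bar>)"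
        by (simp only: mult_ac)
    qed (rule P_square_integral(2))
    also have "\<dots> = (2 ^ J * Kb)\<^sup>2 * ?O x" by simp
    finally have "\<bar>LINT y|lborel. f y * (P J x y)\<^sup>2 - f x * (P J x y)\<^sup>2\<bar> \<le> (2 ^ J * Kb)\<^sup>2 * ?O x" .
    then show ?thesis unfolding eq abs_mult using f_nonneg[of x] f_le[of x] M_nonneg
      by (intro mult_mono) auto
  qed
  have "\<bar>P2 J - (LINT x|lborel. (f x)\<^sup>2 * P J x x)\<bar> = \<bar>LINT x|lborel. f x * ?A x - (f x)\<^sup>2 * P J x x\<bar>"
    unfolding P2_def by (simp only: Bochner_Integration.integral_diff[OF iA iD])
  also have "\<dots> \<le> (LINT x|lborel. \<bar>f x * ?A x - (f x)\<^sup>2 * P J x x\<bar>)" by (rule integral_abs_bound)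
  also have "\<dots> \<le> (LINT x|lborel. M * ((2 ^ J * Kb)\<^sup>2 * ?O x))"
    by (intro integral_mono pt Bochner_Integration.integrable_abs Bochner_Integration.integrable_diff iA iD
        integrable_mult_right local_oscillation(2)[OF r])
  also have "\<dots> = M * ((2 ^ J * Kb)\<^sup>2 * (LINT x|lborel. ?O x))" by simp
  also have "\<dots> \<le> M * ((2 ^ J * Kb)\<^sup>2 * (2 * r * (C * r powr \<alpha>)))"
    by (intro mult_left_mono local_oscillation(1)[OF r] M_nonneg) auto
  also have "\<dots> = 2 ^ J * (Kb\<^sup>2 * M * (4 * R) * C * (2 * R / 2 ^ J) powr \<alpha>)"
    by (simp add: r_def power_mult_distrib power2_eq_square)
  finally show ?thesis .
qed

text \<open>
  Translating the integration variable by \<open>s\<close> leaves the integral unchanged; moving the translation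
  away from \<open>f\<close> costs the \<open>L\<^sub>1\<close> modulus. Averaging over a full period then replaces the diagonal of
  the kernel by its mean \<open>2 ^ J\<close>.
\<close>

lemma diag_vs_square:
  "\<bar>(LINT x|lborel. (f x)\<^sup>2 * P J x x) - 2 ^ J * (LINT x|lborel. (f x)\<^sup>2)\<bar> \<le> 2 ^ J * (2 * Kb * M * C * (1 / 2 ^ J) powr \<alpha>)"
proof -
  define a :: real where "a = 1 / 2 ^ J"
  have a: "0 < a" "a \<le> 1" by (auto simp: a_def)
  let ?p = "\<lambda>x. P J x x"
  let ?S = "LINT x|lborel. (f x)\<^sup>2 * ?p x"
  let ?u = "indicat_real {0..<1::real}"
  have int_u: "integrable lborel ?u" "(LINT t|lborel. ?u t) = 1"
    by (rule integrable_real_indicator) (auto simp: emeasure_lborel_Ico)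
  have i_sh: "integrable lborel (\<lambda>x. (f (x + s))\<^sup>2 * ?p (x + s))" for s
    using lborel_integrable_real_affine[OF f_mult_int(2)[OF diag_measurable P_le], of 1 s J] by (simp add: add.commute)
  have i_mix: "integrable lborel (\<lambda>x. (f x)\<^sup>2 * ?p (x + s))" for s
    by (rule f_mult_int(2)[where c = "2 ^ J * Kb"]) (auto simp: P_le)
  have step: "\<bar>?S - (LINT x|lborel. (f x)\<^sup>2 * ?p (x + s))\<bar> \<le> 2 ^ J * (2 * Kb * M * C * a powr \<alpha>)" if s: "0 \<le> s" "s \<le> a" for s
  proof -
    have "?S = (LINT x|lborel. (f (x + s))\<^sup>2 * ?p (x + s))"
      using lborel_integral_real_affine[of 1 "\<lambda>x. (f x)\<^sup>2 * ?p x" s] by (simp add: add.commute)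
    then have "?S - (LINT x|lborel. (f x)\<^sup>2 * ?p (x + s)) = (LINT x|lborel. (f (x + s))\<^sup>2 * ?p (x + s) - (f x)\<^sup>2 * ?p (x + s))"
      by (simp only: Bochner_Integration.integral_diff[OF i_sh i_mix])
    then have "\<bar>?S - (LINT x|lborel. (f x)\<^sup>2 * ?p (x + s))\<bar> \<le> (LINT x|lborel. \<bar>(f (x + s))\<^sup>2 * ?p (x + s) - (f x)\<^sup>2 * ?p (x + s)\<bar>)"
      by (simp only: integral_abs_bound)
    also have "\<dots> \<le> (LINT x|lborel. (2 ^ J * Kb * (2 * M)) * \<bar>f (x + s) - f x\<bar>)"
    proof (rule integral_mono)
      show "integrable lborel (\<lambda>x. (2 ^ J * Kb * (2 * M)) * \<bar>f (x + s) - f x\<bar>)"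
        by (intro integrable_mult_right Bochner_Integration.integrable_abs Bochner_Integration.integrable_diff shift_int f_int)
      fix x
      have "(f (x + s))\<^sup>2 * ?p (x + s) - (f x)\<^sup>2 * ?p (x + s) = ?p (x + s) * ((f (x + s) + f x) * (f (x + s) - f x))"
        by (simp add: power2_eq_square algebra_simps)
      also have "\<bar>\<dots>\<bar> = \<bar>?p (x + s)\<bar> * ((f (x + s) + f x) * \<bar>f (x + s) - f x\<bar>)"
        using f_nonneg[of x] f_nonneg[of "x + s"] by (simp add: abs_mult)
      also have "\<dots> \<le> (2 ^ J * Kb) * ((2 * M) * \<bar>f (x + s) - f x\<bar>)"
        using f_nonneg[of x] f_nonneg[of "x + s"] f_le[of x] f_le[of "x + s"] Kb_nonneg
        by (intro mult_mono P_le) auto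
      finally show "\<bar>(f (x + s))\<^sup>2 * ?p (x + s) - (f x)\<^sup>2 * ?p (x + s)\<bar> \<le> (2 ^ J * Kb * (2 * M)) * \<bar>f (x + s) - f x\<bar>"
        by (simp only: mult.assoc)
    qed (intro Bochner_Integration.integrable_abs Bochner_Integration.integrable_diff i_sh i_mix)
    also have "\<dots> = (2 ^ J * Kb * (2 * M)) * (LINT x|lborel. \<bar>f (x + s) - f x\<bar>)" by simp
    also have "\<dots> \<le> (2 ^ J * Kb * (2 * M)) * (C * a powr \<alpha>)"
    proof (rule mult_left_mono)
      have "(LINT x|lborel. \<bar>f (x + s) - f x\<bar>) \<le> C * \<bar>s\<bar> powr \<alpha>" by (rule modulus) (use s a in auto)
      also have "\<dots> \<le> C * a powr \<alpha>" using s alpha C_nonneg by (intro mult_left_mono powr_mono2) auto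
      finally show "(LINT x|lborel. \<bar>f (x + s) - f x\<bar>) \<le> C * a powr \<alpha>" .
    qed (use Kb_nonneg M_nonneg in auto)
    finally show ?thesis by (simp only: mult_ac)
  qed
  let ?m = "\<lambda>t. LINT x|lborel. (f x)\<^sup>2 * ?p (x + t * a)"
  have int2: "integrable (lborel \<Otimes>\<^sub>M lborel) (\<lambda>(t, x). ?u t * ((f x)\<^sup>2 * ?p (x + t * a)))"
  proof (rule Bochner_Integration.integrable_bound[of _ "\<lambda>(t, x). ?u t * ((f x)\<^sup>2 * (2 ^ J * Kb))"])
    have "integrable lborel (\<lambda>x. (f x)\<^sup>2 * (2 ^ J * Kb))"
      by (rule f_mult_int(2)[where c = "2 ^ J * Kb"]) (use Kb_nonneg in auto)
    then show "integrable (lborel \<Otimes>\<^sub>M lborel) (\<lambda>(t, x). ?u t * ((f x)\<^sup>2 * (2 ^ J * Kb)))"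
      using int_u(1) by (rule integrable_product_mult)
    show "AE p in lborel \<Otimes>\<^sub>M lborel. norm (case p of (t, x) \<Rightarrow> ?u t * ((f x)\<^sup>2 * ?p (x + t * a)))
       \<le> norm (case p of (t, x) \<Rightarrow> ?u t * ((f x)\<^sup>2 * (2 ^ J * Kb)))"
    proof (rule AE_I2)
      fix p :: "real \<times> real"
      obtain t x where p: "p = (t, x)" by (cases p)
      have "\<bar>(f x)\<^sup>2 * ?p (x + t * a)\<bar> \<le> \<bar>(f x)\<^sup>2 * (2 ^ J * Kb)\<bar>"
        unfolding abs_mult by (intro mult_left_mono order_trans[OF P_le]) (simp_all add: abs_of_nonneg Kb_nonneg)
      then have "\<bar>?u t\<bar> * \<bar>(f x)\<^sup>2 * ?p (x + t * a)\<bar> \<le> \<bar>?u t\<bar> * \<bar>(f x)\<^sup>2 * (2 ^ J * Kb)\<bar>"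
        by (rule mult_left_mono) (rule abs_ge_zero)
      then show "norm (case p of (t, x) \<Rightarrow> ?u t * ((f x)\<^sup>2 * ?p (x + t * a)))
       \<le> norm (case p of (t, x) \<Rightarrow> ?u t * ((f x)\<^sup>2 * (2 ^ J * Kb)))"
        unfolding p prod.case real_norm_def abs_mult[of "?u t"] .
    qed
  qed measurable
  have e1: "(LINT t|lborel. ?u t * ?m t) = (LINT t|lborel. LINT x|lborel. ?u t * ((f x)\<^sup>2 * ?p (x + t * a)))"
    unfolding integral_mult_right_zero ..
  have e2: "(LINT t|lborel. LINT x|lborel. ?u t * ((f x)\<^sup>2 * ?p (x + t * a)))
      = (LINT x|lborel. LINT t|lborel. ?u t * ((f x)\<^sup>2 * ?p (x + t * a)))"
    by (rule lborel_pair.Fubini_integral[OF int2, symmetric])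
  have e3: "(LINT t|lborel. ?u t * ((f x)\<^sup>2 * ?p (x + t * a))) = 2 ^ J * (f x)\<^sup>2" for x
  proof -
    have "(LINT t|lborel. ?u t * ((f x)\<^sup>2 * ?p (x + t * a))) = (LINT t|lborel. (f x)\<^sup>2 * (?u t * ?p (x + t / 2 ^ J)))"
      by (intro Bochner_Integration.integral_cong refl) (simp add: a_def)
    then show ?thesis
      by (simp only: integral_mult_right_zero P_diag_average mult.commute[of "(2::real) ^ J"])
  qed
  have e4: "(LINT x|lborel. 2 ^ J * (f x)\<^sup>2) = 2 ^ J * (LINT x|lborel. (f x)\<^sup>2)"
    by (rule integral_mult_right_zero)
  have avg: "(LINT t|lborel. ?u t * ?m t) = 2 ^ J * (LINT x|lborel. (f x)\<^sup>2)"
    by (rule trans[OF e1 trans[OF e2]]) (simp only: e3 e4)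
  have int_m: "integrable lborel (\<lambda>t. ?u t * ?m t)"
    using lborel_pair.integrable_fst[OF int2] unfolding integral_mult_right_zero .
  have "?S - 2 ^ J * (LINT x|lborel. (f x)\<^sup>2) = (LINT t|lborel. ?u t * ?S) - (LINT t|lborel. ?u t * ?m t)"
    unfolding avg integral_mult_left_zero int_u(2) mult_1 ..
  also have "\<dots> = (LINT t|lborel. ?u t * ?S - ?u t * ?m t)"
    by (rule Bochner_Integration.integral_diff[symmetric, OF integrable_mult_left[OF int_u(1)] int_m])
  finally have eq: "?S - 2 ^ J * (LINT x|lborel. (f x)\<^sup>2) = (LINT t|lborel. ?u t * ?S - ?u t * ?m t)" .
  have "\<bar>?S - 2 ^ J * (LINT x|lborel. (f x)\<^sup>2)\<bar> \<le> (LINT t|lborel. \<bar>?u t * ?S - ?u t * ?m t\<bar>)"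
    unfolding eq by (rule integral_abs_bound)
  also have "\<dots> \<le> (LINT t|lborel. ?u t * (2 ^ J * (2 * Kb * M * C * a powr \<alpha>)))"
  proof (rule integral_mono)
    fix t
    show "\<bar>?u t * ?S - ?u t * ?m t\<bar> \<le> ?u t * (2 ^ J * (2 * Kb * M * C * a powr \<alpha>))"
    proof (cases "t \<in> {0..<1}")
      case True
      then have "0 \<le> t * a" "t * a \<le> a" using a by (auto simp: mult_le_cancel_right1)
      from step[OF this] show ?thesis using True by simp
    qed simp
  next
    show "integrable lborel (\<lambda>t. \<bar>?u t * ?S - ?u t * ?m t\<bar>)"
      by (intro Bochner_Integration.integrable_abs Bochner_Integration.integrable_diff integrable_mult_left int_u(1) int_m)
    show "integrable lborel (\<lambda>t. ?u t * (2 ^ J * (2 * Kb * M * C * a powr \<alpha>)))"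
      by (intro integrable_mult_left int_u(1))
  qed
  also have "\<dots> = 2 ^ J * (2 * Kb * M * C * a powr \<alpha>)"
    unfolding integral_mult_left_zero int_u(2) mult_1 ..
  finally show ?thesis unfolding a_def .
qed

section \<open>The degenerate part of the projection kernel\<close>

interpretation mu: prob_space \<mu> by (rule prob_mu)

text \<open>
  \<open>H\<close> is the Hoeffding projection of the kernel onto functions degenerate in both variables, and
  \<open>Dg\<close> is what the diagonal of the double sum and the linear term leave over.
\<close>

definition gP :: "nat \<Rightarrow> real \<Rightarrow> real" where "gP J x = (LINT y|\<mu>. P J x y)"
definition \<theta> :: "nat \<Rightarrow> real" where "\<theta> J = (LINT x|\<mu>. gP J x)"
definition H :: "nat \<Rightarrow> real \<Rightarrow> real \<Rightarrow> real" where "H J x y = P J x y - gP J x - gP J y + \<theta> J"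
definition Dg :: "nat \<Rightarrow> real \<Rightarrow> real" where "Dg J x = P J x x - 2 * gP J x"
definition vH :: "nat \<Rightarrow> real" where "vH J = (LINT x|\<mu>. LINT y|\<mu>. (H J x y)\<^sup>2)"
definition ch :: real where "ch = Kb + 3 * cg"

lemma P_mu_measurable: "(\<lambda>(x, y). P J x y) \<in> borel_measurable (\<mu> \<Otimes>\<^sub>M \<mu>)"
  by measurable

lemma int_mu_bounded: "g \<in> borel_measurable borel \<Longrightarrow> (\<And>x. \<bar>g x\<bar> \<le> c) \<Longrightarrow> integrable \<mu> (g :: real \<Rightarrow> real)"
  by (rule mu.integrable_const_bound[where B = c]) auto

lemma int_P: "integrable \<mu> (P J x)"
  by (rule int_mu_bounded[OF _ P_le]) measurable

lemma P_abs_mu_le: "(LINT y|\<mu>. \<bar>P J x y\<bar>) \<le> cg"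
  using P_abs_integral_le[of J x] by (subst integral_mu) auto

lemma gP_measurable [measurable]: "gP J \<in> borel_measurable borel"
proof -
  have "(\<lambda>x. LINT y|\<mu>. P J x y) \<in> borel_measurable \<mu>"
    by (rule mu.borel_measurable_lebesgue_integral[OF P_mu_measurable])
  then show ?thesis unfolding gP_def[abs_def] by simp
qed

lemma gP_le: "\<bar>gP J x\<bar> \<le> cg"
  unfolding gP_def using P_abs_mu_le[of J x] integral_abs_bound[of \<mu> "P J x"] by linarith

lemma theta_le: "\<bar>\<theta> J\<bar> \<le> cg"
proof -
  have "\<bar>\<theta> J\<bar> \<le> (LINT x|\<mu>. \<bar>gP J x\<bar>)" unfolding \<theta>_def by (rule integral_abs_bound)
  also have "\<dots> \<le> (LINT x|\<mu>. cg)" by (rule integral_mono') (auto simp: gP_le cg_nonneg)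
  finally show ?thesis using mu.prob_space by simp
qed

lemma H_measurable [measurable]: "(\<lambda>(x, y). H J x y) \<in> borel_measurable (borel \<Otimes>\<^sub>M borel)"
  unfolding H_def split_beta' by measurable

lemma H_section [measurable]: "H J x \<in> borel_measurable borel"
  unfolding H_def[abs_def] by measurable

lemma H_commute: "H J x y = H J y x"
  unfolding H_def using P_commute[of J x y] by linarith

lemma H_minus_P: "\<bar>H J x y - P J x y\<bar> \<le> 3 * cg"
  unfolding H_def using gP_le[of J x] gP_le[of J y] theta_le[of J] by linarith

lemma H_abs_le: "\<bar>H J x y\<bar> \<le> \<bar>P J x y\<bar> + 3 * cg"
  using H_minus_P[of J x y] by linarith

lemma H_le: "\<bar>H J x y\<bar> \<le> 2 ^ J * ch"
proof -
  have "3 * cg \<le> 2 ^ J * (3 * cg)" using mult_right_mono[of 1 "2 ^ J" "3 * cg"] cg_nonneg by simp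
  then show ?thesis using H_abs_le[of J x y] P_le[of J x y] unfolding ch_def distrib_left by linarith
qed

lemma H_degenerate: "(LINT y|\<mu>. H J x y) = 0"
proof -
  have ig: "integrable \<mu> (gP J)" by (rule int_mu_bounded[OF _ gP_le]) measurable
  have "(LINT y|\<mu>. H J x y) = (LINT y|\<mu>. P J x y - gP J x - gP J y) + \<theta> J"
    unfolding H_def using int_P ig by (subst Bochner_Integration.integral_add) (auto simp: mu.prob_space[simplified])
  also have "(LINT y|\<mu>. P J x y - gP J x - gP J y) = gP J x - gP J x - \<theta> J"
    using int_P ig mu.prob_space by (simp add: gP_def[symmetric] \<theta>_def)
  finally show ?thesis by simp
qed

lemma H_abs_mu_le: "(LINT y|\<mu>. \<bar>H J x y\<bar>) \<le> 4 * cg"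
proof -
  have "(LINT y|\<mu>. \<bar>H J x y\<bar>) \<le> (LINT y|\<mu>. \<bar>P J x y\<bar> + 3 * cg)"
    by (intro integral_mono H_abs_le Bochner_Integration.integrable_add Bochner_Integration.integrable_abs int_P
        int_mu_bounded[OF H_section H_le]) simp
  also have "\<dots> = (LINT y|\<mu>. \<bar>P J x y\<bar>) + 3 * cg"
    using int_P mu.prob_space by simp
  finally show ?thesis using P_abs_mu_le[of J x] by linarith
qed

lemma P2_mu: "P2 J = (LINT x|\<mu>. LINT y|\<mu>. (P J x y)\<^sup>2)"
proof -
  have "(LINT y|\<mu>. (P J x y)\<^sup>2) = (LINT y|lborel. f y * (P J x y)\<^sup>2)" for x
    by (rule integral_mu) measurable
  then show ?thesis unfolding P2_def by (subst integral_mu) auto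
qed

lemma H_square_le: "(H J x y)\<^sup>2 \<le> (2 ^ J * ch)\<^sup>2"
  using power_mono[OF H_le[of J x y] abs_ge_zero, of 2] by (simp only: power2_abs)

lemma int_sq: "integrable \<mu> (\<lambda>y. (P J x y)\<^sup>2)" "integrable \<mu> (\<lambda>y. (H J x y)\<^sup>2)"
  by (rule int_mu_bounded[where c = "(2 ^ J * Kb)\<^sup>2"], measurable, simp only: abs_power2 P_square_le)
     (rule int_mu_bounded[where c = "(2 ^ J * ch)\<^sup>2"], measurable, simp only: abs_power2 H_square_le)

lemma inner_sq_le:
  "\<bar>LINT y|\<mu>. (P J x y)\<^sup>2\<bar> \<le> (2 ^ J * Kb)\<^sup>2" "\<bar>LINT y|\<mu>. (H J x y)\<^sup>2\<bar> \<le> (2 ^ J * ch)\<^sup>2"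
proof -
  have gen: "\<bar>LINT y|\<mu>. g y\<bar> \<le> c" if "integrable \<mu> g" "\<And>y. \<bar>g y\<bar> \<le> c" for g :: "real \<Rightarrow> real" and c
  proof -
    have "\<bar>LINT y|\<mu>. g y\<bar> \<le> (LINT y|\<mu>. \<bar>g y\<bar>)" by (rule integral_abs_bound)
    also have "\<dots> \<le> (LINT y|\<mu>. c)" using that by (intro integral_mono) auto
    finally show ?thesis using mu.prob_space by simp
  qed
  show "\<bar>LINT y|\<mu>. (P J x y)\<^sup>2\<bar> \<le> (2 ^ J * Kb)\<^sup>2" by (rule gen[OF int_sq(1)]) (simp only: abs_power2 P_square_le)
  show "\<bar>LINT y|\<mu>. (H J x y)\<^sup>2\<bar> \<le> (2 ^ J * ch)\<^sup>2" by (rule gen[OF int_sq(2)]) (simp only: abs_power2 H_square_le)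
qed

lemma vH_minus_P2: "\<bar>vH J - P2 J\<bar> \<le> 15 * cg\<^sup>2"
proof -
  have inner: "\<bar>(LINT y|\<mu>. (H J x y)\<^sup>2) - (LINT y|\<mu>. (P J x y)\<^sup>2)\<bar> \<le> 15 * cg\<^sup>2" for x
  proof -
    have "(LINT y|\<mu>. (H J x y)\<^sup>2) - (LINT y|\<mu>. (P J x y)\<^sup>2) = (LINT y|\<mu>. (H J x y)\<^sup>2 - (P J x y)\<^sup>2)"
      by (rule Bochner_Integration.integral_diff[symmetric, OF int_sq(2) int_sq(1)])
    then have "\<bar>(LINT y|\<mu>. (H J x y)\<^sup>2) - (LINT y|\<mu>. (P J x y)\<^sup>2)\<bar> \<le> (LINT y|\<mu>. \<bar>(H J x y)\<^sup>2 - (P J x y)\<^sup>2\<bar>)"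
      by (simp only: integral_abs_bound)
    also have "\<dots> \<le> (LINT y|\<mu>. 3 * cg * (2 * \<bar>P J x y\<bar> + 3 * cg))"
    proof (intro integral_mono Bochner_Integration.integrable_abs Bochner_Integration.integrable_diff int_sq)
      fix y
      have "(H J x y)\<^sup>2 - (P J x y)\<^sup>2 = (H J x y - P J x y) * (H J x y + P J x y)"
        by (simp add: power2_eq_square algebra_simps)
      then have "\<bar>(H J x y)\<^sup>2 - (P J x y)\<^sup>2\<bar> = \<bar>H J x y - P J x y\<bar> * \<bar>H J x y + P J x y\<bar>"
        by (simp only: abs_mult)
      also have "\<dots> \<le> 3 * cg * (2 * \<bar>P J x y\<bar> + 3 * cg)"
        using H_abs_le[of J x y] cg_nonneg by (intro mult_mono H_minus_P) linarith+
      finally show "\<bar>(H J x y)\<^sup>2 - (P J x y)\<^sup>2\<bar> \<le> 3 * cg * (2 * \<bar>P J x y\<bar> + 3 * cg)" .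
    next
      show "integrable \<mu> (\<lambda>y. 3 * cg * (2 * \<bar>P J x y\<bar> + 3 * cg))" using int_P by simp
    qed
    also have "\<dots> = 3 * cg * (2 * (LINT y|\<mu>. \<bar>P J x y\<bar>) + 3 * cg)" using int_P mu.prob_space by simp
    also have "\<dots> \<le> 3 * cg * (2 * cg + 3 * cg)"
      using P_abs_mu_le[of J x] cg_nonneg by (intro mult_left_mono add_mono) auto
    finally show ?thesis by (simp add: power2_eq_square)
  qed
  have iP: "integrable \<mu> (\<lambda>x. LINT y|\<mu>. (P J x y)\<^sup>2)" and iH: "integrable \<mu> (\<lambda>x. LINT y|\<mu>. (H J x y)\<^sup>2)"
    by (rule int_mu_bounded[OF _ inner_sq_le(1)], measurable) (rule int_mu_bounded[OF _ inner_sq_le(2)], measurable)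
  have "vH J - P2 J = (LINT x|\<mu>. (LINT y|\<mu>. (H J x y)\<^sup>2) - (LINT y|\<mu>. (P J x y)\<^sup>2))"
    unfolding vH_def P2_mu by (rule Bochner_Integration.integral_diff[symmetric, OF iH iP])
  then have "\<bar>vH J - P2 J\<bar> \<le> (LINT x|\<mu>. \<bar>(LINT y|\<mu>. (H J x y)\<^sup>2) - (LINT y|\<mu>. (P J x y)\<^sup>2)\<bar>)"
    by (simp only: integral_abs_bound)
  also have "\<dots> \<le> (LINT x|\<mu>. 15 * cg\<^sup>2)"
    by (intro integral_mono inner Bochner_Integration.integrable_abs Bochner_Integration.integrable_diff iP iH) simp
  finally show ?thesis using mu.prob_space by simp
qed

lemma vH_nonneg: "0 \<le> vH J" unfolding vH_def by (intro Bochner_Integration.integral_nonneg) auto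

lemma vH_le: "vH J \<le> 2 ^ J * (4 * ch * cg)"
proof -
  have inner: "(LINT y|\<mu>. (H J x y)\<^sup>2) \<le> 2 ^ J * (4 * ch * cg)" for x
  proof -
    have "(LINT y|\<mu>. (H J x y)\<^sup>2) \<le> (LINT y|\<mu>. 2 ^ J * ch * \<bar>H J x y\<bar>)"
    proof (intro integral_mono int_sq integrable_mult_right Bochner_Integration.integrable_abs)
      show "integrable \<mu> (H J x)" by (rule int_mu_bounded[OF H_section H_le])
      show "(H J x y)\<^sup>2 \<le> 2 ^ J * ch * \<bar>H J x y\<bar>" for y
        using mult_right_mono[OF H_le abs_ge_zero, of J x y "H J x y"] by (simp add: power2_eq_square abs_mult_self_eq)
    qed
    also have "\<dots> = 2 ^ J * ch * (LINT y|\<mu>. \<bar>H J x y\<bar>)" by simp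
    also have "\<dots> \<le> 2 ^ J * ch * (4 * cg)"
      using Kb_nonneg cg_nonneg by (intro mult_left_mono H_abs_mu_le) (simp add: ch_def)
    finally show ?thesis by (simp only: mult_ac)
  qed
  have "vH J \<le> (LINT x|\<mu>. 2 ^ J * (4 * ch * cg))"
    unfolding vH_def
  proof (rule integral_mono[OF _ _ inner])
    show "integrable \<mu> (\<lambda>x. LINT y|\<mu>. (H J x y)\<^sup>2)"
      by (rule int_mu_bounded[OF _ inner_sq_le(2)]) measurable
  qed simp
  then show ?thesis using mu.prob_space by simp
qed

definition GH :: "nat \<Rightarrow> real \<Rightarrow> real \<Rightarrow> real" where "GH J x y = (LINT z|\<mu>. H J z x * H J z y)"

definition cG :: real where "cG = 2 * (Kb * cg)\<^sup>2 * (8 * R * M) + 2 * (15 * cg\<^sup>2)\<^sup>2"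

lemma GH_measurable [measurable]: "(\<lambda>(x, y). GH J x y) \<in> borel_measurable (borel \<Otimes>\<^sub>M borel)"
proof -
  have "(\<lambda>(x, y). LINT z|\<mu>. H J z x * H J z y) \<in> borel_measurable (\<mu> \<Otimes>\<^sub>M \<mu>)" by measurable
  then show ?thesis unfolding GH_def by (simp cong: measurable_cong_sets add: sets_pair_measure_cong[of \<mu> borel \<mu> borel])
qed

text \<open>
  The product of two copies of the kernel vanishes unless both second arguments are within one
  window of each other; the other three parts of \<open>H\<close> are bounded.
\<close>

lemma GH_le: "\<bar>GH J x y\<bar> \<le> 2 ^ J * Kb * cg * indicator {x - 4 * R / 2 ^ J..x + 4 * R / 2 ^ J} y + 15 * cg\<^sup>2"
proof -
  have iPs: "integrable \<mu> (\<lambda>z. P J z u)" for u using int_P[of J u] P_commute[of J u] by (simp cong: Bochner_Integration.integrable_cong)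
  have iPP: "integrable \<mu> (\<lambda>z. \<bar>P J z x\<bar> * \<bar>P J z y\<bar>)"
  proof (rule int_mu_bounded[where c = "(2 ^ J * Kb) * (2 ^ J * Kb)"])
    show "\<bar>\<bar>P J z x\<bar> * \<bar>P J z y\<bar>\<bar> \<le> (2 ^ J * Kb) * (2 ^ J * Kb)" for z
      using Kb_nonneg by (simp only: abs_mult abs_abs) (intro mult_mono P_le; simp)
  qed measurable
  have iHH: "integrable \<mu> (\<lambda>z. \<bar>H J z x * H J z y\<bar>)"
  proof (rule int_mu_bounded[where c = "(2 ^ J * ch) * (2 ^ J * ch)"])
    show "\<bar>\<bar>H J z x * H J z y\<bar>\<bar> \<le> (2 ^ J * ch) * (2 ^ J * ch)" for z
      using Kb_nonneg cg_nonneg unfolding abs_abs abs_mult by (intro mult_mono H_le) (simp_all add: ch_def)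
  qed measurable
  have abs_swap: "(LINT z|\<mu>. \<bar>P J z u\<bar>) \<le> cg" for u using P_abs_mu_le[of J u] P_commute[of J u] by simp
  have PP: "(LINT z|\<mu>. \<bar>P J z x\<bar> * \<bar>P J z y\<bar>) \<le> 2 ^ J * Kb * cg * indicator {x - 4 * R / 2 ^ J..x + 4 * R / 2 ^ J} y"
  proof (cases "y \<in> {x - 4 * R / 2 ^ J..x + 4 * R / 2 ^ J}")
    case True
    have "(LINT z|\<mu>. \<bar>P J z x\<bar> * \<bar>P J z y\<bar>) \<le> (LINT z|\<mu>. 2 ^ J * Kb * \<bar>P J z y\<bar>)"
      by (intro integral_mono iPP integrable_mult_right Bochner_Integration.integrable_abs iPs mult_right_mono P_le) simp
    also have "\<dots> = 2 ^ J * Kb * (LINT z|\<mu>. \<bar>P J z y\<bar>)" by simp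
    also have "\<dots> \<le> 2 ^ J * Kb * cg" using Kb_nonneg by (intro mult_left_mono abs_swap) simp
    finally show ?thesis using True by simp
  next
    case False
    have "\<bar>P J z x\<bar> * \<bar>P J z y\<bar> = 0" for z
    proof (rule ccontr)
      assume "\<bar>P J z x\<bar> * \<bar>P J z y\<bar> \<noteq> 0"
      then have "P J z x \<noteq> 0" "P J z y \<noteq> 0" by auto
      then have "\<not> 2 * R / 2 ^ J < \<bar>z - x\<bar>" "\<not> 2 * R / 2 ^ J < \<bar>z - y\<bar>" using P_eq_0 by blast+
      moreover have "4 * R / 2 ^ J = 2 * (2 * R / 2 ^ J)" by simp
      ultimately show False using False unfolding atLeastAtMost_iff by linarith
    qed
    then have "(LINT z|\<mu>. \<bar>P J z x\<bar> * \<bar>P J z y\<bar>) = 0" by (simp only: integral_zero)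
    then show ?thesis using False by simp
  qed
  have "\<bar>GH J x y\<bar> \<le> (LINT z|\<mu>. \<bar>H J z x * H J z y\<bar>)" unfolding GH_def by (rule integral_abs_bound)
  also have "\<dots> \<le> (LINT z|\<mu>. \<bar>P J z x\<bar> * \<bar>P J z y\<bar> + 3 * cg * \<bar>P J z x\<bar> + 3 * cg * \<bar>P J z y\<bar> + 9 * cg\<^sup>2)"
  proof (rule integral_mono[OF iHH])
    show "integrable \<mu> (\<lambda>z. \<bar>P J z x\<bar> * \<bar>P J z y\<bar> + 3 * cg * \<bar>P J z x\<bar> + 3 * cg * \<bar>P J z y\<bar> + 9 * cg\<^sup>2)"
      by (intro Bochner_Integration.integrable_add iPP integrable_mult_right Bochner_Integration.integrable_abs iPs) simp
    fix z
    have "\<bar>H J z x * H J z y\<bar> \<le> (\<bar>P J z x\<bar> + 3 * cg) * (\<bar>P J z y\<bar> + 3 * cg)"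
      unfolding abs_mult using cg_nonneg by (intro mult_mono H_abs_le) auto
    then show "\<bar>H J z x * H J z y\<bar> \<le> \<bar>P J z x\<bar> * \<bar>P J z y\<bar> + 3 * cg * \<bar>P J z x\<bar> + 3 * cg * \<bar>P J z y\<bar> + 9 * cg\<^sup>2"
      by (simp add: power2_eq_square algebra_simps)
  qed
  also have "\<dots> = (LINT z|\<mu>. \<bar>P J z x\<bar> * \<bar>P J z y\<bar>) + 3 * cg * (LINT z|\<mu>. \<bar>P J z x\<bar>) + 3 * cg * (LINT z|\<mu>. \<bar>P J z y\<bar>) + 9 * cg\<^sup>2"
    using iPP iPs mu.prob_space by simp
  also have "\<dots> \<le> 2 ^ J * Kb * cg * indicator {x - 4 * R / 2 ^ J..x + 4 * R / 2 ^ J} y + 3 * cg * cg + 3 * cg * cg + 9 * cg\<^sup>2"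
    using cg_nonneg by (intro add_mono PP mult_left_mono abs_swap) auto
  finally show ?thesis by (simp add: power2_eq_square)
qed

text \<open>
  The bound of \<open>GH_le\<close> squared has height of order \<open>4 ^ J\<close> on a strip of width of order \<open>1 / 2 ^ J\<close>
  and is bounded elsewhere. This gives the decay \<open>1 / 2 ^ J\<close> of the dominant part of the
  variance of \<open>T\<close>.
\<close>

lemma GH_square_integral_le: "(LINT x|\<mu>. LINT y|\<mu>. (GH J x y)\<^sup>2) \<le> 2 ^ J * cG"
proof -
  define k where "k = 2 ^ J * Kb * cg"
  have k: "0 \<le> k" unfolding k_def using Kb_nonneg cg_nonneg by simp
  let ?w = "\<lambda>x. {x - 4 * R / 2 ^ J..x + 4 * R / 2 ^ J}"
  have inner: "(LINT y|\<mu>. (GH J x y)\<^sup>2) \<le> 2 ^ J * cG" for x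
  proof -
    have sq: "(GH J x y)\<^sup>2 \<le> 2 * k\<^sup>2 * indicator (?w x) y + 2 * (15 * cg\<^sup>2)\<^sup>2" for y
    proof -
      have "(GH J x y)\<^sup>2 \<le> (k * indicator (?w x) y + 15 * cg\<^sup>2)\<^sup>2"
        using power_mono[OF GH_le[of J x y] abs_ge_zero, of 2] by (simp only: power2_abs k_def)
      also have "\<dots> \<le> 2 * (k * indicator (?w x) y)\<^sup>2 + 2 * (15 * cg\<^sup>2)\<^sup>2"
        using sum_squares_bound[of "k * indicator (?w x) y" "15 * cg\<^sup>2"] unfolding power2_sum by linarith
      also have "(k * indicator (?w x) y)\<^sup>2 = k\<^sup>2 * indicator (?w x) y" by (simp add: indicator_def)
      finally show ?thesis by simp
    qed
    have iw: "integrable \<mu> (indicat_real (?w x))" by (rule int_mu_bounded[where c = 1]) (auto simp: indicator_def)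
    have "(LINT y|\<mu>. (GH J x y)\<^sup>2) \<le> (LINT y|\<mu>. 2 * k\<^sup>2 * indicator (?w x) y + 2 * (15 * cg\<^sup>2)\<^sup>2)"
    proof (rule integral_mono'[OF _ sq])
      show "integrable \<mu> (\<lambda>y. 2 * k\<^sup>2 * indicator (?w x) y + 2 * (15 * cg\<^sup>2)\<^sup>2)" using iw by simp
    qed simp
    also have "\<dots> = 2 * k\<^sup>2 * (LINT y|\<mu>. indicator (?w x) y) + 2 * (15 * cg\<^sup>2)\<^sup>2"
      using iw mu.prob_space by simp
    also have "(LINT y|\<mu>. indicat_real (?w x) y) \<le> 8 * R * M / 2 ^ J"
    proof -
      have "(LINT y|\<mu>. indicat_real (?w x) y) = (LINT y|lborel. f y * indicator (?w x) y)"
        by (rule integral_mu) measurable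
      also have "\<dots> \<le> (LINT y|lborel. M * indicator (?w x) y)"
        by (intro integral_mono f_mult_int(1)[where c = 1] integrable_mult_right window_int mult_right_mono f_le)
           (auto simp: indicator_def)
      also have "\<dots> = M * (2 * (4 * R / 2 ^ J))"
        using r_nonneg[of J] by (subst integral_mult_right_zero, subst window_int(2)) auto
      finally show ?thesis by (simp add: mult_ac)
    qed
    also have "2 * k\<^sup>2 * (8 * R * M / 2 ^ J) = 2 ^ J * (2 * (Kb * cg)\<^sup>2 * (8 * R * M))"
      by (simp add: k_def power2_eq_square)
    also have "\<dots> + 2 * (15 * cg\<^sup>2)\<^sup>2 \<le> 2 ^ J * cG"
      unfolding cG_def distrib_left
      using mult_right_mono[of 1 "2 ^ J" "2 * (15 * cg\<^sup>2)\<^sup>2"] by simp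
    finally show ?thesis by (simp add: mult_left_mono)
  qed
  have "(LINT x|\<mu>. LINT y|\<mu>. (GH J x y)\<^sup>2) \<le> (LINT x|\<mu>. 2 ^ J * cG)"
  proof (rule integral_mono'[OF _ inner])
    show "0 \<le> 2 ^ J * cG" unfolding cG_def using R_pos M_nonneg by simp
  qed simp
  then show ?thesis using mu.prob_space by simp
qed

text \<open>
  The centred integrated squared error times \<open>n\<^sup>2\<close>.
\<close>

definition stat :: "nat \<Rightarrow> nat \<Rightarrow> (nat \<Rightarrow> real) \<Rightarrow> real" where
  "stat J n x = (\<Sum>i\<in>{1..n}. \<Sum>k\<in>{1..n} - {i}. H J (x i) (x k))
     + (\<Sum>i\<in>{1..n}. Dg J (x i) - (LINT y|\<mu>. Dg J y))"

lemma Dg_measurable [measurable]: "Dg J \<in> borel_measurable borel"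
  unfolding Dg_def[abs_def] by measurable

lemma Dg_le: "\<bar>Dg J x\<bar> \<le> 2 ^ J * ch"
proof -
  have "2 * cg \<le> 2 ^ J * (3 * cg)" using mult_mono[of 1 "2 ^ J" "2 * cg" "3 * cg"] cg_nonneg by simp
  then show ?thesis using P_le[of J x x] gP_le[of J x] unfolding Dg_def ch_def distrib_left by linarith
qed

text \<open>
  The summands are independent, centred and of order \<open>2 ^ J\<close>.
\<close>

lemma diagonal_part_le:
  assumes n: "1 \<le> n"
  shows "(LINT x|Pi\<^sub>M {1..n} (\<lambda>_. \<mu>). \<bar>\<Sum>i\<in>{1..n}. Dg J (x i) - (LINT y|\<mu>. Dg J y)\<bar>) \<le> sqrt (real n) * (2 ^ J * ch)"
    and "integrable (Pi\<^sub>M {1..n} (\<lambda>_. \<mu>)) (\<lambda>x. \<Sum>i\<in>{1..n}. Dg J (x i) - (LINT y|\<mu>. Dg J y))"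
proof -
  interpret I: iid_product \<mu> "{1..n}" by unfold_locales simp
  define m where "m = (LINT y|\<mu>. Dg J y)"
  define Y where "Y i x = Dg J (x i) - m" for i :: nat and x :: "nat \<Rightarrow> real"
  have mD: "Dg J \<in> borel_measurable \<mu>" by measurable
  have int_D: "integrable \<mu> (Dg J)" by (rule int_mu_bounded[OF Dg_measurable Dg_le])
  have bD: "I.bdm (\<lambda>x. Dg J (x i))" if "i \<in> {1..n}" for i
    by (rule I.EE_single(2)[OF mD Dg_le that])
  have bY: "I.bdm (Y i)" if "i \<in> {1..n}" for i
    unfolding Y_def by (intro I.bdm_diff I.bdm_const bD that)
  have sumb: "I.bdm (\<lambda>x. \<Sum>i\<in>{1..n}. Y i x)" by (intro I.bdm_sum bY)
  have one: "I.EE (\<lambda>x. (Y i x)\<^sup>2) \<le> (2 ^ J * ch)\<^sup>2" if i: "i \<in> {1..n}" for i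
  proof -
    have "I.EE (\<lambda>x. (Y i x)\<^sup>2) \<le> I.EE (\<lambda>x. (2 ^ J * ch)\<^sup>2 + m\<^sup>2 - 2 * m * Dg J (x i))"
    proof (intro I.EE_mono I.bdm_diff I.bdm_power I.bdm_mult I.bdm_const bD bY i)
      fix x :: "nat \<Rightarrow> real"
      have "(Dg J (x i))\<^sup>2 \<le> (2 ^ J * ch)\<^sup>2"
        using power_mono[OF Dg_le[of J "x i"] abs_ge_zero, of 2] by (simp only: power2_abs)
      then show "(Y i x)\<^sup>2 \<le> (2 ^ J * ch)\<^sup>2 + m\<^sup>2 - 2 * m * Dg J (x i)"
        unfolding Y_def power2_diff by simp
    qed
    also have "\<dots> = I.EE (\<lambda>x. (2 ^ J * ch)\<^sup>2 + m\<^sup>2) - I.EE (\<lambda>x. 2 * m * Dg J (x i))"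
      by (intro I.EE_diff I.bdm_mult I.bdm_const bD i)
    also have "\<dots> = (2 ^ J * ch)\<^sup>2 + m\<^sup>2 - 2 * m * m"
      unfolding integral_mult_right_zero I.EE_single(1)[OF mD Dg_le i] m_def[symmetric] I.EE_const ..
    also have "\<dots> \<le> (2 ^ J * ch)\<^sup>2" by (simp add: power2_eq_square)
    finally show ?thesis .
  qed
  have "I.EE (\<lambda>x. (\<Sum>i\<in>{1..n}. Y i x)\<^sup>2) \<le> 1 * (\<Sum>i\<in>{1..n}. I.EE (\<lambda>x. (Y i x)\<^sup>2))"
  proof (rule I.EE_sum_square_le[where R = "(=)"])
    fix i k assume ik: "i \<in> {1..n}" "k \<in> {1..n}" "\<not> i = k"
    show "I.EE (\<lambda>x. Y i x * Y k x) = 0"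
    proof (rule I.EE_orth[OF bY[OF ik(1)] bY[OF ik(2)] ik(1)])
      show "(\<integral>y. Y i (x(i := y)) \<partial>\<mu>) = 0" for x
        using int_D mu.prob_space by (simp add: Y_def m_def)
      show "Y k (x(i := y)) = Y k x" for x y using ik by (simp add: Y_def)
    qed
  next
    fix i assume "i \<in> {1..n}"
    then have "{k \<in> {1..n}. i = k} = {i}" by auto
    then show "real (card {k \<in> {1..n}. i = k}) \<le> 1" by simp
  next
    show "I.bdm (Y i)" if "i \<in> {1..n}" for i by (rule bY[OF that])
  qed auto
  also have "\<dots> \<le> (\<Sum>i\<in>{1..n}. (2 ^ J * ch)\<^sup>2)" unfolding mult_1 by (intro sum_mono one)
  also have "\<dots> = real n * (2 ^ J * ch)\<^sup>2" by simp
  finally have sq: "I.EE (\<lambda>x. (\<Sum>i\<in>{1..n}. Y i x)\<^sup>2) \<le> real n * (2 ^ J * ch)\<^sup>2" .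
  define a where "a = I.EE (\<lambda>x. \<bar>\<Sum>i\<in>{1..n}. Y i x\<bar>)"
  have "0 \<le> I.EE (\<lambda>x. (\<bar>\<Sum>i\<in>{1..n}. Y i x\<bar> - a)\<^sup>2)" by (rule I.EE_nonneg) simp
  also have "\<dots> = I.EE (\<lambda>x. \<bar>\<Sum>i\<in>{1..n}. Y i x\<bar>\<^sup>2) - a\<^sup>2"
    unfolding a_def by (rule I.P.variance_eq) (intro I.bdm_integrable I.bdm_power I.bdm_abs sumb)+
  finally have "a\<^sup>2 \<le> real n * (2 ^ J * ch)\<^sup>2" using sq by simp
  then have "a \<le> sqrt (real n * (2 ^ J * ch)\<^sup>2)" by (rule real_le_rsqrt)
  also have "\<dots> = sqrt (real n) * (2 ^ J * ch)"
    using Kb_nonneg cg_nonneg by (simp add: real_sqrt_mult ch_def)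
  finally show "(LINT x|Pi\<^sub>M {1..n} (\<lambda>_. \<mu>). \<bar>\<Sum>i\<in>{1..n}. Dg J (x i) - (LINT y|\<mu>. Dg J y)\<bar>) \<le> sqrt (real n) * (2 ^ J * ch)"
    unfolding a_def Y_def m_def .
  show "integrable (Pi\<^sub>M {1..n} (\<lambda>_. \<mu>)) (\<lambda>x. \<Sum>i\<in>{1..n}. Dg J (x i) - (LINT y|\<mu>. Dg J y))"
    using I.bdm_integrable[OF sumb] unfolding Y_def m_def .
qed

lemma ch_nonneg: "0 \<le> ch" unfolding ch_def using Kb_nonneg cg_nonneg by simp
lemma cG_nonneg: "0 \<le> cG" unfolding cG_def using R_pos M_nonneg by simp

definition c2 :: real where "c2 = Kb\<^sup>2 * M * (4 * R) * C * (2 * R) powr \<alpha> + 2 * Kb * M * C"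

lemma c2_nonneg: "0 \<le> c2" unfolding c2_def using Kb_nonneg M_nonneg R_pos C_nonneg by simp

lemma second_moment_limit:
  assumes J: "2 * R / 2 ^ J \<le> 1"
  shows "\<bar>P2 J / 2 ^ J - (LINT x|lborel. (f x)\<^sup>2)\<bar> \<le> c2 * (1 / 2 ^ J) powr \<alpha>"
proof -
  have "(2 * R / 2 ^ J) powr \<alpha> = (2 * R) powr \<alpha> * (1 / 2 ^ J) powr \<alpha>"
    using R_pos by (simp flip: powr_mult)
  then have "\<bar>P2 J - 2 ^ J * (LINT x|lborel. (f x)\<^sup>2)\<bar> \<le> 2 ^ J * (c2 * (1 / 2 ^ J) powr \<alpha>)"
    using P2_vs_diag[OF J] diag_vs_square[of J] unfolding c2_def by (simp add: algebra_simps)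
  moreover have "P2 J - 2 ^ J * (LINT x|lborel. (f x)\<^sup>2) = 2 ^ J * (P2 J / 2 ^ J - (LINT x|lborel. (f x)\<^sup>2))"
    by (simp add: field_simps)
  ultimately have "2 ^ J * \<bar>P2 J / 2 ^ J - (LINT x|lborel. (f x)\<^sup>2)\<bar> \<le> 2 ^ J * (c2 * (1 / 2 ^ J) powr \<alpha>)"
    by (simp add: abs_mult)
  then show ?thesis by (simp only: mult_le_cancel_left_pos zero_less_power zero_less_numeral)
qed

text \<open>
  The quantity compared with \<open>1\<close> is the mean of \<open>T\<close> for the normalised kernel.
\<close>

lemma variance_approx:
  assumes J: "2 * R / 2 ^ J \<le> 1" and n: "1 \<le> n" and \<sigma>: "0 < \<sigma>" "\<sigma>\<^sup>2 = 2 * (LINT x|lborel. (f x)\<^sup>2)"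
  shows "\<bar>1 - 2 / \<sigma>\<^sup>2 * (1 - 1 / real n) * (vH J / 2 ^ J)\<bar>
    \<le> 2 / \<sigma>\<^sup>2 * (c2 + 15 * cg\<^sup>2 + 4 * ch * cg) * ((1 / 2 ^ J) powr \<alpha> + 1 / 2 ^ J + 1 / real n)"
proof -
  define F where "F = (LINT x|lborel. (f x)\<^sup>2)"
  define N :: real where "N = 2 ^ J"
  have N: "0 < N" by (simp add: N_def)
  have "\<sigma>\<^sup>2 = 2 * F" using \<sigma>(2) by (simp only: F_def)
  moreover have "0 < \<sigma>\<^sup>2" using \<sigma>(1) by simp
  ultimately have F: "2 / \<sigma>\<^sup>2 * F = 1" by simp
  let ?x = "(1 / N) powr \<alpha>"
  have "\<bar>P2 J / N - F\<bar> \<le> c2 * ?x" using second_moment_limit[OF J] by (simp add: N_def F_def)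
  moreover have "\<bar>vH J / N - P2 J / N\<bar> \<le> 15 * cg\<^sup>2 * (1 / N)"
    using vH_minus_P2[of J] N by (simp add: divide_right_mono flip: diff_divide_distrib)
  moreover have "\<bar>vH J / N * (1 / real n)\<bar> \<le> 4 * ch * cg * (1 / real n)"
  proof -
    have "vH J / N \<le> 4 * ch * cg" using vH_le[of J] N by (simp add: N_def field_simps)
    then have "vH J / N * (1 / real n) \<le> 4 * ch * cg * (1 / real n)" by (rule mult_right_mono) simp
    moreover have "0 \<le> vH J / N * (1 / real n)" using vH_nonneg[of J] N by simp
    ultimately show ?thesis by linarith
  qed
  moreover have "F - (1 - u) * w = - (p - F) - (w - p) + w * u" for u w p :: real
    by (simp add: algebra_simps)
  then have "F - (1 - 1 / real n) * (vH J / N) = - (P2 J / N - F) - (vH J / N - P2 J / N) + vH J / N * (1 / real n)" .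
  ultimately have "\<bar>F - (1 - 1 / real n) * (vH J / N)\<bar> \<le> c2 * ?x + 15 * cg\<^sup>2 * (1 / N) + 4 * ch * cg * (1 / real n)"
    by linarith
  also have "\<dots> \<le> (c2 + 15 * cg\<^sup>2 + 4 * ch * cg) * ?x + (c2 + 15 * cg\<^sup>2 + 4 * ch * cg) * (1 / N) + (c2 + 15 * cg\<^sup>2 + 4 * ch * cg) * (1 / real n)"
    using c2_nonneg ch_nonneg cg_nonneg N by (intro add_mono mult_right_mono) auto
  finally have le: "\<bar>F - (1 - 1 / real n) * (vH J / N)\<bar> \<le> (c2 + 15 * cg\<^sup>2 + 4 * ch * cg) * (?x + 1 / N + 1 / real n)"
    by (simp only: distrib_left)
  have "1 - t * u * w = t * (F - u * w)" if "t * F = 1" for t u w :: real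
    using that by (simp add: right_diff_distrib mult.assoc)
  from this[OF F] have "1 - 2 / \<sigma>\<^sup>2 * (1 - 1 / real n) * (vH J / N) = 2 / \<sigma>\<^sup>2 * (F - (1 - 1 / real n) * (vH J / N))" .
  then have "\<bar>1 - 2 / \<sigma>\<^sup>2 * (1 - 1 / real n) * (vH J / N)\<bar> = \<bar>2 / \<sigma>\<^sup>2\<bar> * \<bar>F - (1 - 1 / real n) * (vH J / N)\<bar>"
    by (simp only: abs_mult)
  also have "\<dots> = 2 / \<sigma>\<^sup>2 * \<bar>F - (1 - 1 / real n) * (vH J / N)\<bar>" by simp
  also have "\<dots> \<le> 2 / \<sigma>\<^sup>2 * ((c2 + 15 * cg\<^sup>2 + 4 * ch * cg) * (?x + 1 / N + 1 / real n))"
    by (intro mult_left_mono le) simp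
  finally show ?thesis by (simp only: N_def mult.assoc)
qed

section \<open>Normal approximation of the centred statistic\<close>

text \<open>
  The three terms come from the smoothness of the density, from the fluctuation of \<open>T\<close>, and from
  smoothing with \<open>\<epsilon> = (2 ^ J / n) powr (1 / 4)\<close>.
\<close>

definition rate :: "nat \<Rightarrow> nat \<Rightarrow> real" where
  "rate J n = (1 / 2 ^ J) powr \<alpha> + 1 / sqrt (2 ^ J) + (2 ^ J / real n) powr (1 / 4)"

text \<open>
  If the constant times the rate is at least \<open>1\<close>, there is nothing to prove. Otherwise all the
  smallness conditions of \<open>smooth_distance_le\<close> follow from it, which makes the bound uniform in \<open>J\<close>
  and \<open>n\<close>.
\<close>

lemma stat_normal_approximation:
  assumes \<sigma>: "0 < \<sigma>" "\<sigma>\<^sup>2 = 2 * (LINT x|lborel. (f x)\<^sup>2)"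
  obtains K where "\<And>J n t. 1 \<le> n \<Longrightarrow>
    \<bar>measure (Pi\<^sub>M {1..n} (\<lambda>_. \<mu>)) {x \<in> space (Pi\<^sub>M {1..n} (\<lambda>_. \<mu>)). stat J n x / (\<sigma> * real n * sqrt (2 ^ J)) \<le> t}
      - measure std_normal_distribution {..t}\<bar> \<le> K * rate J n"
proof -
  define k1 where "k1 = 2 / \<sigma>\<^sup>2 * (c2 + 15 * cg\<^sup>2 + 4 * ch * cg)"
  define kq where "kq = 64 * ch^3 * cg / \<sigma>^4 + 1"
  define kr where "kr = 16 * cG / \<sigma>^4"
  define k2 where "k2 = 24 * kq + 3 * kr"
  \<comment> \<open>The first four summands make the smallness conditions consequences of \<open>K * rate J n < 1\<close>; the others bound the distance.\<close>
  define K where "K = 1 + 2 * R + k1 + k2 + 2 * k1 + 2 * sqrt k2 + 126 * sqrt kq + ch / \<sigma>"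
  have nn: "0 \<le> k1" "0 \<le> k2" "0 < kq" "0 \<le> kr"
    unfolding k1_def k2_def kq_def kr_def
    using c2_nonneg ch_nonneg cg_nonneg cG_nonneg by (auto intro!: add_nonneg_pos add_nonneg_nonneg mult_nonneg_nonneg divide_nonneg_nonneg)
  have K_parts: "1 \<le> K" "2 * R \<le> K" "k1 \<le> K" "k2 \<le> K"
    "2 * k1 + 2 * sqrt k2 + 126 * sqrt kq + 1 + ch / \<sigma> \<le> K"
    unfolding K_def using nn R_pos ch_nonneg \<sigma> by auto
  show thesis
  proof (rule that[of K])
    fix J n :: nat and t :: real assume n: "1 \<le> n"
    define \<Omega> where "\<Omega> = Pi\<^sub>M {1..n} (\<lambda>_. \<mu>)"
    define N :: real where "N = 2 ^ J"
    define \<xi> where "\<xi> = rate J n"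
    define \<rho> where "\<rho> = N / real n"
    have N: "1 \<le> N" by (simp add: N_def)
    have \<rho>: "0 < \<rho>" using N n by (simp add: \<rho>_def)
    interpret I: iid_product \<mu> "{1..n}" by unfold_locales simp
    interpret N01: prob_space std_normal_distribution by (rule prob_space_normal_density) simp
    have parts: "(1 / N) powr \<alpha> \<le> \<xi>" "1 / sqrt N \<le> \<xi>" "\<rho> powr (1/4) \<le> \<xi>" "0 \<le> \<xi>"
      and \<xi>_eq: "\<xi> = (1 / N) powr \<alpha> + 1 / sqrt N + \<rho> powr (1/4)"
      unfolding \<xi>_def rate_def N_def \<rho>_def by auto
    show "\<bar>measure \<Omega> {x \<in> space \<Omega>. stat J n x / (\<sigma> * real n * sqrt (2 ^ J)) \<le> t} - measure std_normal_distribution {..t}\<bar> \<le> K * \<xi>"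
    proof (cases "1 \<le> K * \<xi>")
      case True
      have "measure \<Omega> A \<le> 1" for A unfolding \<Omega>_def by (rule I.P.prob_le_1)
      moreover have "measure std_normal_distribution A \<le> 1" for A by (rule N01.prob_le_1)
      ultimately show ?thesis using True measure_nonneg by (smt (verit))
    next
      case False
      then have small: "K * \<xi> < 1" by simp
      have le1: "c * \<xi> \<le> 1" if "c \<le> K" for c
        using mult_right_mono[OF that parts(4)] small by linarith
      have \<xi>1: "\<xi> \<le> 1" using le1[OF K_parts(1)] by simp
      have \<rho>1: "\<rho> \<le> 1"
      proof (rule ccontr)
        assume "\<not> \<rho> \<le> 1"
        then have "1 < \<rho> powr (1/4)" using powr_less_mono2[of "1/4" 1 \<rho>] by simp
        then show False using parts \<xi>1 by linarith
      qed
      have N_le: "1 / N \<le> 1 / sqrt N"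
      proof -
        have "sqrt N \<le> N" using N real_le_rsqrt real_sqrt_le_iff[of N "N\<^sup>2"] by (simp add: power2_eq_square mult_left_mono)
        then show ?thesis using N by (intro divide_left_mono) auto
      qed
      have \<rho>_le: "\<rho> \<le> \<rho> powr (1/4)" "sqrt \<rho> \<le> \<rho> powr (1/4)"
      proof -
        have "\<rho> powr 1 \<le> \<rho> powr (1/4)" using \<rho> \<rho>1 by (intro powr_mono') auto
        then show "\<rho> \<le> \<rho> powr (1/4)" using \<rho> by simp
        have "\<rho> powr (1/2) \<le> \<rho> powr (1/4)" using \<rho> \<rho>1 by (intro powr_mono') auto
        then show "sqrt \<rho> \<le> \<rho> powr (1/4)" using \<rho> by (simp add: powr_half_sqrt)
      qed
      have n_le: "1 / real n \<le> \<rho>" unfolding \<rho>_def using N by (simp add: divide_right_mono)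
      have J: "2 * R / 2 ^ J \<le> 1"
      proof -
        have "2 * R / 2 ^ J = 2 * R * (1 / N)" by (simp add: N_def)
        also have "\<dots> \<le> 2 * R * \<xi>" using R_pos N_le parts by (intro mult_left_mono) auto
        also have "\<dots> \<le> 1" by (rule le1[OF K_parts(2)])
        finally show ?thesis .
      qed
      define c where "c = 2 / (\<sigma> * real n * sqrt N)"
      define h where "h x y = c * H J x y" for x y
      define b where "b = c * (N * ch)"
      have c: "0 < c" unfolding c_def using \<sigma> n N by simp
      have c2: "c\<^sup>2 = 4 / (\<sigma>\<^sup>2 * (real n)\<^sup>2 * N)"
        unfolding c_def using N by (simp add: power_divide power_mult_distrib)
      interpret Q: degenerate_kernel \<mu> "{1..n}" h b
      proof unfold_locales
        show "(\<lambda>(x, y). h x y) \<in> borel_measurable (\<mu> \<Otimes>\<^sub>M \<mu>)" unfolding h_def by measurable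
        show "h x y = h y x" for x y unfolding h_def by (simp only: H_commute[of J x y])
        show "\<bar>h x y\<bar> \<le> b" for x y
          unfolding h_def b_def abs_mult using c H_le[of J x y] by (simp add: N_def)
        show "(\<integral>y. h x y \<partial>\<mu>) = 0" for x unfolding h_def by (simp add: H_degenerate)
      qed
      have v_eq: "Q.v = c\<^sup>2 * vH J"
        unfolding Q.v_def h_def vH_def power_mult_distrib by simp
      have GG: "Q.G x y = c\<^sup>2 * GH J x y" for x y
      proof -
        have "Q.G x y = (LINT z|\<mu>. c\<^sup>2 * (H J z x * H J z y))"
          unfolding Q.G_def h_def by (simp add: power2_eq_square mult_ac)
        then show ?thesis unfolding GH_def by simp
      qed
      have g_eq: "Q.g = c\<^sup>2 * c\<^sup>2 * (LINT x|\<mu>. LINT y|\<mu>. (GH J x y)\<^sup>2)"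
        unfolding Q.g_def GG power_mult_distrib by (simp add: power2_eq_square)
      have nn_eq: "real (card {1..n}) = real n" by simp
      have s_eq: "I.EE Q.T = 2 / \<sigma>\<^sup>2 * (1 - 1 / real n) * (vH J / 2 ^ J)"
        unfolding Q.EE_T v_eq c2 nn_eq N_def[symmetric] using n N \<sigma>(1) by (simp add: field_simps power2_eq_square)
      have s_bound: "\<bar>1 - I.EE Q.T\<bar> \<le> k1 * \<xi>"
      proof -
        have "\<bar>1 - I.EE Q.T\<bar> \<le> k1 * ((1 / 2 ^ J) powr \<alpha> + 1 / 2 ^ J + 1 / real n)"
          unfolding s_eq k1_def by (rule variance_approx[OF J n \<sigma>])
        also have "\<dots> \<le> k1 * \<xi>"
          unfolding \<xi>_eq N_def[symmetric] using nn N_le n_le \<rho>_le by (intro mult_left_mono) linarith+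
        finally show ?thesis .
      qed
      have q_bound: "real n ^ 3 * b\<^sup>2 * Q.v \<le> kq * \<rho>"
      proof -
        have "real n ^ 3 * b\<^sup>2 * Q.v = real n ^ 3 * (c\<^sup>2 * (N * ch)\<^sup>2) * c\<^sup>2 * vH J"
          unfolding b_def v_eq by (simp add: power_mult_distrib)
        also have "\<dots> \<le> real n ^ 3 * (c\<^sup>2 * (N * ch)\<^sup>2) * c\<^sup>2 * (N * (4 * ch * cg))"
          using vH_le[of J] by (intro mult_left_mono) (auto simp: N_def)
        also have "\<dots> = 64 * ch^3 * cg / \<sigma>^4 * \<rho>"
          unfolding c2 \<rho>_def using n N \<sigma>(1)
          by (simp add: field_simps power2_eq_square power3_eq_cube power4_eq_xxxx)
        also have "\<dots> \<le> kq * \<rho>" unfolding kq_def using \<rho> by (intro mult_right_mono) auto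
        finally show ?thesis .
      qed
      have r_bound: "real n ^ 4 * Q.g \<le> kr * (1 / N)"
      proof -
        have "real n ^ 4 * Q.g \<le> real n ^ 4 * (c\<^sup>2 * c\<^sup>2 * (N * cG))"
          unfolding g_eq using GH_square_integral_le[of J] by (intro mult_left_mono) (auto simp: N_def)
        also have "\<dots> = kr * (1 / N)"
          unfolding c2 kr_def using n N \<sigma>(1) by (simp add: field_simps power2_eq_square power4_eq_xxxx)
        finally show ?thesis .
      qed
      define V where "V = 24 * (real n ^ 3 * b\<^sup>2 * Q.v) + 3 * (real n ^ 4 * Q.g)"
      have V: "V \<le> k2 * (\<rho> + 1 / N)"
      proof -
        have "V \<le> 24 * (kq * \<rho>) + 3 * (kr * (1 / N))" unfolding V_def using q_bound r_bound by linarith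
        also have "\<dots> \<le> 24 * (kq * (\<rho> + 1 / N)) + 3 * (kr * (\<rho> + 1 / N))"
          using nn \<rho> N by (intro add_mono mult_left_mono) auto
        also have "\<dots> = k2 * (\<rho> + 1 / N)" unfolding k2_def by (simp only: distrib_right mult.assoc)
        finally show ?thesis .
      qed
      have \<rho>N: "\<rho> + 1 / N \<le> \<xi>" unfolding \<xi>_eq using N_le \<rho>_le powr_ge_zero[of "1 / N" \<alpha>] by linarith
      have V1: "V \<le> 1" using V mult_left_mono[OF \<rho>N nn(2)] le1[OF K_parts(4)] by linarith
      have sqrtV: "sqrt V \<le> sqrt k2 * \<xi>"
      proof -
        have "sqrt V \<le> sqrt (k2 * (\<rho> + 1 / N))" using V by (rule real_sqrt_le_mono)
        also have "\<dots> = sqrt k2 * sqrt (\<rho> + 1 / N)" by (rule real_sqrt_mult)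
        also have "\<dots> \<le> sqrt k2 * (sqrt \<rho> + sqrt (1 / N))"
          using nn \<rho> N by (intro mult_left_mono sqrt_add_le_add_sqrt) auto
        also have "\<dots> \<le> sqrt k2 * \<xi>"
        proof (rule mult_left_mono)
          show "sqrt \<rho> + sqrt (1 / N) \<le> \<xi>"
            unfolding \<xi>_eq real_sqrt_divide real_sqrt_one using \<rho>_le(2) powr_ge_zero[of "1 / N" \<alpha>] by linarith
        qed (use nn in simp)
        finally show ?thesis .
      qed
      define \<epsilon> where "\<epsilon> = \<rho> powr (1/4)"
      have \<epsilon>: "0 < \<epsilon>" "\<epsilon> \<le> 1" "\<epsilon> \<le> \<xi>" unfolding \<epsilon>_def using \<rho> parts \<xi>1 by auto
      have \<epsilon>2: "sqrt \<rho> / \<epsilon> = \<epsilon>"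
      proof -
        have "sqrt \<rho> = \<rho> powr (1/4 + 1/4)" using \<rho> by (simp add: powr_half_sqrt)
        also have "\<dots> = \<epsilon> * \<epsilon>" unfolding powr_add \<epsilon>_def ..
        finally show ?thesis using \<epsilon> by simp
      qed
      define \<kappa> where "\<kappa> = sqrt (kq * \<rho>)"
      have \<kappa>: "0 < \<kappa>" "\<kappa>\<^sup>2 = kq * \<rho>" unfolding \<kappa>_def using nn \<rho> by auto
      define \<eta> where "\<eta> = 2 * (\<bar>1 - I.EE Q.T\<bar> + sqrt V) + 126 * \<kappa> / \<epsilon>"
      \<comment> \<open>The diagonal sum is treated as a perturbation of the quadratic form.\<close>
      define Rm where "Rm x = (\<Sum>i\<in>{1..n}. Dg J (x i) - (LINT y|\<mu>. Dg J y)) / (\<sigma> * real n * sqrt N)" for x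
      have int_Rm: "integrable \<Omega> Rm"
        unfolding Rm_def \<Omega>_def by (intro integrable_divide_zero impI diagonal_part_le(2)[OF n])
      have Rm_le: "(LINT x|\<Omega>. \<bar>Rm x\<bar>) \<le> ch / \<sigma> * sqrt \<rho>"
      proof -
        have "(LINT x|\<Omega>. \<bar>Rm x\<bar>) = (LINT x|\<Omega>. \<bar>\<Sum>i\<in>{1..n}. Dg J (x i) - (LINT y|\<mu>. Dg J y)\<bar>) / (\<sigma> * real n * sqrt N)"
          unfolding Rm_def using \<sigma> N by (simp add: abs_divide abs_mult)
        also have "\<dots> \<le> (sqrt (real n) * (2 ^ J * ch)) / (\<sigma> * real n * sqrt N)"
          unfolding \<Omega>_def using \<sigma> N by (intro divide_right_mono diagonal_part_le(1)[OF n]) auto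
        also have "\<dots> = ch / \<sigma> * sqrt \<rho>"
        proof -
          have e: "real n = sqrt (real n) * sqrt (real n)" "2 ^ J = sqrt N * sqrt N" using N by (auto simp: N_def)
          have "sqrt (real n) * (2 ^ J * ch) / (\<sigma> * real n * sqrt N)
             = (sqrt (real n) * sqrt N) * (ch * sqrt N) / ((sqrt (real n) * sqrt N) * (\<sigma> * sqrt (real n)))"
            unfolding e(2) by (subst e(1)) (simp only: mult_ac)
          also have "\<dots> = ch * sqrt N / (\<sigma> * sqrt (real n))"
            by (rule mult_divide_mult_cancel_left) (use n N in simp)
          also have "\<dots> = ch / \<sigma> * sqrt \<rho>" unfolding \<rho>_def real_sqrt_divide by (simp only: times_divide_times_eq)
          finally show ?thesis .
        qed
        finally show ?thesis .
      qed
      have dist: "\<bar>measure \<Omega> {x \<in> space \<Omega>. Q.W x + Rm x \<le> t} - measure std_normal_distribution {..t}\<bar>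
          \<le> \<eta> + \<epsilon> + (LINT x|\<Omega>. \<bar>Rm x\<bar>) / \<epsilon>"
      proof (rule kolmogorov_distance_le)
        show "prob_space \<Omega>" unfolding \<Omega>_def by (rule I.P.prob_space_axioms)
        show "Q.W \<in> borel_measurable \<Omega>" unfolding \<Omega>_def by (rule I.bdm_measurable[OF Q.bdm_W])
        show "integrable \<Omega> Rm" by (rule int_Rm)
        show "0 < \<epsilon>" by (rule \<epsilon>)
        fix F :: "real \<Rightarrow> real"
        assume F: "\<And>x y. \<bar>F x - F y\<bar> \<le> \<bar>x - y\<bar> / \<epsilon>" "\<And>x. 0 \<le> F x" "\<And>x. F x \<le> 1"
        show "\<bar>(LINT \<omega>|\<Omega>. F (Q.W \<omega>)) - (LINT x|lborel. std_normal_density x * F x)\<bar> \<le> \<eta>"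
          unfolding \<eta>_def \<Omega>_def V_def nn_eq[symmetric]
        proof (rule Q.smooth_distance_le[OF F \<epsilon>(1,2)])
          show "24 * (real (card {1..n}) ^ 3 * b\<^sup>2 * Q.v) + 3 * (real (card {1..n}) ^ 4 * Q.g) \<le> 1"
            using V1 unfolding V_def nn_eq .
          show "I.EE Q.T \<le> 2" using s_bound le1[OF K_parts(3)] by linarith
          show "0 < \<kappa>" by (rule \<kappa>)
          show "real (card {1..n}) ^ 3 * b\<^sup>2 * Q.v \<le> \<kappa>\<^sup>2" unfolding nn_eq \<kappa>(2) by (rule q_bound)
        qed
      qed
      have W_eq: "Q.W x + Rm x = stat J n x / (\<sigma> * real n * sqrt (2 ^ J))" for x
      proof -
        have "Q.W x = c / 2 * (\<Sum>i\<in>{1..n}. \<Sum>k\<in>{1..n} - {i}. H J (x i) (x k))"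
          unfolding Q.W_def Q.D_def h_def sum_distrib_left[symmetric] by simp
        also have "\<dots> = (\<Sum>i\<in>{1..n}. \<Sum>k\<in>{1..n} - {i}. H J (x i) (x k)) / (\<sigma> * real n * sqrt N)"
          by (simp add: c_def)
        finally show ?thesis unfolding Rm_def stat_def N_def add_divide_distrib by simp
      qed
      have "\<bar>measure \<Omega> {x \<in> space \<Omega>. stat J n x / (\<sigma> * real n * sqrt (2 ^ J)) \<le> t} - measure std_normal_distribution {..t}\<bar>
          \<le> \<eta> + \<epsilon> + (LINT x|\<Omega>. \<bar>Rm x\<bar>) / \<epsilon>"
        using dist unfolding W_eq .
      also have "\<eta> + \<epsilon> + (LINT x|\<Omega>. \<bar>Rm x\<bar>) / \<epsilon> \<le> (2 * k1 + 2 * sqrt k2 + 126 * sqrt kq + 1 + ch / \<sigma>) * \<xi>"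
      proof -
        have "126 * \<kappa> / \<epsilon> = 126 * sqrt kq * (sqrt \<rho> / \<epsilon>)" unfolding \<kappa>_def real_sqrt_mult by simp
        then have 1: "126 * \<kappa> / \<epsilon> \<le> 126 * sqrt kq * \<xi>" unfolding \<epsilon>2 using \<epsilon> nn by (simp add: mult_left_mono)
        have "(LINT x|\<Omega>. \<bar>Rm x\<bar>) / \<epsilon> \<le> ch / \<sigma> * sqrt \<rho> / \<epsilon>" using Rm_le \<epsilon> by (intro divide_right_mono) auto
        also have "\<dots> = ch / \<sigma> * (sqrt \<rho> / \<epsilon>)" by simp
        also have "\<dots> \<le> ch / \<sigma> * \<xi>" unfolding \<epsilon>2 using \<epsilon> ch_nonneg \<sigma> by (intro mult_left_mono) auto
        finally have 2: "(LINT x|\<Omega>. \<bar>Rm x\<bar>) / \<epsilon> \<le> ch / \<sigma> * \<xi>" .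
        have "\<eta> + \<epsilon> + (LINT x|\<Omega>. \<bar>Rm x\<bar>) / \<epsilon>
            \<le> 2 * (k1 * \<xi> + sqrt k2 * \<xi>) + 126 * sqrt kq * \<xi> + \<xi> + ch / \<sigma> * \<xi>"
          unfolding \<eta>_def by (intro add_mono mult_left_mono s_bound sqrtV 1 2 \<epsilon>(3)) simp
        also have "\<dots> = (2 * k1 + 2 * sqrt k2 + 126 * sqrt kq + 1 + ch / \<sigma>) * \<xi>"
          by (simp add: distrib_right)
        finally show ?thesis .
      qed
      also have "\<dots> \<le> K * \<xi>" by (rule mult_right_mono[OF K_parts(5) parts(4)])
      finally show ?thesis .
    qed
  qed
qed

section \<open>The integrated squared error\<close>

text \<open>
  The integrated squared error as a function of the sample, as \<open>kernel_ise_eq\<close> shows.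
\<close>

definition ise_stat :: "nat \<Rightarrow> nat \<Rightarrow> (nat \<Rightarrow> real) \<Rightarrow> real" where
  "ise_stat J n x = (\<Sum>i\<in>{1..n}. \<Sum>k\<in>{1..n}. P J (x i) (x k)) / (real n)\<^sup>2
     - 2 * (\<Sum>i\<in>{1..n}. gP J (x i)) / real n + (LINT y|lborel. (f y)\<^sup>2)"

lemma f_sq_int: "integrable lborel (\<lambda>x. (f x)\<^sup>2)"
  using f_mult_int(2)[of "\<lambda>_. 1" 1] by simp

lemma P_col_measurable: "(\<lambda>x. P J x y) \<in> borel_measurable borel"
  using P_section[of J y] P_commute[of J y] by simp

lemma Pf_int: "integrable lborel (\<lambda>x. f x * P J x y)"
  using P_le by (intro f_mult_int(1)[OF P_col_measurable])

lemma Pf_integral: "(LINT x|lborel. f x * P J x y) = gP J y"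
proof -
  have "gP J y = (LINT x|lborel. f x * P J y x)" unfolding gP_def by (rule integral_mu) measurable
  then show ?thesis by (simp only: P_commute[of J y])
qed

lemma kernel_ise_eq:
  "(LINT x|lborel. (1 / real n * (\<Sum>i\<in>{1..n}. P J x (y i)) - f x)\<^sup>2) = ise_stat J n y"
proof -
  have ex: "(1 / real n * (\<Sum>i\<in>{1..n}. P J x (y i)) - f x)\<^sup>2
     = (\<Sum>i\<in>{1..n}. \<Sum>k\<in>{1..n}. P J x (y i) * P J x (y k)) / (real n)\<^sup>2 - 2 * (\<Sum>i\<in>{1..n}. f x * P J x (y i)) / real n + (f x)\<^sup>2" for x
  proof -
    define S where "S = (\<Sum>i\<in>{1..n}. P J x (y i))"
    have "(\<Sum>i\<in>{1..n}. \<Sum>k\<in>{1..n}. P J x (y i) * P J x (y k)) = S\<^sup>2"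
      unfolding S_def power2_eq_square sum_product ..
    moreover have "(\<Sum>i\<in>{1..n}. f x * P J x (y i)) = f x * S"
      unfolding S_def sum_distrib_left ..
    moreover have "(1 / real n * S - f x)\<^sup>2 = S\<^sup>2 / (real n)\<^sup>2 - 2 * (f x * S) / real n + (f x)\<^sup>2"
      by (simp add: power2_diff power_divide mult_ac)
    ultimately show ?thesis unfolding S_def by simp
  qed
  have i1: "integrable lborel (\<lambda>x. (\<Sum>i\<in>{1..n}. \<Sum>k\<in>{1..n}. P J x (y i) * P J x (y k)) / (real n)\<^sup>2)"
    by (intro integrable_divide_zero impI Bochner_Integration.integrable_sum P_reproducing(2))
  have i2: "integrable lborel (\<lambda>x. 2 * (\<Sum>i\<in>{1..n}. f x * P J x (y i)) / real n)"
    by (intro integrable_divide_zero impI integrable_mult_right Bochner_Integration.integrable_sum Pf_int)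
  have "(LINT x|lborel. (1 / real n * (\<Sum>i\<in>{1..n}. P J x (y i)) - f x)\<^sup>2)
     = (LINT x|lborel. (\<Sum>i\<in>{1..n}. \<Sum>k\<in>{1..n}. P J x (y i) * P J x (y k)) / (real n)\<^sup>2)
       - (LINT x|lborel. 2 * (\<Sum>i\<in>{1..n}. f x * P J x (y i)) / real n) + (LINT x|lborel. (f x)\<^sup>2)"
    unfolding ex Bochner_Integration.integral_add[OF Bochner_Integration.integrable_diff[OF i1 i2] f_sq_int]
      Bochner_Integration.integral_diff[OF i1 i2] ..
  also have "(LINT x|lborel. (\<Sum>i\<in>{1..n}. \<Sum>k\<in>{1..n}. P J x (y i) * P J x (y k)) / (real n)\<^sup>2)
     = (\<Sum>i\<in>{1..n}. \<Sum>k\<in>{1..n}. P J (y i) (y k)) / (real n)\<^sup>2"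
    by (simp add: P_reproducing Bochner_Integration.integrable_sum)
  also have "(LINT x|lborel. 2 * (\<Sum>i\<in>{1..n}. f x * P J x (y i)) / real n) = 2 * (\<Sum>i\<in>{1..n}. gP J (y i)) / real n"
    by (simp add: Pf_int Pf_integral)
  finally show ?thesis unfolding ise_stat_def .
qed

text \<open>
  Replacing \<open>P\<close> by \<open>H\<close> in the off-diagonal sum changes the linear term to \<open>- 2 / n\<^sup>2\<close> times the sum of
  the \<open>gP J (x i)\<close>; this joins the diagonal.
\<close>

lemma ise_stat_decomp:
  assumes n: "1 \<le> n"
  obtains c0 where "\<And>x. ise_stat J n x = stat J n x / (real n)\<^sup>2 + c0"
proof
  fix x :: "nat \<Rightarrow> real"
  define m where "m = (LINT y|\<mu>. Dg J y)"
  define Dsum where "Dsum = (\<Sum>i\<in>{1..n}. P J (x i) (x i))"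
  define Psum where "Psum = (\<Sum>i\<in>{1..n}. \<Sum>k\<in>{1..n} - {i}. P J (x i) (x k))"
  define gsum where "gsum = (\<Sum>i\<in>{1..n}. gP J (x i))"
  have card: "real (card ({1..n} - {i})) = real n - 1" if "i \<in> {1..n}" for i
    using that n by (simp add: of_nat_diff)
  have PP: "(\<Sum>i\<in>{1..n}. \<Sum>k\<in>{1..n}. P J (x i) (x k)) = Dsum + Psum"
    unfolding Dsum_def Psum_def sum.distrib[symmetric]
    by (intro sum.cong refl sum.remove) auto
  have row: "(\<Sum>k\<in>{1..n} - {i}. gP J (x k)) = gsum - gP J (x i)" if "i \<in> {1..n}" for i
    using sum.remove[of "{1..n}" i "\<lambda>k. gP J (x k)"] that unfolding gsum_def by simp
  have "(\<Sum>i\<in>{1..n}. \<Sum>k\<in>{1..n} - {i}. H J (x i) (x k))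
     = (\<Sum>i\<in>{1..n}. (\<Sum>k\<in>{1..n} - {i}. P J (x i) (x k)) - (real n - 1) * gP J (x i) - (gsum - gP J (x i)) + (real n - 1) * \<theta> J)"
  proof (intro sum.cong refl)
    fix i assume i: "i \<in> {1..n}"
    show "(\<Sum>k\<in>{1..n} - {i}. H J (x i) (x k)) = (\<Sum>k\<in>{1..n} - {i}. P J (x i) (x k)) - (real n - 1) * gP J (x i) - (gsum - gP J (x i)) + (real n - 1) * \<theta> J"
      unfolding H_def sum.distrib sum_subtractf sum_constant card[OF i] row[OF i] ..
  qed
  also have "\<dots> = Psum - (real n - 1) * gsum - (real n * gsum - gsum) + real n * (real n - 1) * \<theta> J"
    unfolding sum.distrib sum_subtractf Psum_def sum_distrib_left[symmetric] gsum_def[symmetric] by simp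
  finally have HH: "(\<Sum>i\<in>{1..n}. \<Sum>k\<in>{1..n} - {i}. H J (x i) (x k)) = Psum - 2 * (real n - 1) * gsum + real n * (real n - 1) * \<theta> J"
    by (simp add: algebra_simps)
  have DD: "(\<Sum>i\<in>{1..n}. Dg J (x i) - m) = Dsum - 2 * gsum - real n * m"
    unfolding Dg_def Dsum_def gsum_def by (simp add: sum_subtractf sum_distrib_left)
  have st: "stat J n x = Psum + Dsum - 2 * real n * gsum + (real n * (real n - 1) * \<theta> J - real n * m)"
    unfolding stat_def m_def[symmetric] HH DD by (simp add: algebra_simps)
  have "ise_stat J n x = (Dsum + Psum) / (real n)\<^sup>2 - 2 * gsum / real n + (LINT y|lborel. (f y)\<^sup>2)"
    unfolding ise_stat_def PP gsum_def ..
  also have "\<dots> = stat J n x / (real n)\<^sup>2 + ((LINT y|lborel. (f y)\<^sup>2) - (real n * (real n - 1) * \<theta> J - real n * m) / (real n)\<^sup>2)"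
    unfolding st using n by (simp add: field_simps power2_eq_square)
  finally show "ise_stat J n x = stat J n x / (real n)\<^sup>2
    + ((LINT y|lborel. (f y)\<^sup>2) - (real n * (real n - 1) * \<theta> J - real n * (LINT y|\<mu>. Dg J y)) / (real n)\<^sup>2)"
    unfolding m_def .
qed

lemma stat_mean:
  shows "integrable (Pi\<^sub>M {1..n} (\<lambda>_. \<mu>)) (stat J n)" and "(LINT x|Pi\<^sub>M {1..n} (\<lambda>_. \<mu>). stat J n x) = 0"
proof -
  interpret I: iid_product \<mu> "{1..n}" by unfold_locales simp
  have mH: "(\<lambda>(x, y). H J x y) \<in> borel_measurable (\<mu> \<Otimes>\<^sub>M \<mu>)" by measurable
  have mD: "Dg J \<in> borel_measurable \<mu>" by measurable
  have int_D: "integrable \<mu> (Dg J)" by (rule int_mu_bounded[OF Dg_measurable Dg_le])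
  have bH: "I.bdm (\<lambda>x. H J (x i) (x k))" if "i \<in> {1..n}" "k \<in> {1..n}" for i k
    by (rule I.EE_pair(1)[OF mH H_le that])
  have bD: "I.bdm (\<lambda>x. Dg J (x i))" if "i \<in> {1..n}" for i
    by (rule I.EE_single(2)[OF mD Dg_le that])
  have b1: "I.bdm (\<lambda>x. \<Sum>i\<in>{1..n}. \<Sum>k\<in>{1..n} - {i}. H J (x i) (x k))"
    by (intro I.bdm_sum bH) auto
  have b2: "I.bdm (\<lambda>x. \<Sum>i\<in>{1..n}. Dg J (x i) - (LINT y|\<mu>. Dg J y))"
    by (intro I.bdm_sum I.bdm_diff I.bdm_const bD)
  show "integrable (Pi\<^sub>M {1..n} (\<lambda>_. \<mu>)) (stat J n)"
    unfolding stat_def[abs_def] by (rule I.bdm_integrable[OF I.bdm_add[OF b1 b2]])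
  have "I.EE (stat J n) = I.EE (\<lambda>x. \<Sum>i\<in>{1..n}. \<Sum>k\<in>{1..n} - {i}. H J (x i) (x k)) + I.EE (\<lambda>x. \<Sum>i\<in>{1..n}. Dg J (x i) - (LINT y|\<mu>. Dg J y))"
    unfolding stat_def[abs_def] by (rule I.EE_add[OF b1 b2])
  also have "I.EE (\<lambda>x. \<Sum>i\<in>{1..n}. \<Sum>k\<in>{1..n} - {i}. H J (x i) (x k)) = (\<Sum>i\<in>{1..n}. \<Sum>k\<in>{1..n} - {i}. I.EE (\<lambda>x. H J (x i) (x k)))"
    by (subst I.EE_sum, intro I.bdm_sum bH, simp, simp, intro sum.cong refl I.EE_sum bH) auto
  also have "\<dots> = 0"
  proof (intro sum.neutral ballI)
    fix i k assume "i \<in> {1..n}" "k \<in> {1..n} - {i}"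
    then have "I.EE (\<lambda>x. H J (x i) (x k)) = (LINT x|\<mu>. LINT y|\<mu>. H J x y)"
      by (intro I.EE_pair(2)[OF mH H_le]) auto
    then show "I.EE (\<lambda>x. H J (x i) (x k)) = 0" by (simp add: H_degenerate)
  qed
  also have "I.EE (\<lambda>x. \<Sum>i\<in>{1..n}. Dg J (x i) - (LINT y|\<mu>. Dg J y)) = (\<Sum>i\<in>{1..n}. I.EE (\<lambda>x. Dg J (x i) - (LINT y|\<mu>. Dg J y)))"
    by (intro I.EE_sum I.bdm_diff I.bdm_const bD)
  also have "\<dots> = 0"
  proof (intro sum.neutral ballI)
    fix i assume i: "i \<in> {1..n}"
    have "I.EE (\<lambda>x. Dg J (x i) - (LINT y|\<mu>. Dg J y)) = I.EE (\<lambda>x. Dg J (x i)) - I.EE (\<lambda>x. (LINT y|\<mu>. Dg J y))"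
      by (intro I.EE_diff I.bdm_const bD i)
    then show "I.EE (\<lambda>x. Dg J (x i) - (LINT y|\<mu>. Dg J y)) = 0"
      unfolding I.EE_single(1)[OF mD Dg_le i] I.EE_const by simp
  qed
  finally show "(LINT x|Pi\<^sub>M {1..n} (\<lambda>_. \<mu>). stat J n x) = 0" by simp
qed

lemma sample_law:
  fixes Pm :: "'b measure" and X :: "nat \<Rightarrow> 'b \<Rightarrow> real"
  assumes Pm: "prob_space Pm" and X: "iid_with_density Pm X f" and n: "1 \<le> n"
  shows "(\<lambda>\<omega>. \<lambda>i\<in>{1..n}. X i \<omega>) \<in> Pm \<rightarrow>\<^sub>M Pi\<^sub>M {1..n} (\<lambda>_. \<mu>)"
    and "distr Pm (Pi\<^sub>M {1..n} (\<lambda>_. \<mu>)) (\<lambda>\<omega>. \<lambda>i\<in>{1..n}. X i \<omega>) = Pi\<^sub>M {1..n} (\<lambda>_. \<mu>)"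
    and "\<And>i. i \<in> {1..n} \<Longrightarrow> X i \<in> borel_measurable Pm"
    and "\<And>i. i \<in> {1..n} \<Longrightarrow> distr Pm borel (X i) = \<mu>"
proof -
  interpret prob_space Pm by fact
  have dist: "distributed Pm lborel (X i) (\<lambda>x. ennreal (f x))" if "i \<in> {1..n}" for i
    using X that by (auto simp: iid_with_density_def)
  show meas: "X i \<in> borel_measurable Pm" if "i \<in> {1..n}" for i
    using distributed_measurable[OF dist[OF that]] by simp
  show law: "distr Pm borel (X i) = \<mu>" if "i \<in> {1..n}" for i
  proof -
    have "distr Pm borel (X i) = distr Pm lborel (X i)" by (rule distr_cong) auto
    then show ?thesis unfolding \<mu>_def using distributed_distr_eq_density[OF dist[OF that]] by simp
  qed
  have "indep_vars (\<lambda>_. borel) X {1..n}"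
    using X by (auto simp: iid_with_density_def intro: indep_vars_subset)
  then have "distr Pm (Pi\<^sub>M {1..n} (\<lambda>_. borel)) (\<lambda>\<omega>. \<lambda>i\<in>{1..n}. X i \<omega>) = Pi\<^sub>M {1..n} (\<lambda>i. distr Pm borel (X i))"
    using indep_vars_iff_distr_eq_PiM'[where I = "{1..n}" and M' = "\<lambda>_. borel" and X = X] meas n by simp
  also have "\<dots> = Pi\<^sub>M {1..n} (\<lambda>_. \<mu>)" by (intro PiM_cong refl law)
  also have "distr Pm (Pi\<^sub>M {1..n} (\<lambda>_. borel)) (\<lambda>\<omega>. \<lambda>i\<in>{1..n}. X i \<omega>) = distr Pm (Pi\<^sub>M {1..n} (\<lambda>_. \<mu>)) (\<lambda>\<omega>. \<lambda>i\<in>{1..n}. X i \<omega>)"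
    by (intro distr_cong refl sets_PiM_cong) simp
  finally show "distr Pm (Pi\<^sub>M {1..n} (\<lambda>_. \<mu>)) (\<lambda>\<omega>. \<lambda>i\<in>{1..n}. X i \<omega>) = Pi\<^sub>M {1..n} (\<lambda>_. \<mu>)" .
  show "(\<lambda>\<omega>. \<lambda>i\<in>{1..n}. X i \<omega>) \<in> Pm \<rightarrow>\<^sub>M Pi\<^sub>M {1..n} (\<lambda>_. \<mu>)"
    by (intro measurable_restrict) (use meas in \<open>simp cong: measurable_cong_sets\<close>)
qed

text \<open>
  Measurability has to hold everywhere on the probability space and not only up to null sets: the
  measure need not be complete, and the measure and the integral in the statement are zero by
  convention on nonmeasurable arguments.
\<close>

lemma ise_measurable:
  fixes Pm :: "'b measure" and X :: "nat \<Rightarrow> 'b \<Rightarrow> real"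
  assumes [measurable]: "\<psi> \<in> borel_measurable borel" and X: "\<And>i. i \<in> {1..n} \<Longrightarrow> X i \<in> borel_measurable Pm"
  shows "ise f \<phi> \<psi> J X n \<in> borel_measurable Pm"
    and "\<omega> \<in> space Pm \<Longrightarrow> wavelet_estimator \<phi> \<psi> J X n \<omega> \<in> borel_measurable borel"
proof -
  have father_pair: "(\<lambda>(\<omega>, x). alpha_hat \<phi> X n \<omega> k * father \<phi> k x) \<in> borel_measurable (Pm \<Otimes>\<^sub>M lborel)" for k
    unfolding alpha_hat_def father_def split_beta' using X by measurable
  have mother_pair: "(\<lambda>(\<omega>, x). beta_hat \<psi> X n \<omega> j k * mother \<psi> j k x) \<in> borel_measurable (Pm \<Otimes>\<^sub>M lborel)" for j k
    unfolding beta_hat_def mother_def split_beta' using X by measurable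
  have pair: "(\<lambda>(\<omega>, x). wavelet_estimator \<phi> \<psi> J X n \<omega> x) \<in> borel_measurable (Pm \<Otimes>\<^sub>M lborel)"
    unfolding wavelet_estimator_def split_beta'
    by (intro borel_measurable_add borel_measurable_sum borel_measurable_infsum_int
        father_pair[unfolded split_beta'] mother_pair[unfolded split_beta'])
  have "(\<lambda>(\<omega>, x). (wavelet_estimator \<phi> \<psi> J X n \<omega> x - f x)\<^sup>2) \<in> borel_measurable (Pm \<Otimes>\<^sub>M lborel)"
    using pair unfolding split_beta' by measurable
  from lborel.borel_measurable_lebesgue_integral[OF this]
  show "ise f \<phi> \<psi> J X n \<in> borel_measurable Pm"
    unfolding ise_def[abs_def] l2norm_power2 .
  assume \<omega>: "\<omega> \<in> space Pm"
  have "(\<lambda>x. case (\<omega>, x) of (\<omega>, x) \<Rightarrow> wavelet_estimator \<phi> \<psi> J X n \<omega> x) \<in> borel_measurable lborel"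
    by (rule measurable_compose[OF _ pair]) (use \<omega> in simp)
  then show "wavelet_estimator \<phi> \<psi> J X n \<omega> \<in> borel_measurable borel" by simp
qed

lemma null_set_avoided:
  fixes Pm :: "'b measure" and X :: "nat \<Rightarrow> 'b \<Rightarrow> real"
  assumes Pm: "prob_space Pm" and X: "iid_with_density Pm X f" and n: "1 \<le> n" and N: "N \<in> null_sets lborel"
  shows "AE \<omega> in Pm. \<forall>i\<in>{1..n}. X i \<omega> \<notin> N"
proof (rule AE_finite_allI)
  fix i assume i: "i \<in> {1..n}"
  have "AE x in lborel. x \<notin> N" by (rule AE_not_in[OF N])
  then have "AE x in \<mu>. x \<notin> N" unfolding \<mu>_def by (subst AE_density) auto
  then have "AE x in distr Pm borel (X i). x \<notin> N" unfolding sample_law(4)[OF Pm X n i] .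
  then show "AE \<omega> in Pm. X i \<omega> \<notin> N" by (rule AE_distrD[OF sample_law(3)[OF Pm X n i]])
qed simp

text \<open>
  Off an event of probability zero no observation falls into the exceptional null set, and the
  estimator is the kernel estimator for almost every \<open>x\<close>.
\<close>

lemma centered_ise_law:
  fixes Pm :: "'b measure" and X :: "nat \<Rightarrow> 'b \<Rightarrow> real"
  assumes Pm: "prob_space Pm" and X: "iid_with_density Pm X f" and n: "1 \<le> n"
    and w: "compact_wavelet V \<phi> R \<psi>"
  shows "measure Pm {\<omega> \<in> space Pm. real n * 2 powr (- real_of_int (int J) / 2) * centered_ise Pm f \<phi> \<psi> (int J) X n \<omega> \<le> t}
    = measure (Pi\<^sub>M {1..n} (\<lambda>_. \<mu>)) {x \<in> space (Pi\<^sub>M {1..n} (\<lambda>_. \<mu>)). stat J n x / (real n * sqrt (2 ^ J)) \<le> t}"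
proof -
  interpret prob_space Pm by fact
  interpret w: compact_wavelet V \<phi> R \<psi> by fact
  define \<Omega> where "\<Omega> = Pi\<^sub>M {1..n} (\<lambda>_. \<mu>)"
  define Y where "Y \<omega> = (\<lambda>i\<in>{1..n}. X i \<omega>)" for \<omega>
  have Y: "Y \<in> Pm \<rightarrow>\<^sub>M \<Omega>" and law: "distr Pm \<Omega> Y = \<Omega>"
    using sample_law(1,2)[OF Pm X n] unfolding Y_def[abs_def] \<Omega>_def by auto
  note Xm = sample_law(3)[OF Pm X n]
  have psi_m: "\<psi> \<in> borel_measurable borel" by (rule L2_funD(1)[OF w.psi_L2])
  have ise_m: "ise f \<phi> \<psi> (int J) X n \<in> borel_measurable Pm" by (rule ise_measurable(1)[OF psi_m Xm])
  obtain N where N: "N \<in> null_sets lborel" and est: "\<forall>(X :: nat \<Rightarrow> 'b \<Rightarrow> real) n \<omega> x. x \<notin> N \<longrightarrow> (\<forall>i\<in>{1..n}. X i \<omega> \<notin> N) \<longrightarrow>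
      wavelet_estimator \<phi> \<psi> (int J) X n \<omega> x = (1 / real n) * (\<Sum>i=1..n. P J x (X i \<omega>))"
    using w.estimator_eq_kernel[where 'a = 'b, of J] by (rule bexE)
  obtain c0 where c0: "\<And>x. ise_stat J n x = stat J n x / (real n)\<^sup>2 + c0"
    by (rule ise_stat_decomp[OF n, of J]) (rule that; assumption)
  have st_m: "stat J n \<in> borel_measurable \<Omega>" using stat_mean(1)[of n J] unfolding \<Omega>_def by auto
  have st_Y: "stat J n (Y \<omega>) = stat J n (\<lambda>i. X i \<omega>)" for \<omega>
    unfolding stat_def Y_def by (intro arg_cong2[where f="(+)"] sum.cong refl) auto
  have ae: "AE \<omega> in Pm. ise f \<phi> \<psi> (int J) X n \<omega> = stat J n (Y \<omega>) / (real n)\<^sup>2 + c0"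
    using null_set_avoided[OF Pm X n N] AE_space
  proof eventually_elim
    case (elim \<omega>)
    have "ise f \<phi> \<psi> (int J) X n \<omega> = (LINT x|lborel. (wavelet_estimator \<phi> \<psi> (int J) X n \<omega> x - f x)\<^sup>2)"
      unfolding ise_def l2norm_power2 ..
    also have "\<dots> = (LINT x|lborel. (1 / real n * (\<Sum>i\<in>{1..n}. P J x (X i \<omega>)) - f x)\<^sup>2)"
    proof (rule integral_cong_AE)
      show "AE x in lborel. (wavelet_estimator \<phi> \<psi> (int J) X n \<omega> x - f x)\<^sup>2 = (1 / real n * (\<Sum>i\<in>{1..n}. P J x (X i \<omega>)) - f x)\<^sup>2"
        using AE_not_in[OF N]
      proof eventually_elim
        case (elim x)
        have "wavelet_estimator \<phi> \<psi> (int J) X n \<omega> x = (1 / real n) * (\<Sum>i=1..n. P J x (X i \<omega>))"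
          by (rule est[rule_format]) (use elim \<open>\<forall>i\<in>{1..n}. X i \<omega> \<notin> N\<close> in blast)+
        then show ?case by (simp only:)
      qed
      have [measurable]: "wavelet_estimator \<phi> \<psi> (int J) X n \<omega> \<in> borel_measurable borel"
        by (rule ise_measurable(2)[OF psi_m Xm]) (use elim in auto)
      show "(\<lambda>x. (wavelet_estimator \<phi> \<psi> (int J) X n \<omega> x - f x)\<^sup>2) \<in> borel_measurable lborel" by measurable
      show "(\<lambda>x. (1 / real n * (\<Sum>i\<in>{1..n}. P J x (X i \<omega>)) - f x)\<^sup>2) \<in> borel_measurable lborel"
        using P_col_measurable by measurable
    qed
    also have "\<dots> = ise_stat J n (\<lambda>i. X i \<omega>)" by (rule kernel_ise_eq)
    finally show ?case unfolding c0 st_Y .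
  qed
  have "(LINT \<omega>|Pm. ise f \<phi> \<psi> (int J) X n \<omega>) = (LINT \<omega>|Pm. stat J n (Y \<omega>) / (real n)\<^sup>2 + c0)"
    by (rule integral_cong_AE[OF ise_m _ ae]) (use measurable_compose[OF Y st_m] in measurable)
  also have "\<dots> = (LINT x|distr Pm \<Omega> Y. stat J n x / (real n)\<^sup>2 + c0)"
    by (rule integral_distr[symmetric, OF Y]) (use st_m in measurable)
  also have "\<dots> = c0"
  proof -
    interpret O: prob_space \<Omega> unfolding \<Omega>_def by (rule prob_space_PiM) (rule prob_mu)
    show ?thesis unfolding law using stat_mean[of n J] O.prob_space unfolding \<Omega>_def[symmetric] by simp
  qed
  finally have mean: "(LINT \<omega>|Pm. ise f \<phi> \<psi> (int J) X n \<omega>) = c0" .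
  have scale: "real n * 2 powr (- real_of_int (int J) / 2) * (s / (real n)\<^sup>2) = s / (real n * sqrt (2 ^ J))" for s
  proof -
    have "2 powr (- real_of_int (int J) / 2) = 1 / sqrt (2 ^ J)"
      by (simp add: powr_minus_divide powr_half_sqrt_powr powr_realpow)
    then show ?thesis using n by (simp add: power2_eq_square)
  qed
  let ?A = "{x \<in> space \<Omega>. stat J n x / (real n * sqrt (2 ^ J)) \<le> t}"
  have A: "?A \<in> sets \<Omega>" using st_m by measurable
  have "measure Pm {\<omega> \<in> space Pm. real n * 2 powr (- real_of_int (int J) / 2) * centered_ise Pm f \<phi> \<psi> (int J) X n \<omega> \<le> t}
      = measure Pm (Y -` ?A \<inter> space Pm)"
  proof (rule measure_eq_AE)
    show "AE \<omega> in Pm. \<omega> \<in> {\<omega> \<in> space Pm. real n * 2 powr (- real_of_int (int J) / 2) * centered_ise Pm f \<phi> \<psi> (int J) X n \<omega> \<le> t}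
       \<longleftrightarrow> \<omega> \<in> Y -` ?A \<inter> space Pm"
      using ae AE_space
    proof eventually_elim
      case (elim \<omega>)
      have "centered_ise Pm f \<phi> \<psi> (int J) X n \<omega> = stat J n (Y \<omega>) / (real n)\<^sup>2"
        unfolding centered_ise_def mean using elim by simp
      moreover have "Y \<omega> \<in> space \<Omega>" using Y elim by (auto dest: measurable_space)
      ultimately show ?case using elim by (simp only: scale mem_Collect_eq vimage_eq Int_iff simp_thms)
    qed
    show "{\<omega> \<in> space Pm. real n * 2 powr (- real_of_int (int J) / 2) * centered_ise Pm f \<phi> \<psi> (int J) X n \<omega> \<le> t} \<in> sets Pm"
      using ise_m unfolding centered_ise_def by measurable
    show "Y -` ?A \<inter> space Pm \<in> sets Pm" by (rule measurable_sets[OF Y A])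
  qed
  also have "\<dots> = measure (distr Pm \<Omega> Y) ?A" by (rule measure_distr[symmetric, OF Y A])
  finally show ?thesis unfolding law unfolding \<Omega>_def .
qed

end

section \<open>The rate of convergence\<close>

lemma same_order_eventually_bounds:
  assumes "same_order a c" and pos: "\<forall>\<^sub>F n in sequentially. 0 < c n"
  obtains l u where "0 < l" "0 < u" "\<forall>\<^sub>F n in sequentially. l * c n \<le> a n \<and> a n \<le> u * c n"
proof -
  let ?r = "\<lambda>n. ereal (a n / c n)"
  have "0 < liminf ?r" "limsup ?r < \<infinity>" using assms(1) by (auto simp: same_order_def)
  then obtain l u where l: "0 < ereal l" "ereal l < liminf ?r" and u: "limsup ?r < ereal u"
    using ereal_dense2 by blast
  have "\<forall>\<^sub>F n in sequentially. l * c n \<le> a n \<and> a n \<le> max u 1 * c n"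
    using pos less_LiminfD[OF l(2)] Limsup_lessD[OF u]
  proof eventually_elim
    case (elim n)
    then have "l < a n / c n" "a n / c n < u" by auto
    then have "l * c n \<le> a n" "a n \<le> u * c n" using elim(1) by (simp_all add: field_simps)
    moreover have "u * c n \<le> max u 1 * c n" using elim(1) by (intro mult_right_mono) auto
    ultimately show ?case by linarith
  qed
  then show thesis using l by (intro that[of l "max u 1"]) auto
qed

text \<open>
  The bound \<open>\<delta> < 1/3\<close> leaves room: \<open>(1 - \<delta>) / 4\<close> and \<open>\<delta> / 2\<close> both exceed \<open>3 \<delta> / 16\<close>. The logarithm is at least
  \<open>1\<close> from \<open>n = 3\<close> on.
\<close>

lemma rate_le:
  assumes le: "l * real n powr (- \<delta>) \<le> 1 / 2 ^ J" "1 / 2 ^ J \<le> u * real n powr (- \<delta>)"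
    and l: "0 < l" and u: "0 < u" and n: "3 \<le> n" and \<delta>: "0 < \<delta>" "\<delta> < 1 / 3" and \<alpha>: "0 < \<alpha>"
  shows "(1 / 2 ^ J) powr \<alpha> + 1 / sqrt (2 ^ J) + (2 ^ J / real n) powr (1 / 4)
    \<le> (u powr \<alpha> + u powr (1 / 2) + (1 / l) powr (1 / 4)) * max (real n powr (- (3 * \<delta> / 16))) (real n powr (- (\<alpha> * \<delta>)) * sqrt (ln (real n)))"
    (is "_ \<le> _ * ?m")
proof -
  define x where "x = real n"
  have x: "3 \<le> x" using n by (simp add: x_def)
  have m1: "x powr (- (3 * \<delta> / 16)) \<le> ?m" by (simp add: x_def)
  have m2: "x powr (- (\<alpha> * \<delta>)) \<le> ?m"
  proof -
    have "exp 1 \<le> x" using exp_le x by linarith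
    then have "1 \<le> ln x" using x by (subst ln_ge_iff) auto
    then have "1 \<le> sqrt (ln x)" by simp
    then have "x powr (- (\<alpha> * \<delta>)) * 1 \<le> x powr (- (\<alpha> * \<delta>)) * sqrt (ln x)" by (intro mult_left_mono) auto
    then show ?thesis by (simp add: x_def)
  qed
  have a: "(1 / 2 ^ J) powr \<alpha> \<le> u powr \<alpha> * ?m"
  proof -
    have "(1 / 2 ^ J) powr \<alpha> \<le> (u * x powr (- \<delta>)) powr \<alpha>" using le \<alpha> by (intro powr_mono2) (auto simp: x_def)
    also have "\<dots> = u powr \<alpha> * x powr (- (\<alpha> * \<delta>))" using u by (simp add: powr_mult powr_powr mult.commute)
    also have "\<dots> \<le> u powr \<alpha> * ?m" by (intro mult_left_mono m2) simp
    finally show ?thesis .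
  qed
  have b: "1 / sqrt (2 ^ J) \<le> u powr (1 / 2) * ?m"
  proof -
    have "1 / sqrt (2 ^ J) = (1 / 2 ^ J) powr (1 / 2)" by (simp add: powr_half_sqrt real_sqrt_divide)
    also have "\<dots> \<le> (u * x powr (- \<delta>)) powr (1 / 2)" using le by (intro powr_mono2) (auto simp: x_def)
    also have "\<dots> = u powr (1 / 2) * x powr (- \<delta> * (1 / 2))" using u by (simp only: powr_mult powr_powr powr_ge_zero)
    also have "\<dots> \<le> u powr (1 / 2) * x powr (- (3 * \<delta> / 16))" using x \<delta> by (intro mult_left_mono powr_mono) auto
    also have "\<dots> \<le> u powr (1 / 2) * ?m" by (intro mult_left_mono m1) simp
    finally show ?thesis .
  qed
  have c: "(2 ^ J / real n) powr (1 / 4) \<le> (1 / l) powr (1 / 4) * ?m"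
  proof -
    have "l * x powr (- \<delta>) * 2 ^ J \<le> 1" using le(1) by (simp add: field_simps x_def)
    then have "2 ^ J \<le> 1 / l * x powr \<delta>" using l x by (simp add: powr_minus field_simps)
    then have "2 ^ J / x \<le> 1 / l * x powr \<delta> / x" using x by (intro divide_right_mono) auto
    also have "1 / l * x powr \<delta> / x = 1 / l * x powr (\<delta> - 1)" using x by (simp add: powr_diff)
    finally have "(2 ^ J / x) powr (1 / 4) \<le> (1 / l * x powr (\<delta> - 1)) powr (1 / 4)"
      using x by (intro powr_mono2) auto
    also have "\<dots> = (1 / l) powr (1 / 4) * x powr ((\<delta> - 1) * (1 / 4))" by (simp only: powr_mult powr_powr)
    also have "\<dots> \<le> (1 / l) powr (1 / 4) * x powr (- (3 * \<delta> / 16))" using x \<delta> by (intro mult_left_mono powr_mono) auto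
    also have "\<dots> \<le> (1 / l) powr (1 / 4) * ?m" by (intro mult_left_mono m1) simp
    finally show ?thesis by (simp only: x_def)
  qed
  show ?thesis unfolding distrib_right by (intro add_mono a b c)
qed

theorem theorem1p2:
  fixes f \<phi> :: "real \<Rightarrow> real" and j :: "nat \<Rightarrow> int" and \<delta> \<alpha> L \<sigma> :: real
  assumes f_nonneg: "\<And>x. 0 \<le> f x"
    and f_bounded: "bounded (range f)"
    and phi_scaling: "scaling_function \<phi>"
    and phi_bounded: "bounded (range \<phi>)"
    and phi_supp: "\<exists>S. compact S \<and> (\<forall>x. x \<notin> S \<longrightarrow> \<phi> x = 0)"
    and j_lim: "filterlim j at_top sequentially"
    and delta: "0 < \<delta>" "\<delta> < 1 / 3"
    and j_order: "same_order (\<lambda>n. 2 powr (- real_of_int (j n))) (\<lambda>n. real n powr (- \<delta>))"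
    and L: "0 \<le> L"
    and alpha: "0 < \<alpha>" "\<alpha> \<le> 1"
    and f_holder: "holder_on {-L..L} \<alpha> f"
    and f_incr: "mono_on {..-L} f"
    and f_decr: "antimono_on {L..} f"
    and sigma: "\<sigma>\<^sup>2 = 2 * (LINT x|lborel. (f x)\<^sup>2)" "0 < \<sigma>"
  shows "\<exists>C::real. \<forall>(\<psi>::real \<Rightarrow> real) (M::'a measure) (X::nat \<Rightarrow> 'a \<Rightarrow> real).
           wavelet_function \<phi> \<psi> \<longrightarrow> prob_space M \<longrightarrow> iid_with_density M X f \<longrightarrow>
           (\<forall>n\<ge>1.
              (SUP t::real.
                 \<bar>measure M {\<omega> \<in> space M.
                      real n * 2 powr (- real_of_int (j n) / 2) * centered_ise M f \<phi> \<psi> (j n) X n \<omega> \<le> t}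
                  - measure std_normal_distribution {z. \<sigma> * z \<le> t}\<bar>)
              \<le> C * max (real n powr (- (3 * \<delta> / 16)))
                         (real n powr (- (\<alpha> * \<delta>)) * sqrt (ln (real n))))"
proof (cases "\<exists>(M::'a measure) (X::nat \<Rightarrow> 'a \<Rightarrow> real). prob_space M \<and> iid_with_density M X f")
  case False
  then show ?thesis by blast
next
  case True
  then obtain M0 :: "'a measure" and X0 where M0: "prob_space M0" and X0: "iid_with_density M0 X0 f" by blast
  have dist: "distributed M0 lborel (X0 1) (\<lambda>x. ennreal (f x))" using X0 by (simp add: iid_with_density_def)
  have f_meas [measurable]: "f \<in> borel_measurable borel"
    using distributed_real_measurable[OF _ dist] f_nonneg by simp
  have "(\<integral>\<^sup>+x. ennreal (f x) \<partial>lborel) = 1"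
  proof -
    interpret prob_space M0 by fact
    have "prob_space (distr M0 lborel (X0 1))" using distributed_measurable[OF dist] by (rule prob_space_distr)
    then have "emeasure (density lborel (\<lambda>x. ennreal (f x))) UNIV = 1"
      unfolding distributed_distr_eq_density[OF dist] using prob_space.emeasure_space_1 by fastforce
    then show ?thesis by (simp add: emeasure_density)
  qed
  then have f_int: "integrable lborel f" and f_one: "(LINT x|lborel. f x) = 1"
    using f_nonneg by (auto simp: integrable_iff_bounded integral_eq_nn_integral)
  obtain Mf where Mf: "\<And>x. f x \<le> Mf"
    using f_bounded unfolding bounded_iff by (auto simp: abs_le_iff)
  obtain B where B: "\<And>x. \<bar>\<phi> x\<bar> \<le> B" using phi_bounded unfolding bounded_iff by auto
  obtain R where R: "0 < R" "\<And>x. R < \<bar>x\<bar> \<Longrightarrow> \<phi> x = 0"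
  proof -
    obtain S where S: "compact S" "\<forall>x. x \<notin> S \<longrightarrow> \<phi> x = 0" using phi_supp by blast
    from compact_imp_bounded[OF S(1)] obtain R where R: "0 < R" "\<And>x. x \<in> S \<Longrightarrow> \<bar>x\<bar> \<le> R"
      unfolding bounded_pos by auto
    show thesis
    proof (rule that[OF R(1)])
      fix x assume "R < \<bar>x\<bar>"
      then have "x \<notin> S" using R(2)[of x] by auto
      then show "\<phi> x = 0" using S(2) by blast
    qed
  qed
  obtain V0 where V0: "orthonormal_mra V0 \<phi>" using phi_scaling unfolding scaling_function_def by blast
  interpret m0: mra V0 \<phi> by unfold_locales (rule V0)
  obtain C where C: "0 \<le> C" "\<And>t. \<bar>t\<bar> \<le> 1 \<Longrightarrow> (LINT x|lborel. \<bar>f (x + t) - f x\<bar>) \<le> C * \<bar>t\<bar> powr \<alpha>"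
    by (rule L1_modulus_of_continuity[OF f_meas f_int f_nonneg Mf L alpha f_holder f_incr f_decr]) (rule that, assumption, blast)
  interpret smoothed_density \<phi> R B f Mf C \<alpha>
    by unfold_locales
      (fact B R m0.phi_L2 m0.father_orth L2_funD(1)[OF m0.phi_L2] f_meas f_nonneg Mf f_int f_one C alpha)+
  obtain K where K: "\<And>J n t. 1 \<le> n \<Longrightarrow>
    \<bar>measure (Pi\<^sub>M {1..n} (\<lambda>_. \<mu>)) {x \<in> space (Pi\<^sub>M {1..n} (\<lambda>_. \<mu>)). stat J n x / (\<sigma> * real n * sqrt (2 ^ J)) \<le> t}
      - measure std_normal_distribution {..t}\<bar> \<le> K * rate J n"
    by (rule stat_normal_approximation[OF sigma(2,1)]) blast
  define m where "m n = max (real n powr (- (3 * \<delta> / 16))) (real n powr (- (\<alpha> * \<delta>)) * sqrt (ln (real n)))" for n :: nat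
  have m_pos: "0 < m n" if "1 \<le> n" for n
    unfolding m_def using that by (intro less_max_iff_disj[THEN iffD2] disjI1) simp
  have "\<forall>\<^sub>F n in sequentially. 0 < real n powr (- \<delta>)"
    using eventually_gt_at_top[of 0] by eventually_elim simp
  from same_order_eventually_bounds[OF j_order this] obtain l u where lu: "0 < l" "0 < u"
    and ev: "\<forall>\<^sub>F n in sequentially. l * real n powr (- \<delta>) \<le> 2 powr (- real_of_int (j n)) \<and> 2 powr (- real_of_int (j n)) \<le> u * real n powr (- \<delta>)" .
  have "\<forall>\<^sub>F n in sequentially. 0 \<le> j n" using j_lim by (simp add: filterlim_at_top)
  with ev eventually_ge_at_top[of 3] have "\<forall>\<^sub>F n in sequentially. 3 \<le> n \<and> 0 \<le> j n \<and>
      l * real n powr (- \<delta>) \<le> 2 powr (- real_of_int (j n)) \<and> 2 powr (- real_of_int (j n)) \<le> u * real n powr (- \<delta>)"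
    by eventually_elim (elim conjE, intro conjI)
  then obtain n0 where n0: "\<And>n. n0 \<le> n \<Longrightarrow> 3 \<le> n \<and> 0 \<le> j n \<and>
      l * real n powr (- \<delta>) \<le> 2 powr (- real_of_int (j n)) \<and> 2 powr (- real_of_int (j n)) \<le> u * real n powr (- \<delta>)"
    unfolding eventually_sequentially by blast
  define k where "k = u powr \<alpha> + u powr (1 / 2) + (1 / l) powr (1 / 4)"
  \<comment> \<open>The finite sum makes the bound trivial for the finitely many small \<open>n\<close>.\<close>
  define CC where "CC = \<bar>K\<bar> * k + (\<Sum>n\<in>{1..<n0}. 1 / m n)"
  have k: "0 \<le> k" unfolding k_def by simp
  have s0: "0 \<le> (\<Sum>n\<in>{1..<n0}. 1 / m n)" by (intro sum_nonneg) (use m_pos in \<open>simp add: less_imp_le\<close>)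
  interpret N01: prob_space std_normal_distribution by (rule prob_space_normal_density) simp
  show ?thesis
  proof (intro exI[of _ CC] allI impI)
    fix \<psi> and M :: "'a measure" and X and n :: nat
    assume w: "wavelet_function \<phi> \<psi>" and M: "prob_space M" and X: "iid_with_density M X f" and n: "1 \<le> n"
    interpret M: prob_space M by fact
    let ?d = "\<lambda>t. \<bar>measure M {\<omega> \<in> space M. real n * 2 powr (- real_of_int (j n) / 2) * centered_ise M f \<phi> \<psi> (j n) X n \<omega> \<le> t}
                  - measure std_normal_distribution {z. \<sigma> * z \<le> t}\<bar>"
    have "?d t \<le> CC * m n" for t
    proof (cases "n < n0")
      case True
      have "1 / m n \<le> (\<Sum>n\<in>{1..<n0}. 1 / m n)"
        by (rule member_le_sum) (use True n m_pos in \<open>auto simp: less_imp_le\<close>)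
      then have "1 / m n \<le> CC" unfolding CC_def using k by (simp add: add_increasing)
      then have "1 \<le> CC * m n" using m_pos[OF n] by (simp add: field_simps)
      moreover have "?d t \<le> 1"
      proof -
        have "\<bar>a - b\<bar> \<le> 1" if "0 \<le> a" "a \<le> 1" "0 \<le> b" "b \<le> 1" for a b :: real
          using that by linarith
        from this[OF measure_nonneg M.prob_le_1 measure_nonneg N01.prob_le_1] show ?thesis .
      qed
      ultimately show ?thesis by linarith
    next
      case False
      then have n0': "3 \<le> n" "0 \<le> j n" "l * real n powr (- \<delta>) \<le> 2 powr (- real_of_int (j n))" "2 powr (- real_of_int (j n)) \<le> u * real n powr (- \<delta>)"
        using n0[of n] by auto
      define J where "J = nat (j n)"
      have jJ: "j n = int J" using n0'(2) by (simp add: J_def)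
      have pw: "2 powr (- real_of_int (j n)) = 1 / 2 ^ J" unfolding jJ by (simp add: powr_minus_divide powr_realpow)
      obtain V where "orthonormal_mra V \<phi>" "\<psi> \<in> V 1" "L2_orthonormal_basis (wavelet_system \<phi> \<psi>) L2_fun"
        using w unfolding wavelet_function_def by blast
      then have cw: "compact_wavelet V \<phi> R \<psi>"
        by unfold_locales (assumption | rule R(2))+
      have ev_eq: "{x \<in> space (Pi\<^sub>M {1..n} (\<lambda>_. \<mu>)). stat J n x / (real n * sqrt (2 ^ J)) \<le> t}
          = {x \<in> space (Pi\<^sub>M {1..n} (\<lambda>_. \<mu>)). stat J n x / (\<sigma> * real n * sqrt (2 ^ J)) \<le> t / \<sigma>}"
        using sigma(2) n by (intro Collect_cong conj_cong refl) (simp add: field_simps)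
      have "{z. \<sigma> * z \<le> t} = {..t / \<sigma>}" using sigma(2) by (auto simp: field_simps)
      then have "?d t = \<bar>measure (Pi\<^sub>M {1..n} (\<lambda>_. \<mu>)) {x \<in> space (Pi\<^sub>M {1..n} (\<lambda>_. \<mu>)). stat J n x / (\<sigma> * real n * sqrt (2 ^ J)) \<le> t / \<sigma>}
          - measure std_normal_distribution {..t / \<sigma>}\<bar>"
        unfolding jJ centered_ise_law[OF M X n cw] ev_eq by simp
      also have "\<dots> \<le> K * rate J n" by (rule K[OF n])
      also have "\<dots> \<le> \<bar>K\<bar> * rate J n" unfolding rate_def by (intro mult_right_mono) auto
      also have "\<dots> \<le> \<bar>K\<bar> * (k * m n)"
        unfolding rate_def k_def m_def
        by (intro mult_left_mono rate_le[OF n0'(3,4)[unfolded pw] lu n0'(1) delta alpha(1)]) simp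
      also have "\<dots> \<le> CC * m n"
        unfolding CC_def distrib_right mult.assoc using s0 m_pos[OF n] by simp
      finally show ?thesis .
    qed
    then have "(SUP t. ?d t) \<le> CC * m n" by (intro cSUP_least) auto
    then show "(SUP t::real. ?d t) \<le> CC * max (real n powr (- (3 * \<delta> / 16))) (real n powr (- (\<alpha> * \<delta>)) * sqrt (ln (real n)))"
      unfolding m_def .
  qed
qed

end
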